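(* Let $m>1$, $m\ge N\ge1$, $p>0$, $q,\mu\in\mathbb{R}$ and $\alpha\in(0,N)$. Then the inequality $$-\Delta_m u-\frac{\mu}{|x|^m}u^{m-1}\ge (I_\alpha*u^p)u^q\quad\text{in }\mathbb{R}^N\setminus\overline{B}_1 \tag{P}$$ has a positive solution if and only if all of the following hold: (i) $\mu<0$; (ii) $p>\frac{\alpha}{|\beta^-|}$; (iii) $p+q>m-1+\frac{m+\alpha}{|\beta^-|}$; (iv) $q>m-1-\frac{N-m-\alpha}{|\beta^-|}$. (Under (i), $\beta^\pm$ are well defined and $\beta^-<0<\beta^+$.)
   Context: $B_r$ denotes the open ball of radius $r$ centered at the origin in $\mathbb{R}^N$. $\Delta_m u=\operatorname{div}(|\nabla u|^{m-2}\nabla u)$. For $\alpha\in(0,N)$, $I_\alpha(x)=A_\alpha|x|^{\alpha-N}$ with $A_\alpha=\frac{\Gamma((N-\alpha)/2)}{\Gamma(\alpha/2)\pi^{N/2}2^\alpha}$, and $(I_\alpha*g)(x)=\int_{\mathbb{R}^N\setminus\overline B_1}I_\alpha(x-y)g(y)\,dy$. A positive solution of (P) is a function $u\in W^{1,m}_{loc}(\mathbb{R}^N\setminus\overline B_1)\cap C(\mathbb{R}^N\setminus\overline B_1)$ such that: $u>0$ and $(I_\alpha*u^p)u^q\in L^1_{loc}(\mathbb{R}^N\setminus\overline B_1)$; $\int_{\mathbb{R}^N\setminus\overline B_1}\frac{u^p(y)}{1+|y|^{N-\alpha}}dy<\infty$; and for every $\phi\in C_c^\infty(\mathbb{R}^N\setminus\overline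 B_1)$ with $\phi\ge0$, $\int_{\mathbb{R}^N\setminus\overline B_1}\big(|\nabla u|^{m-2}\nabla u\cdot\nabla\phi-\frac{\mu}{|x|^m}u^{m-1}\phi\big)\ge\int_{\mathbb{R}^N\setminus\overline B_1}(I_\alpha*u^p)u^q\phi$. $C_H=\left|\frac{N-m}{m}\right|^m$. Let $G(\beta)=-\beta|\beta|^{m-2}(\beta(m-1)+N-m)$. For $\mu\le C_H$, $\{\beta:G(\beta)\ge\mu\}=[\beta^-,\beta^+]$, where $\beta^-\le\beta^+$ are the real solutions of $G(\beta)=\mu$. *)

theory Defs
  imports "HOL-Analysis.Analysis"
begin

definition ext_dom :: "'a::euclidean_space set" where
  "ext_dom = - cball 0 1"

fun Ck :: "nat \<Rightarrow> ('a::euclidean_space \<Rightarrow> real) \<Rightarrow> bool" where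
  "Ck 0 f = continuous_on UNIV f"
| "Ck (Suc k) f = (continuous_on UNIV f \<and> (\<forall>x. f differentiable (at x)) \<and>
      (\<forall>b\<in>Basis. Ck k (\<lambda>x. frechet_derivative f (at x) b)))"

definition smooth_fun :: "('a::euclidean_space \<Rightarrow> real) \<Rightarrow> bool" where
  "smooth_fun f \<longleftrightarrow> (\<forall>k. Ck k f)"

definition tsupport :: "('a::euclidean_space \<Rightarrow> real) \<Rightarrow> 'a set" where
  "tsupport f = closure {x. f x \<noteq> 0}"

definition test_fun :: "'a::euclidean_space set \<Rightarrow> ('a \<Rightarrow> real) \<Rightarrow> bool" where
  "test_fun \<Omega> \<phi> \<longleftrightarrow> smooth_fun \<phi> \<and> compact (tsupport \<phi>) \<and> tsupport \<phi> \<subseteq> \<Omega>"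

definition grad :: "('a::euclidean_space \<Rightarrow> real) \<Rightarrow> 'a \<Rightarrow> 'a" where
  "grad f x = (\<Sum>b\<in>Basis. frechet_derivative f (at x) b *\<^sub>R b)"

definition Lloc :: "real \<Rightarrow> 'a::euclidean_space set \<Rightarrow> ('a \<Rightarrow> real) \<Rightarrow> bool" where
  "Lloc r \<Omega> f \<longleftrightarrow> (\<forall>K. compact K \<and> K \<subseteq> \<Omega> \<longrightarrow>
      set_integrable lebesgue K f \<and> set_integrable lebesgue K (\<lambda>x. \<bar>f x\<bar> powr r))"

definition weak_grad :: "'a::euclidean_space set \<Rightarrow> ('a \<Rightarrow> real) \<Rightarrow> ('a \<Rightarrow> 'a) \<Rightarrow> bool" where
  "weak_grad \<Omega> u Du \<longleftrightarrow> set_borel_measurable lebesgue \<Omega> Du \<and>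
     Lloc 1 \<Omega> u \<and> Lloc 1 \<Omega> (\<lambda>x. norm (Du x)) \<and>
     (\<forall>\<phi>. test_fun \<Omega> \<phi> \<longrightarrow> (\<forall>b\<in>Basis.
        (LINT x:\<Omega>|lebesgue. u x * frechet_derivative \<phi> (at x) b)
          = - (LINT x:\<Omega>|lebesgue. (Du x \<bullet> b) * \<phi> x)))"

definition W1loc :: "real \<Rightarrow> 'a::euclidean_space set \<Rightarrow> ('a \<Rightarrow> real) \<Rightarrow> ('a \<Rightarrow> 'a) \<Rightarrow> bool" where
  "W1loc m \<Omega> u Du \<longleftrightarrow> weak_grad \<Omega> u Du \<and> Lloc m \<Omega> u \<and> Lloc m \<Omega> (\<lambda>x. norm (Du x))"

definition riesz_const :: "nat \<Rightarrow> real \<Rightarrow> real" where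
  "riesz_const N \<alpha> = Gamma ((real N - \<alpha>) / 2) / (Gamma (\<alpha> / 2) * pi powr (real N / 2) * 2 powr \<alpha>)"

definition riesz_kernel :: "real \<Rightarrow> 'a::euclidean_space \<Rightarrow> real" where
  "riesz_kernel \<alpha> x = riesz_const DIM('a) \<alpha> * norm x powr (\<alpha> - real DIM('a))"

definition riesz_conv :: "real \<Rightarrow> ('a::euclidean_space \<Rightarrow> real) \<Rightarrow> 'a \<Rightarrow> ennreal" where
  "riesz_conv \<alpha> g x = (\<integral>\<^sup>+ y. indicator ext_dom y * ennreal (riesz_kernel \<alpha> (x - y) * g y) \<partial>lebesgue)"

definition pos_solution :: "real \<Rightarrow> real \<Rightarrow> real \<Rightarrow> real \<Rightarrow> real \<Rightarrow> ('a::euclidean_space \<Rightarrow> real) \<Rightarrow> bool" where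
  "pos_solution m \<mu> p q \<alpha> u \<longleftrightarrow>
     continuous_on ext_dom u \<and> (\<forall>x\<in>ext_dom. u x > 0) \<and>
     (\<exists>Du. W1loc m ext_dom u Du \<and>
       (\<forall>K. compact K \<and> K \<subseteq> ext_dom \<longrightarrow>
          (\<integral>\<^sup>+ x. indicator K x * riesz_conv \<alpha> (\<lambda>y. u y powr p) x * ennreal (u x powr q) \<partial>lebesgue) < \<infinity>) \<and>
       (\<integral>\<^sup>+ y. indicator ext_dom y * ennreal (u y powr p / (1 + norm y powr (real DIM('a) - \<alpha>))) \<partial>lebesgue) < \<infinity> \<and>
       (\<forall>\<phi>. test_fun ext_dom \<phi> \<and> (\<forall>x. \<phi> x \<ge> 0) \<longrightarrow>
          (LINT x:ext_dom|lebesgue. norm (Du x) powr (m - 2) * (Du x \<bullet> grad \<phi> x)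
               - \<mu> / norm x powr m * u x powr (m - 1) * \<phi> x)
          \<ge> enn2real (\<integral>\<^sup>+ x. indicator ext_dom x * riesz_conv \<alpha> (\<lambda>y. u y powr p) x
                              * ennreal (u x powr q * \<phi> x) \<partial>lebesgue)))"

definition Gfun :: "real \<Rightarrow> nat \<Rightarrow> real \<Rightarrow> real" where
  "Gfun m N \<beta> = - \<beta> * \<bar>\<beta>\<bar> powr (m - 2) * (\<beta> * (m - 1) + real N - m)"

text \<open>beta^- = left endpoint of {beta. G(beta) >= mu} = [beta^-, beta^+].\<close>
definition beta_minus :: "real \<Rightarrow> nat \<Rightarrow> real \<Rightarrow> real" where
  "beta_minus m N \<mu> = Inf {\<beta>. Gfun m N \<beta> \<ge> \<mu>}"

end

theory Submission
  imports Defs "HOL-Real_Asymp.Real_Asymp"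
begin

text \<open>
  Put \<open>K(b) = - G(-b)\<close>, so that \<open>|\<beta>\<^sup>-| = b\<close> is the root of \<open>K(b) = - \<mu>\<close> when \<open>\<mu> < 0\<close>; the power
  \<open>|x| powr (-b)\<close> solves \<open>-\<Delta>\<^sub>m w + K(b) |x| powr (-m) w powr (m-1) = 0\<close>.

  Necessity. If \<open>u\<close> is a supersolution of this equation near infinity, comparison with
  \<open>c |x| powr (-b) - \<epsilon>\<close> gives \<open>u \<ge> c |x| powr (-b)\<close>, and then integrability of
  \<open>u powr p / |y| powr (N-\<alpha>)\<close> forces \<open>p b > \<alpha>\<close>. Hence the Hardy constant of a supersolution
  must exceed \<open>K(\<alpha>/p) > 0\<close>, which yields (i) and (ii). The nonlocal term is at least a multiple
  of \<open>|x| powr (-s) u powr q\<close> with \<open>s = N - \<alpha>\<close> and with \<open>s = p b - \<alpha>\<close>. If (iii) or (iv) fails, it absorbs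
  a positive part of the Hardy term; comparison then improves the decay of \<open>u\<close>, the nonlocal
  term dominates every multiple of the Hardy term, and every Hardy constant becomes admissible,
  a contradiction. The comparison only uses points where \<open>u < 1\<close>, so \<open>q \<le> m - 1\<close> needs no
  upper bound on \<open>u\<close>.

  Sufficiency. For \<open>\<gamma> < b\<close> close to \<open>b\<close> and \<open>c\<close> small, \<open>c |x| powr (-\<gamma>)\<close> is a solution.
\<close>

section \<open>Smooth functions\<close>

text \<open>A smooth substitute built from a mollified \<open>u\<close> takes its place, and the
  errors made on the way must be beaten by something fixed beforehand. What beats them is the
  zero-order term: its constant K(b) is positive, and a violation of the lower bound at one point
  gives it a definite amount on a whole ball before the mollification scale is chosen.

  The assumption N \<le> m makes K strictly increasing from 0 to infinity on the half-line, so decay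
  exponents and Hardy constants can be exchanged for one another, and every b > 0 yields a usable
  barrier.

  Conditions (iii) and (iv) mirror the two parts of space that feed the Riesz potential at a distant
  x: points y with |y| comparable to |x|, and a fixed bounded shell seen from afar. Either part
  alone bounds the potential below; together with the region around the origin they are also all
  that matters for the upper bound.\<close>

fun Ck_on :: "nat \<Rightarrow> 'a::euclidean_space set \<Rightarrow> ('a \<Rightarrow> real) \<Rightarrow> bool" where
  "Ck_on 0 S f = continuous_on S f"
| "Ck_on (Suc k) S f = (continuous_on S f \<and> (\<forall>x\<in>S. f differentiable (at x)) \<and>
      (\<forall>b\<in>Basis. Ck_on k S (\<lambda>x. frechet_derivative f (at x) b)))"

lemma Ck_on_UNIV: "Ck_on k UNIV f \<longleftrightarrow> Ck k f"
  by (induction k arbitrary: f) auto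

lemma Ck_on_continuous: "Ck_on k S f \<Longrightarrow> continuous_on S f"
  by (cases k) auto

text \<open>On an open set the derivative at a point depends only on nearby values, so equality on
  \<open>S\<close> passes to all partial derivatives; the induction therefore runs over pairs of
  functions.\<close>

lemma Ck_on_cong:
  assumes "open S" "\<And>x. x \<in> S \<Longrightarrow> f x = g x"
  shows "Ck_on k S f \<longleftrightarrow> Ck_on k S g"
proof -
  have "Ck_on k S g" if "Ck_on k S f" "\<And>x. x \<in> S \<Longrightarrow> f x = g x" for f g
    using that
  proof (induction k arbitrary: f g)
    case 0
    then show ?case by (simp cong: continuous_on_cong)
  next
    case (Suc k)
    have d: "(g has_derivative frechet_derivative f (at x)) (at x)" if "x \<in> S" for x
    proof -
      have "(f has_derivative frechet_derivative f (at x)) (at x)"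
        using Suc.prems(1) that by (simp add: frechet_derivative_works[symmetric])
      then show ?thesis
        using has_derivative_transform_within_open[OF _ assms(1) that] Suc.prems(2) by blast
    qed
    have fd: "frechet_derivative f (at x) = frechet_derivative g (at x)" if "x \<in> S" for x
      using frechet_derivative_at[OF d[OF that]] .
    have "Ck_on k S (\<lambda>x. frechet_derivative g (at x) b)" if "b \<in> Basis" for b
      by (rule Suc.IH[of "\<lambda>x. frechet_derivative f (at x) b"]) (use Suc.prems that fd in auto)
    moreover have "continuous_on S g"
      using Suc.prems by (simp cong: continuous_on_cong)
    ultimately show ?case using d by (auto simp: differentiable_def)
  qed
  from this[of f g] this[of g f] show ?thesis using assms(2) by auto
qed

text \<open>Smoothness is local. This is the reason for relativising \<open>Ck\<close> to sets: the
  cut-off used for comparison is glued from two open pieces, and \<open>norm x powr a\<close> is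
  smooth only off the origin.\<close>

lemma Ck_on_local:
  assumes "\<And>x. x \<in> S \<Longrightarrow> \<exists>T. open T \<and> x \<in> T \<and> Ck_on k T f"
  shows "Ck_on k S f"
  using assms
proof (induction k arbitrary: f)
  case 0
  then show ?case
    by (metis Ck_on.simps(1) continuous_at_imp_continuous_on continuous_on_eq_continuous_at)
next
  case (Suc k)
  have "continuous_on S f"
    using Suc.prems Ck_on_continuous
    by (metis continuous_at_imp_continuous_on continuous_on_eq_continuous_at)
  moreover have "f differentiable at x" if "x \<in> S" for x
    using Suc.prems[OF that] by auto
  moreover have "Ck_on k S (\<lambda>x. frechet_derivative f (at x) b)" if "b \<in> Basis" for b
    by (rule Suc.IH) (use Suc.prems that in fastforce)
  ultimately show ?case by auto
qed

lemma Ck_on_subset: "Ck_on k S f \<Longrightarrow> T \<subseteq> S \<Longrightarrow> Ck_on k T f"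
  by (induction k arbitrary: f) (auto intro: continuous_on_subset)

text \<open>Uniqueness of the derivative lets an explicit family \<open>D\<close> of partial
  derivatives stand in for the chosen \<open>frechet_derivative\<close>; each closure property below
  then only has to exhibit its product or chain rule formula.\<close>

lemma Ck_on_SucI:
  assumes "open S"
    and "\<And>x. x \<in> S \<Longrightarrow> (f has_derivative (\<lambda>h. \<Sum>b\<in>Basis. (h \<bullet> b) * D b x)) (at x)"
    and "\<And>b. b \<in> Basis \<Longrightarrow> Ck_on k S (D b)"
  shows "Ck_on (Suc k) S f"
proof -
  have "frechet_derivative f (at x) b = D b x" if "x \<in> S" "b \<in> Basis" for x b
    using frechet_derivative_at[OF assms(2)[OF that(1)], symmetric] that(2)
    by (simp add: inner_Basis if_distrib[of "\<lambda>c. c * _"] cong: if_cong)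
  then have "Ck_on k S (\<lambda>x. frechet_derivative f (at x) b)" if "b \<in> Basis" for b
    using Ck_on_cong[OF assms(1), of "\<lambda>x. frechet_derivative f (at x) b" "D b"] assms(3) that by auto
  moreover have "continuous_on S f"
    using assms(2) by (meson continuous_at_imp_continuous_on has_derivative_continuous)
  moreover have "\<forall>x\<in>S. f differentiable (at x)"
    using assms(2) differentiable_def by blast
  ultimately show ?thesis by simp
qed

lemma Ck_on_Suc_derivative:
  assumes "Ck_on (Suc k) S f" "x \<in> S"
  shows "(f has_derivative (\<lambda>h. \<Sum>b\<in>Basis. (h \<bullet> b) * frechet_derivative f (at x) b)) (at x)"
proof -
  have d: "(f has_derivative frechet_derivative f (at x)) (at x)"
    using assms by (simp add: frechet_derivative_works[symmetric])
  then have l: "linear (frechet_derivative f (at x))"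
    using has_derivative_linear by blast
  have "frechet_derivative f (at x) h = (\<Sum>b\<in>Basis. (h \<bullet> b) * frechet_derivative f (at x) b)" for h
  proof -
    have "frechet_derivative f (at x) h = frechet_derivative f (at x) (\<Sum>b\<in>Basis. (h \<bullet> b) *\<^sub>R b)"
      by (simp add: euclidean_representation)
    also have "\<dots> = (\<Sum>b\<in>Basis. (h \<bullet> b) * frechet_derivative f (at x) b)"
      by (simp add: linear_sum[OF l] linear_cmul[OF l])
    finally show ?thesis .
  qed
  with d show ?thesis by (metis (no_types, lifting) ext)
qed

text \<open>Needed in the product and chain rules, where undifferentiated factors occur next to
  derivatives.\<close>

lemma Ck_on_SucD: "Ck_on (Suc k) S f \<Longrightarrow> Ck_on k S f"
  by (induction k arbitrary: f) auto

lemma Ck_on_const: "open S \<Longrightarrow> Ck_on k S (\<lambda>x. c)"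
proof (induction k arbitrary: c)
  case (Suc k)
  show ?case by (rule Ck_on_SucI[where D="\<lambda>_ _. 0"]) (use Suc in auto)
qed auto

lemma Ck_on_inner: "open S \<Longrightarrow> Ck_on k S (\<lambda>x. x \<bullet> v)"
proof (induction k)
  case (Suc k)
  show ?case
  proof (rule Ck_on_SucI[where D="\<lambda>b x. b \<bullet> v"])
    fix x
    have "((\<lambda>x. x \<bullet> v) has_derivative (\<lambda>h. h \<bullet> v)) (at x)"
      by (auto intro!: derivative_eq_intros)
    then show "((\<lambda>x. x \<bullet> v) has_derivative (\<lambda>h. \<Sum>b\<in>Basis. (h \<bullet> b) * (b \<bullet> v))) (at x)"
      by (metis (no_types, lifting) ext euclidean_inner inner_commute sum.cong)
  qed (use Suc Ck_on_const in auto)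
qed (auto intro!: continuous_intros)

lemma Ck_on_add:
  "open S \<Longrightarrow> Ck_on k S f \<Longrightarrow> Ck_on k S g \<Longrightarrow> Ck_on k S (\<lambda>x. f x + g x)"
proof (induction k arbitrary: f g)
  case (Suc k)
  show ?case
  proof (rule Ck_on_SucI[where D="\<lambda>b x. frechet_derivative f (at x) b + frechet_derivative g (at x) b"])
    fix x assume "x \<in> S"
    from has_derivative_add[OF Ck_on_Suc_derivative[OF Suc.prems(2) this] Ck_on_Suc_derivative[OF Suc.prems(3) this]]
    show "((\<lambda>x. f x + g x) has_derivative
        (\<lambda>h. \<Sum>b\<in>Basis. h \<bullet> b * (frechet_derivative f (at x) b + frechet_derivative g (at x) b))) (at x)"
      by (simp add: sum.distrib distrib_left)
  qed (use Suc in auto)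
qed (auto intro: continuous_on_add)

lemma Ck_on_mult:
  "open S \<Longrightarrow> Ck_on k S f \<Longrightarrow> Ck_on k S g \<Longrightarrow> Ck_on k S (\<lambda>x. f x * g x)"
proof (induction k arbitrary: f g)
  case (Suc k)
  show ?case
  proof (rule Ck_on_SucI[where D="\<lambda>b x. f x * frechet_derivative g (at x) b + frechet_derivative f (at x) b * g x"])
    fix x assume "x \<in> S"
    from has_derivative_mult[OF Ck_on_Suc_derivative[OF Suc.prems(2) this] Ck_on_Suc_derivative[OF Suc.prems(3) this]]
    show "((\<lambda>x. f x * g x) has_derivative
        (\<lambda>h. \<Sum>b\<in>Basis. h \<bullet> b * (f x * frechet_derivative g (at x) b + frechet_derivative f (at x) b * g x))) (at x)"
      by (simp add: sum.distrib distrib_left sum_distrib_left sum_distrib_right mult_ac)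
  next
    fix b :: 'a assume "b \<in> Basis"
    then show "Ck_on k S (\<lambda>x. f x * frechet_derivative g (at x) b + frechet_derivative f (at x) b * g x)"
      using Suc.prems Ck_on_SucD by (intro Ck_on_add Suc.IH) auto
  qed (use Suc in auto)
qed (auto intro: continuous_on_mult)

lemma Ck_on_sum:
  "open S \<Longrightarrow> (\<And>i. i \<in> I \<Longrightarrow> Ck_on k S (f i)) \<Longrightarrow> Ck_on k S (\<lambda>x. \<Sum>i\<in>I. f i x)"
  by (induction I rule: infinite_finite_induct) (auto intro: Ck_on_const Ck_on_add)

lemma Ck_on_diff:
  assumes "open S" "Ck_on k S f" "Ck_on k S g"
  shows "Ck_on k S (\<lambda>x. f x - g x)"
  using Ck_on_add[OF assms(1,2) Ck_on_mult[OF assms(1) Ck_on_const[OF assms(1), of k "-1"] assms(3)]] by simp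

text \<open>The factor F'(g x) of the chain rule is again a composition, with \<open>F\<close>
  replaced by its derivative, so the induction keeps \<open>F\<close> general. An outer function of
  one variable is enough for powers of the norm and for cut-offs.\<close>

lemma Ck_on_compose:
  fixes F :: "real \<Rightarrow> real"
  shows "open S \<Longrightarrow> open T \<Longrightarrow> g ` S \<subseteq> T \<Longrightarrow> Ck_on k T F \<Longrightarrow> Ck_on k S g \<Longrightarrow> Ck_on k S (\<lambda>x. F (g x))"
proof (induction k arbitrary: F g)
  case 0
  then show ?case by (auto intro: continuous_on_compose2)
next
  case (Suc k)
  show ?case
  proof (rule Ck_on_SucI[where D="\<lambda>b x. frechet_derivative F (at (g x)) 1 * frechet_derivative g (at x) b"])
    fix x assume x: "x \<in> S"
    then have gx: "g x \<in> T" using Suc.prems by auto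
    from has_derivative_compose[OF Ck_on_Suc_derivative[OF Suc.prems(5) x] Ck_on_Suc_derivative[OF Suc.prems(4) gx]]
    show "((\<lambda>x. F (g x)) has_derivative
        (\<lambda>h. \<Sum>b\<in>Basis. h \<bullet> b * (frechet_derivative F (at (g x)) 1 * frechet_derivative g (at x) b))) (at x)"
      by (simp add: sum_distrib_left sum_distrib_right mult_ac)
  next
    fix b :: 'a assume b: "b \<in> Basis"
    have "Ck_on k S (\<lambda>x. frechet_derivative F (at (g x)) 1)"
      using Suc.IH[of g "\<lambda>y. frechet_derivative F (at y) 1"] Suc.prems(1-4) Ck_on_SucD[OF Suc.prems(5)] by auto
    then show "Ck_on k S (\<lambda>x. frechet_derivative F (at (g x)) 1 * frechet_derivative g (at x) b)"
      using Suc.prems b by (intro Ck_on_mult) auto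
  qed (use Suc in auto)
qed

lemma Ck_on_SucI_real:
  fixes f :: "real \<Rightarrow> real"
  assumes "open S" "\<And>x. x \<in> S \<Longrightarrow> (f has_real_derivative D x) (at x)" "Ck_on k S D"
  shows "Ck_on (Suc k) S f"
proof (rule Ck_on_SucI[where D="\<lambda>_. D"])
  fix x assume "x \<in> S"
  then show "(f has_derivative (\<lambda>h. \<Sum>b\<in>Basis. h \<bullet> b * D x)) (at x)"
    using assms(2) by (simp add: has_field_derivative_def mult_commute_abs)
qed (use assms in auto)

lemma Ck_on_powr: "Ck_on k {0<..} (\<lambda>t::real. t powr a)"
proof (induction k arbitrary: a)
  case (Suc k)
  have "Ck_on k {0<..} (\<lambda>t::real. a * t powr (a - 1))"
    using Suc by (intro Ck_on_mult Ck_on_const) auto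
  then show ?case
    by (intro Ck_on_SucI_real[where D="\<lambda>t. a * t powr (a - 1)"])
       (auto intro!: derivative_eq_intros simp: powr_diff field_simps)
qed (auto intro!: continuous_intros)

text \<open>The norm is handled through its square: the sum of squared coordinates is a polynomial,
  positive off the origin, and its power a/2 is smooth there.\<close>

lemma Ck_on_norm_powr: "Ck_on k (- {0}) (\<lambda>x::'a::euclidean_space. norm x powr a)"
proof -
  have "Ck_on k (-{0}) (\<lambda>x::'a. (\<Sum>b\<in>Basis. (x \<bullet> b) * (x \<bullet> b)) powr (a/2))"
  proof (rule Ck_on_compose[where T="{0<..}" and F="\<lambda>t. t powr (a/2)" and g="\<lambda>x. \<Sum>b\<in>Basis. (x \<bullet> b) * (x \<bullet> b)"])
    have "(\<Sum>b\<in>Basis. (x \<bullet> b) * (x \<bullet> b)) > 0" if "x \<noteq> 0" for x :: 'a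
      using that by (simp add: euclidean_inner[symmetric])
    then show "(\<lambda>x. \<Sum>b\<in>Basis. x \<bullet> b * (x \<bullet> b)) ` (- {0::'a}) \<subseteq> {0<..}" by auto
    show "Ck_on k (- {0}) (\<lambda>x::'a. \<Sum>b\<in>Basis. x \<bullet> b * (x \<bullet> b))"
      by (intro Ck_on_sum Ck_on_mult Ck_on_inner) auto
  qed (auto intro: Ck_on_powr)
  moreover have "(\<Sum>b\<in>Basis. (x \<bullet> b) * (x \<bullet> b)) powr (a/2) = norm x powr a" if "x \<in> -{0}" for x :: 'a
  proof -
    have "(\<Sum>b\<in>Basis. (x \<bullet> b) * (x \<bullet> b)) = norm x powr 2"
      using that by (simp add: euclidean_inner[symmetric] power2_norm_eq_inner[symmetric] powr_numeral)
    then show ?thesis by (simp only: powr_powr) simp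
  qed
  ultimately show ?thesis
    by (subst (asm) Ck_on_cong[where g="\<lambda>x. norm x powr a"]) auto
qed

section \<open>Functions of one variable that are flat at zero\<close>

definition flat_exp :: "nat \<Rightarrow> real \<Rightarrow> real" where
  "flat_exp j t = (if t > 0 then exp (- 1 / t) / t ^ j else 0)"

text \<open>The family exp(-1/t) t^(-j), extended by zero, is closed under differentiation, which
  makes smoothness an induction over all \<open>j\<close> at once. At t = 0 the difference quotient
  is identically zero on the left and tends to zero on the right because exp(-1/t) beats every power
  of 1/t.\<close>

lemma flat_exp_deriv:
  "(flat_exp j has_real_derivative flat_exp (j + 2) t - real j * flat_exp (j + 1) t) (at t)"
proof (cases "t = 0")
  case True
  have "((\<lambda>h::real. flat_exp j h / h) \<longlongrightarrow> 0) (at_left 0)"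
    by (rule Lim_transform_eventually[OF tendsto_const])
       (auto simp: flat_exp_def eventually_at_left_field intro!: exI[of _ "-1"])
  moreover have "((\<lambda>h::real. flat_exp j h / h) \<longlongrightarrow> 0) (at_right 0)"
  proof (rule Lim_transform_eventually)
    show "((\<lambda>h::real. exp (- 1 / h) / h ^ j / h) \<longlongrightarrow> 0) (at_right 0)" by real_asymp
  qed (auto simp: flat_exp_def eventually_at_right_field intro!: exI[of _ "1"])
  ultimately have "((\<lambda>h::real. flat_exp j h / h) \<longlongrightarrow> 0) (at 0)"
    by (simp add: filterlim_split_at)
  then show ?thesis using True by (simp add: has_field_derivative_iff flat_exp_def)
next
  case False
  then consider "t < 0" | "t > 0" by linarith
  then show ?thesis
  proof cases
    case 1
    have "((\<lambda>_. 0) has_real_derivative 0) (at t)" by simp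
    then have "(flat_exp j has_real_derivative 0) (at t)"
      by (rule has_field_derivative_transform_within_open[where S="{..<0}"]) (use 1 in \<open>auto simp: flat_exp_def\<close>)
    then show ?thesis using 1 by (simp add: flat_exp_def)
  next
    case 2
    have "((\<lambda>t. exp (- 1 / t) / t ^ j) has_real_derivative
        exp (- 1 / t) / t ^ (j + 2) - real j * (exp (- 1 / t) / t ^ (j + 1))) (at t)"
    proof -
      \<comment> \<open>Truncated subtraction is harmless at \<open>j = 0\<close>, where the factor
        \<open>real j\<close> makes both sides vanish.\<close>
      have e: "real j * t ^ (j - Suc 0) = real j * t ^ j / t"
        using 2 by (cases j) auto
      have dexp: "((\<lambda>t. exp (- 1 / t)) has_real_derivative exp (- 1 / t) / t\<^sup>2) (at t)"
        using 2 by (auto intro!: derivative_eq_intros simp: power2_eq_square)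
      show ?thesis
        by (rule DERIV_cong[OF DERIV_divide[OF dexp DERIV_pow[of j t]]])
           (use 2 in \<open>simp_all add: e, simp add: field_simps power2_eq_square\<close>)
    qed
    then have "(flat_exp j has_real_derivative
        exp (- 1 / t) / t ^ (j + 2) - real j * (exp (- 1 / t) / t ^ (j + 1))) (at t)"
      by (rule has_field_derivative_transform_within_open[where S="{0<..}"]) (use 2 in \<open>auto simp: flat_exp_def\<close>)
    then show ?thesis using 2 by (simp add: flat_exp_def)
  qed
qed

lemma Ck_on_flat_exp: "Ck_on k UNIV (flat_exp j)"
proof (induction k arbitrary: j)
  case 0
  show ?case
    using DERIV_isCont[OF flat_exp_deriv] by (auto intro!: continuous_at_imp_continuous_on)
next
  case (Suc k)
  show ?case
    by (rule Ck_on_SucI_real[OF _ flat_exp_deriv]) (auto intro!: Ck_on_diff Ck_on_mult Ck_on_const Suc)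
qed

lemma flat_exp_nonneg: "flat_exp j t \<ge> 0"
  by (simp add: flat_exp_def)

lemma flat_exp_0_le_1: "flat_exp 0 t \<le> 1"
  by (simp add: flat_exp_def)

section \<open>Integration by parts\<close>

lemma integrable_compact_support:
  fixes f :: "'a::euclidean_space \<Rightarrow> 'b::{banach,second_countable_topology}"
  assumes "compact K" "continuous_on K f" "\<And>x. x \<notin> K \<Longrightarrow> f x = 0"
  shows "integrable lborel f"
proof -
  have "integrable lborel (\<lambda>x. indicator K x *\<^sub>R f x)"
    by (rule borel_integrable_compact[OF assms(1,2)])
  moreover have "(\<lambda>x. indicator K x *\<^sub>R f x) = f"
    using assms(3) by (auto simp: indicator_def)
  ultimately show ?thesis by simp
qed

text \<open>The inequality is stated with integrals over the exterior domain with respect to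
  \<open>lebesgue\<close>; for integrands of compact support they reduce to \<open>lborel\<close>,
  where Borel measurability and translation invariance are at hand.\<close>

lemma set_lebesgue_integral_compact_support:
  fixes f :: "'a::euclidean_space \<Rightarrow> 'b::{banach,second_countable_topology}"
  assumes "compact K" "continuous_on K f" "\<And>x. x \<notin> K \<Longrightarrow> f x = 0" "K \<subseteq> \<Omega>"
  shows "(LINT x:\<Omega>|lebesgue. f x) = integral\<^sup>L lborel f"
proof -
  have "(\<lambda>x. indicator \<Omega> x *\<^sub>R f x) = f"
    using assms(3,4) by (auto simp: indicator_def fun_eq_iff)
  moreover have "f \<in> borel_measurable lborel"
    using integrable_compact_support[OF assms(1-3)] by auto
  ultimately show ?thesis
    by (simp add: set_lebesgue_integral_def integral_completion)
qed

lemma set_integrable_compact_support: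
  fixes f :: "'a::euclidean_space \<Rightarrow> 'b::{banach,second_countable_topology}"
  assumes "compact K" "continuous_on K f" "\<And>x. x \<notin> K \<Longrightarrow> f x = 0" "K \<subseteq> \<Omega>"
  shows "set_integrable lebesgue \<Omega> f"
proof -
  have "(\<lambda>x. indicator \<Omega> x *\<^sub>R f x) = f"
    using assms(3,4) by (auto simp: indicator_def fun_eq_iff)
  moreover have "integrable lborel f" "f \<in> borel_measurable lborel"
    using integrable_compact_support[OF assms(1-3)] by auto
  ultimately show ?thesis
    by (simp add: set_integrable_def integrable_completion)
qed

lemma lborel_integral_translate:
  fixes f :: "'a::euclidean_space \<Rightarrow> 'b::{banach,second_countable_topology}"
  assumes "f \<in> borel_measurable borel"
  shows "(\<integral>x. f (x + v) \<partial>lborel) = integral\<^sup>L lborel f"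
proof -
  have "integral\<^sup>L lborel f = integral\<^sup>L (distr lborel borel ((+) v)) f"
    by (simp add: lborel_distr_plus)
  also have "\<dots> = (\<integral>x. f (v + x) \<partial>lborel)"
    by (rule integral_distr) (use assms in auto)
  finally show ?thesis by (simp add: add.commute)
qed

text \<open>Every difference quotient in direction \<open>b\<close> has integral zero by translation
  invariance. The mean value theorem bounds the quotients by a constant on one fixed ball, outside
  which they vanish, so dominated convergence passes to the derivative.\<close>

lemma integral_directional_derivative_eq_0:
  fixes h :: "'a::euclidean_space \<Rightarrow> real"
  assumes d: "\<And>x. (h has_derivative h' x) (at x)"
    and c: "continuous_on UNIV (\<lambda>x. h' x b)"
    and K: "compact K" "\<And>x. x \<notin> K \<Longrightarrow> h x = 0"
  shows "(\<integral>x. h' x b \<partial>lborel) = 0"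
proof -
  have ch: "continuous_on UNIV h"
    using d by (meson continuous_at_imp_continuous_on has_derivative_continuous)
  have h'0: "h' x b = 0" if "x \<notin> K" for x
  proof -
    have "(h has_derivative (\<lambda>_. 0)) (at x)"
      by (rule has_derivative_transform_within_open[where s="-K" and f="\<lambda>_. 0"])
         (use K that compact_imp_closed in auto)
    then show ?thesis using has_derivative_unique[OF d] by metis
  qed
  obtain M0 where M0: "\<And>x. x \<in> K \<Longrightarrow> norm (h' x b) \<le> M0"
    using compact_imp_bounded[OF compact_continuous_image[OF continuous_on_subset[OF c] K(1)]]
    by (auto simp: bounded_iff)
  \<comment> \<open>The maximum with 0 keeps the bound nonnegative even if \<open>K\<close> is
    empty.\<close>
  define M where "M = max M0 0"
  have M: "\<bar>h' x b\<bar> \<le> M" for x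
    using M0[of x] h'0[of x] by (cases "x \<in> K") (auto simp: M_def)
  have M_nn: "M \<ge> 0" by (simp add: M_def)
  obtain R where R: "\<And>x. x \<in> K \<Longrightarrow> norm x \<le> R"
    using compact_imp_bounded[OF K(1)] by (auto simp: bounded_iff)
  define s where "s n x = (h (x + (1 / real (Suc n)) *\<^sub>R b) - h x) * real (Suc n)" for n x
  have dir: "((\<lambda>t. h (x + t *\<^sub>R b)) has_real_derivative h' (x + t *\<^sub>R b) b) (at t)" for x t
  proof -
    have "((\<lambda>t. x + t *\<^sub>R b) has_derivative (\<lambda>t. t *\<^sub>R b)) (at t)"
      by (auto intro!: derivative_eq_intros)
    from has_derivative_compose[OF this d]
    have "((\<lambda>t. h (x + t *\<^sub>R b)) has_derivative (\<lambda>s. h' (x + t *\<^sub>R b) (s *\<^sub>R b))) (at t)" .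
    moreover have "h' (x + t *\<^sub>R b) (s *\<^sub>R b) = h' (x + t *\<^sub>R b) b * s" for s
      using linear_cmul[OF has_derivative_linear[OF d]] by simp
    ultimately show ?thesis by (simp add: has_field_derivative_def)
  qed
  \<comment> \<open>The increments are at most \<open>norm b\<close> long because 1/(n+1) is at most
    1; enlarging the radius \<open>R\<close> of \<open>K\<close> by \<open>norm b\<close> covers the
    supports of all quotients at once.\<close>
  have far: "x \<notin> K \<and> x + (1 / real (Suc n)) *\<^sub>R b \<notin> K" if "x \<notin> cball 0 (R + norm b)" for n x
  proof -
    have f: "norm x > R + norm b" using that by simp
    have "norm ((1 / real (Suc n)) *\<^sub>R b) \<le> norm b"
      by (simp add: field_simps mult_le_cancel_left1 del: of_nat_Suc)
    then have "norm (x + (1 / real (Suc n)) *\<^sub>R b) > R"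
      using f norm_diff_ineq[of x "(1 / real (Suc n)) *\<^sub>R b"] by linarith
    moreover have "norm x > R" using f norm_ge_zero[of b] by linarith
    ultimately show ?thesis using R by (meson not_less)
  qed
  have bnd: "norm (s n x) \<le> M * indicator (cball 0 (R + norm b)) x" for n x
  proof (cases "x \<in> cball 0 (R + norm b)")
    case True
    obtain t where "h (x + (1 / real (Suc n)) *\<^sub>R b) - h (x + 0 *\<^sub>R b) = (1 / real (Suc n) - 0) * h' (x + t *\<^sub>R b) b"
      using MVT2[of 0 "1 / real (Suc n)" "\<lambda>t. h (x + t *\<^sub>R b)" "\<lambda>t. h' (x + t *\<^sub>R b) b"] dir
      by auto
    then have "s n x = h' (x + t *\<^sub>R b) b" by (simp add: s_def)
    with M[of "x + t *\<^sub>R b"] True show ?thesis by simp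
  next
    case False
    then have "x \<notin> K" "x + (1 / real (Suc n)) *\<^sub>R b \<notin> K" using far by auto
    then show ?thesis by (simp add: s_def K M_nn)
  qed
  have lim: "(\<lambda>n. s n x) \<longlonglongrightarrow> h' x b" for x
  proof -
    have "((\<lambda>t. (h (x + t *\<^sub>R b) - h x) / t) \<longlongrightarrow> h' x b) (at 0)"
      using dir[of x 0] by (simp add: has_field_derivative_iff)
    moreover have "filterlim (\<lambda>n. 1 / real (Suc n)) (at 0) sequentially"
      by real_asymp
    ultimately have "(\<lambda>n. (h (x + (1 / real (Suc n)) *\<^sub>R b) - h x) / (1 / real (Suc n))) \<longlonglongrightarrow> h' x b"
      by (rule filterlim_compose)
    then show ?thesis by (simp add: s_def)
  qed
  have int_h: "integrable lborel h"
    by (rule integrable_compact_support[OF K(1) continuous_on_subset[OF ch] K(2)]) auto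
  have hb[measurable]: "h \<in> borel_measurable borel" using ch by (rule borel_measurable_continuous_onI)
  have int0: "integral\<^sup>L lborel (s n) = 0" for n
  proof -
    have "integrable lborel (\<lambda>x. h (x + (1 / real (Suc n)) *\<^sub>R b))"
    proof (rule integrable_compact_support[of "cball 0 (R + norm b)"])
      show "continuous_on (cball 0 (R + norm b)) (\<lambda>x. h (x + (1 / real (Suc n)) *\<^sub>R b))"
        by (rule continuous_on_compose2[OF ch]) (auto intro!: continuous_intros)
      fix x :: 'a assume "x \<notin> cball 0 (R + norm b)"
      then show "h (x + (1 / real (Suc n)) *\<^sub>R b) = 0" using far K(2) by blast
    qed auto
    then show ?thesis
      using int_h lborel_integral_translate[OF hb, of "(1 / real (Suc n)) *\<^sub>R b"] by (simp add: s_def[abs_def])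
  qed
  have "(\<lambda>n. integral\<^sup>L lborel (s n)) \<longlonglongrightarrow> (\<integral>x. h' x b \<partial>lborel)"
  proof (rule integral_dominated_convergence[where w="\<lambda>x. M * indicator (cball 0 (R + norm b)) x"])
    show "(\<lambda>x. h' x b) \<in> borel_measurable lborel" using c by (simp add: borel_measurable_continuous_onI)
    show "s n \<in> borel_measurable lborel" for n unfolding s_def by measurable
    show "integrable lborel (\<lambda>x. M * indicat_real (cball 0 (R + norm b)) x)"
      using emeasure_lborel_cball_finite by (intro integrable_mult_right integrable_real_indicator) auto
  qed (use lim bnd in auto)
  then show ?thesis by (simp add: int0 LIMSEQ_const_iff)
qed

lemma test_fun_facts:
  assumes "test_fun \<Omega> \<phi>"
  shows "continuous_on UNIV \<phi>" "\<phi> differentiable (at x)"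
    "b \<in> Basis \<Longrightarrow> continuous_on UNIV (\<lambda>x. frechet_derivative \<phi> (at x) b)"
    "compact (tsupport \<phi>)" "tsupport \<phi> \<subseteq> \<Omega>"
    "x \<notin> tsupport \<phi> \<Longrightarrow> \<phi> x = 0"
    "x \<notin> tsupport \<phi> \<Longrightarrow> frechet_derivative \<phi> (at x) v = 0"
proof -
  have "Ck (Suc 0) \<phi>" and c: "compact (tsupport \<phi>)" "tsupport \<phi> \<subseteq> \<Omega>"
    using assms by (auto simp: test_fun_def smooth_fun_def simp del: Ck.simps)
  then show "continuous_on UNIV \<phi>" "\<phi> differentiable (at x)" "compact (tsupport \<phi>)" "tsupport \<phi> \<subseteq> \<Omega>"
    "b \<in> Basis \<Longrightarrow> continuous_on UNIV (\<lambda>x. frechet_derivative \<phi> (at x) b)"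
    by auto
  have z: "\<phi> y = 0" if "y \<notin> tsupport \<phi>" for y
    using that closure_subset[of "{x. \<phi> x \<noteq> 0}"] by (auto simp: tsupport_def)
  show "x \<notin> tsupport \<phi> \<Longrightarrow> \<phi> x = 0" by (rule z)
  show "frechet_derivative \<phi> (at x) v = 0" if "x \<notin> tsupport \<phi>"
  proof -
    have "(\<phi> has_derivative (\<lambda>_. 0)) (at x)"
      by (rule has_derivative_transform_within_open[where s="-tsupport \<phi>" and f="\<lambda>_. 0"])
         (use that z compact_imp_closed[OF c(1)] in auto)
    then show ?thesis using frechet_derivative_at by metis
  qed
qed

lemma test_fun_integration_by_parts:
  fixes g :: "'a::euclidean_space \<Rightarrow> real"
  assumes "open \<Omega>" and t: "test_fun \<Omega> \<phi>"
    and g: "\<And>x. x \<in> \<Omega> \<Longrightarrow> (g has_derivative g' x) (at x)"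
    and c: "continuous_on \<Omega> (\<lambda>x. g' x b)" and b: "b \<in> Basis"
  shows "(LINT x:\<Omega>|lebesgue. g x * frechet_derivative \<phi> (at x) b)
       = - (LINT x:\<Omega>|lebesgue. g' x b * \<phi> x)"
proof -
  note tf = test_fun_facts[OF t]
  define K where "K = tsupport \<phi>"
  have cg: "continuous_on \<Omega> g"
    using g by (meson continuous_at_imp_continuous_on has_derivative_continuous)
  have K: "compact K" "K \<subseteq> \<Omega>" "\<And>x. x \<notin> K \<Longrightarrow> \<phi> x = 0"
    "\<And>x v. x \<notin> K \<Longrightarrow> frechet_derivative \<phi> (at x) v = 0"
    using tf by (auto simp: K_def)
  \<comment> \<open>\<open>g\<close> is differentiable only on \<Omega>, so the candidate derivative
    of the product is forced to zero off the support of \<open>\<phi>\<close>, where the product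
    vanishes on an open set.\<close>
  define h' where "h' x v = (if x \<in> K then g x * frechet_derivative \<phi> (at x) v + g' x v * \<phi> x else 0)" for x v
  have c1: "continuous_on \<Omega> (\<lambda>x. g x * frechet_derivative \<phi> (at x) b)"
    "continuous_on \<Omega> (\<lambda>x. g' x b * \<phi> x)"
    by (intro continuous_intros cg c continuous_on_subset[OF tf(1)] continuous_on_subset[OF tf(3)[OF b]]; simp)+
  have h'eq: "h' x b = g x * frechet_derivative \<phi> (at x) b + g' x b * \<phi> x" for x
    using K by (simp add: h'_def)
  have "(\<integral>x. h' x b \<partial>lborel) = 0"
  proof (rule integral_directional_derivative_eq_0[where h="\<lambda>x. g x * \<phi> x" and K=K])
    fix x
    show "((\<lambda>x. g x * \<phi> x) has_derivative h' x) (at x)"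
    proof (cases "x \<in> K")
      case True
      with K have x: "x \<in> \<Omega>" by auto
      have "(\<phi> has_derivative frechet_derivative \<phi> (at x)) (at x)"
        using tf(2) by (simp add: frechet_derivative_works[symmetric])
      from has_derivative_mult[OF g[OF x] this] True show ?thesis by (simp add: h'_def[abs_def])
    next
      case False
      have "((\<lambda>x. g x * \<phi> x) has_derivative (\<lambda>_. 0)) (at x)"
        by (rule has_derivative_transform_within_open[where s="-K" and f="\<lambda>_. 0"])
           (use False K compact_imp_closed[OF K(1)] in auto)
      then show ?thesis using False by (simp add: h'_def[abs_def])
    qed
  next
    have "continuous_on \<Omega> (\<lambda>x. h' x b)"
      using continuous_on_add[OF c1] by (simp add: h'eq)
    moreover have "continuous_on (-K) (\<lambda>x. h' x b)"
      by (rule continuous_on_eq[where f="\<lambda>_. 0"]) (auto simp: h'_def)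
    ultimately have "continuous_on (\<Omega> \<union> (-K)) (\<lambda>x. h' x b)"
      using assms(1) compact_imp_closed[OF K(1)] by (intro continuous_on_open_Un) auto
    moreover have "\<Omega> \<union> (-K) = UNIV" using K by auto
    ultimately show "continuous_on UNIV (\<lambda>x. h' x b)" by simp
  qed (use K in auto)
  moreover have "integrable lborel (\<lambda>x. g x * frechet_derivative \<phi> (at x) b)"
    by (rule integrable_compact_support[OF K(1) continuous_on_subset[OF c1(1) K(2)]]) (use K in auto)
  moreover have "integrable lborel (\<lambda>x. g' x b * \<phi> x)"
    by (rule integrable_compact_support[OF K(1) continuous_on_subset[OF c1(2) K(2)]]) (use K in auto)
  moreover have "(LINT x:\<Omega>|lebesgue. g x * frechet_derivative \<phi> (at x) b) = (\<integral>x. g x * frechet_derivative \<phi> (at x) b \<partial>lborel)"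
    by (rule set_lebesgue_integral_compact_support[OF K(1) continuous_on_subset[OF c1(1) K(2)]]) (use K in auto)
  moreover have "(LINT x:\<Omega>|lebesgue. g' x b * \<phi> x) = (\<integral>x. g' x b * \<phi> x \<partial>lborel)"
    by (rule set_lebesgue_integral_compact_support[OF K(1) continuous_on_subset[OF c1(2) K(2)]]) (use K in auto)
  ultimately show ?thesis by (simp add: h'eq)
qed

section \<open>Smooth approximation of Sobolev functions\<close>

definition bump :: "real \<Rightarrow> 'a::euclidean_space \<Rightarrow> real" where
  "bump e z = flat_exp 0 (e\<^sup>2 - z \<bullet> z)"

definition mollifier :: "real \<Rightarrow> 'a::euclidean_space \<Rightarrow> real" where
  "mollifier e z = bump e z / integral\<^sup>L lborel (bump e :: 'a \<Rightarrow> real)"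

lemma Ck_on_bump: "Ck_on k UNIV (bump e :: 'a::euclidean_space \<Rightarrow> real)"
proof -
  have "Ck_on k UNIV (\<lambda>z::'a. flat_exp 0 (e\<^sup>2 - (\<Sum>b\<in>Basis. (z \<bullet> b) * (z \<bullet> b))))"
    by (rule Ck_on_compose[where T=UNIV and F="flat_exp 0"])
       (auto intro!: Ck_on_flat_exp Ck_on_diff Ck_on_sum Ck_on_mult Ck_on_inner Ck_on_const)
  then show ?thesis by (simp add: bump_def[abs_def] euclidean_inner[symmetric])
qed

lemma bump_eq_0: "e > 0 \<Longrightarrow> norm z \<ge> e \<Longrightarrow> bump e z = 0"
  using power_mono[of e "norm z" 2] by (simp add: bump_def flat_exp_def power2_norm_eq_inner)

lemma bump_nonneg: "bump e z \<ge> 0"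
  by (simp add: bump_def flat_exp_nonneg)

lemma integrable_bump:
  assumes "e > 0"
  shows "integrable lborel (bump e :: 'a::euclidean_space \<Rightarrow> real)"
proof (rule integrable_compact_support[of "cball 0 e"])
  show "continuous_on (cball 0 e) (bump e :: 'a \<Rightarrow> real)"
    using Ck_on_continuous[OF Ck_on_bump[of 0 e]] continuous_on_subset by blast
qed (use assms in \<open>auto intro: bump_eq_0\<close>)

lemma integral_bump_pos:
  assumes "e > 0"
  shows "integral\<^sup>L lborel (bump e :: 'a::euclidean_space \<Rightarrow> real) > 0"
proof -
  \<comment> \<open>The value of the bump at radius e/2, which bounds it from below on the ball of
    that radius.\<close>
  define c where "c = exp (- 1 / (e\<^sup>2 - (e/2)\<^sup>2))"
  have le: "c * indicator (ball 0 (e/2)) z \<le> bump e z" for z :: 'a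
  proof (cases "z \<in> ball 0 (e/2)")
    case True
    then have "z \<bullet> z \<le> (e/2)\<^sup>2"
      using power_mono[of "norm z" "e/2" 2] by (simp add: power2_norm_eq_inner)
    moreover have p: "e\<^sup>2 - (e/2)\<^sup>2 > 0" using assms by (simp add: power2_eq_square)
    ultimately have "- 1 / (e\<^sup>2 - (e/2)\<^sup>2) \<le> - 1 / (e\<^sup>2 - z \<bullet> z)"
      using assms by (simp add: frac_le)
    then show ?thesis using True p \<open>z \<bullet> z \<le> (e/2)\<^sup>2\<close> by (simp add: c_def bump_def flat_exp_def)
  qed (simp add: bump_nonneg)
  have int: "integrable lborel (\<lambda>z::'a. c * indicator (ball 0 (e/2)) z)"
    using emeasure_lborel_ball_finite by (intro integrable_mult_right integrable_real_indicator) auto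
  have "0 < c * measure lborel (ball (0::'a) (e/2))"
    using assms by (intro mult_pos_pos content_ball_pos) (auto simp: c_def)
  also have "\<dots> = (\<integral>z. c * indicator (ball (0::'a) (e/2)) z \<partial>lborel)" by simp
  also have "\<dots> \<le> integral\<^sup>L lborel (bump e :: 'a \<Rightarrow> real)"
    by (rule integral_mono[OF int integrable_bump[OF assms] le])
  finally show ?thesis .
qed

lemma mollifier_facts:
  assumes "e > 0"
  shows "Ck k (mollifier e :: 'a::euclidean_space \<Rightarrow> real)"
    "mollifier e (z :: 'a) \<ge> 0"
    "norm z \<ge> e \<Longrightarrow> mollifier e z = 0"
    "integrable lborel (mollifier e :: 'a \<Rightarrow> real)"
    "integral\<^sup>L lborel (mollifier e :: 'a \<Rightarrow> real) = 1"
proof -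
  note pos = integral_bump_pos[OF assms, where 'a='a]
  have "Ck_on k UNIV (\<lambda>z::'a. (1 / integral\<^sup>L lborel (bump e :: 'a \<Rightarrow> real)) * bump e z)"
    by (intro Ck_on_mult Ck_on_const Ck_on_bump) auto
  then show "Ck k (mollifier e :: 'a \<Rightarrow> real)"
    by (simp add: mollifier_def[abs_def] Ck_on_UNIV)
  show "mollifier e z \<ge> 0" using divide_nonneg_pos[OF bump_nonneg pos] by (simp add: mollifier_def)
  show "norm z \<ge> e \<Longrightarrow> mollifier e z = 0" by (simp add: mollifier_def bump_eq_0[OF assms])
  show "integrable lborel (mollifier e :: 'a \<Rightarrow> real)"
    unfolding mollifier_def[abs_def] by (intro integrable_divide_zero integrable_bump assms)
  show "integral\<^sup>L lborel (mollifier e :: 'a \<Rightarrow> real) = 1"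
    using pos by (simp add: mollifier_def[abs_def])
qed

text \<open>Differentiation under the integral sign. The convolution is taken over a box so that the
  parameter integral runs over a compact set; at points where the kernel is supported in the box it
  agrees with the integral over the whole space.\<close>

lemma convolution_has_derivative:
  fixes \<rho> U :: "'a::euclidean_space \<Rightarrow> real"
  assumes \<rho>: "Ck (Suc 0) \<rho>" and U: "continuous_on UNIV U"
  shows "((\<lambda>x. integral (cbox a c) (\<lambda>y. \<rho> (x - y) * U y)) has_derivative
     (\<lambda>h. \<Sum>b\<in>Basis. (h \<bullet> b) * integral (cbox a c) (\<lambda>y. frechet_derivative \<rho> (at (x - y)) b * U y))) (at x)"
proof -
  define fx where "fx x y = (\<Sum>b\<in>Basis. (frechet_derivative \<rho> (at (x - y)) b * U y) *\<^sub>R blinfun_inner_left b)" for x y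
  have c\<rho>: "continuous_on UNIV \<rho>" and cd: "\<And>b. b \<in> Basis \<Longrightarrow> continuous_on UNIV (\<lambda>x. frechet_derivative \<rho> (at x) b)"
    using \<rho> by auto
  have d: "(\<rho> has_derivative (\<lambda>h. \<Sum>b\<in>Basis. (h \<bullet> b) * frechet_derivative \<rho> (at x) b)) (at x)" for x
    using Ck_on_Suc_derivative[of 0 UNIV \<rho> x] \<rho> by (simp add: Ck_on_UNIV[symmetric])
  have L: "((\<lambda>x. integral (cbox a c) (\<lambda>y. \<rho> (x - y) * U y)) has_derivative
       blinfun_apply (integral (cbox a c) (fx x))) (at x within UNIV)"
  proof (rule leibniz_rule)
    fix x t :: 'a
    have "((\<lambda>x. x - t) has_derivative (\<lambda>h. h)) (at x)"
      by (auto intro!: derivative_eq_intros)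
    from has_derivative_mult_left[OF has_derivative_compose[OF this d], of "U t"]
    have "((\<lambda>x. \<rho> (x - t) * U t) has_derivative
        (\<lambda>h. (\<Sum>b\<in>Basis. (h \<bullet> b) * frechet_derivative \<rho> (at (x - t)) b) * U t)) (at x)" by simp
    moreover have "(\<Sum>b\<in>Basis. (h \<bullet> b) * frechet_derivative \<rho> (at (x - t)) b) * U t = blinfun_apply (fx x t) h" for h
      by (simp add: fx_def blinfun.sum_left blinfun.scaleR_left sum_distrib_right sum_distrib_left mult_ac)
    ultimately show "((\<lambda>x. \<rho> (x - t) * U t) has_derivative blinfun_apply (fx x t)) (at x within UNIV)"
      by simp
  next
    fix x
    show "(\<lambda>y. \<rho> (x - y) * U y) integrable_on cbox a c"
      by (intro integrable_continuous continuous_intros continuous_on_compose2[OF c\<rho>] continuous_on_subset[OF U]) auto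
  next
    show "continuous_on (UNIV \<times> cbox a c) (\<lambda>(x, t). fx x t)"
      unfolding fx_def split_def
      by (intro continuous_intros continuous_on_compose2[OF cd] continuous_on_compose2[OF U]) auto
  qed auto
  have "blinfun_apply (integral (cbox a c) (fx x)) h =
      (\<Sum>b\<in>Basis. (h \<bullet> b) * integral (cbox a c) (\<lambda>y. frechet_derivative \<rho> (at (x - y)) b * U y))" for h
  proof -
    have i1: "fx x integrable_on cbox a c"
      unfolding fx_def[abs_def]
      by (intro integrable_continuous continuous_intros continuous_on_compose2[OF cd] continuous_on_subset[OF U]) auto
    have i2: "(\<lambda>y. frechet_derivative \<rho> (at (x - y)) b * U y) integrable_on cbox a c" if "b \<in> Basis" for b
      by (intro integrable_continuous continuous_intros continuous_on_compose2[OF cd[OF that]] continuous_on_subset[OF U]) auto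
    have "blinfun_apply (integral (cbox a c) (fx x)) h = integral (cbox a c) (\<lambda>y. blinfun_apply (fx x y) h)"
      using blinfun_apply_integral[OF i1] .
    also have "\<dots> = integral (cbox a c) (\<lambda>y. \<Sum>b\<in>Basis. (h \<bullet> b) * (frechet_derivative \<rho> (at (x - y)) b * U y))"
      by (simp add: fx_def blinfun.sum_left blinfun.scaleR_left mult_ac)
    also have "\<dots> = (\<Sum>b\<in>Basis. integral (cbox a c) (\<lambda>y. (h \<bullet> b) * (frechet_derivative \<rho> (at (x - y)) b * U y)))"
      using i2 by (intro integral_sum integrable_on_mult_right) auto
    finally show ?thesis by simp
  qed
  then have "blinfun_apply (integral (cbox a c) (fx x)) =
      (\<lambda>h. \<Sum>b\<in>Basis. (h \<bullet> b) * integral (cbox a c) (\<lambda>y. frechet_derivative \<rho> (at (x - y)) b * U y))"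
    by (rule ext)
  with L show ?thesis by simp
qed

text \<open>Each derivative falls on the kernel, so a derivative of the convolution is the
  convolution of the same \<open>U\<close> with a differentiated kernel; hence the induction over
  all smooth kernels.\<close>

lemma Ck_convolution:
  fixes \<rho> U :: "'a::euclidean_space \<Rightarrow> real"
  assumes "\<And>k. Ck k \<rho>" and U: "continuous_on UNIV U"
  shows "Ck k (\<lambda>x. integral (cbox a c) (\<lambda>y. \<rho> (x - y) * U y))"
  using assms(1)
proof (induction k arbitrary: \<rho>)
  case 0
  have "isCont (\<lambda>x. integral (cbox a c) (\<lambda>y. \<rho> (x - y) * U y)) x" for x
    using convolution_has_derivative[OF 0 U] has_derivative_continuous by blast
  then show ?case by (simp add: continuous_at_imp_continuous_on)
next
  case (Suc k)
  show ?case
    unfolding Ck_on_UNIV[symmetric]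
  proof (rule Ck_on_SucI[OF _ convolution_has_derivative[OF Suc.prems U]])
    fix b :: 'a assume b: "b \<in> Basis"
    have "Ck j (\<lambda>x. frechet_derivative \<rho> (at x) b)" for j
      using Suc.prems[of "Suc j"] b by simp
    from Suc.IH[OF this]
    show "Ck_on k UNIV (\<lambda>x. integral (cbox a c) (\<lambda>y. frechet_derivative \<rho> (at (x - y)) b * U y))"
      by (simp add: Ck_on_UNIV)
  qed auto
qed

section \<open>Approximation and translation continuity in L^m\<close>

lemma powr_add_le:
  fixes s t m :: real
  assumes "s \<ge> 0" "t \<ge> 0" "m > 0"
  shows "(s + t) powr m \<le> 2 powr m * (s powr m + t powr m)"
proof -
  have "(s + t) powr m \<le> (2 * max s t) powr m"
    using assms by (intro powr_mono2) auto
  also have "\<dots> = 2 powr m * (max s t) powr m"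
    using assms by (simp add: powr_mult)
  also have "(max s t) powr m \<le> s powr m + t powr m"
    by (auto simp: max_def)
  finally show ?thesis by simp
qed

text \<open>Two approximations are combined. Projecting \<open>f\<close> to a ball of radius
  \<open>n\<close> costs little in L^m, by domination with |f|^m. Continuous functions converging
  almost everywhere to \<open>f\<close> are then projected to the same ball, so that on
  \<open>K\<close>, which has finite measure, a constant dominates them.\<close>

lemma Lm_continuous_approx:
  fixes f :: "'a::euclidean_space \<Rightarrow> 'b::euclidean_space"
  assumes m: "m > 0" and f[measurable]: "f \<in> borel_measurable borel"
    and K: "compact K" and int: "integrable lborel (\<lambda>x. norm (f x) powr m)" and e: "\<epsilon> > 0"
  obtains G where "continuous_on UNIV G"
    "(\<integral>\<^sup>+x. indicator K x * ennreal (norm (f x - G x) powr m) \<partial>lborel) \<le> ennreal \<epsilon>"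
proof -
  define T where "T M = closest_point (cball (0::'b) M)" for M
  have T_cont: "continuous_on UNIV (T M)" if "M \<ge> 0" for M
    unfolding T_def using that by (intro continuous_on_closest_point) auto
  have T_in: "norm (T M v) \<le> M" if "M \<ge> 0" for M v
    using closest_point_in_set[of "cball (0::'b) M" v] that by (simp add: T_def)
  have T_self: "T M v = v" if "norm v \<le> M" for M v
    using that by (simp add: T_def closest_point_self)
  have T_dist: "norm (v - T M v) \<le> norm v" if "M \<ge> 0" for M v
    using closest_point_le[of "cball (0::'b) M" 0 v] that by (simp add: T_def dist_norm)
  have T_meas[measurable]: "T (real n) \<in> borel_measurable borel" for n
    using T_cont by (intro borel_measurable_continuous_onI) auto
  \<comment> \<open>Splitting the m-th power of a sum of two errors costs \<open>2 powr m\<close> by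
    \<open>powr_add_le\<close>, so each error gets half of \<epsilon> divided by that
    factor.\<close>
  define e1 where "e1 = \<epsilon> / (2 * 2 powr m)"
  have e1: "e1 > 0" using e by (simp add: e1_def)
  have "(\<lambda>n. \<integral>x. norm (f x - T (real n) (f x)) powr m \<partial>lborel) \<longlonglongrightarrow> (\<integral>x. 0 \<partial>(lborel :: 'a measure))"
  proof (rule integral_dominated_convergence[OF _ _ int])
    show "AE x in lborel. (\<lambda>n. norm (f x - T (real n) (f x)) powr m) \<longlonglongrightarrow> 0"
    proof (rule AE_I2)
      fix x
      obtain n0 where n0: "norm (f x) \<le> real n0" using real_arch_simple by blast
      have "norm (f x - T (real n) (f x)) powr m = 0" if "n \<ge> n0" for n
        using T_self[of "f x" "real n"] that n0 by simp
      then show "(\<lambda>n. norm (f x - T (real n) (f x)) powr m) \<longlonglongrightarrow> 0"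
        by (intro tendsto_eventually) (auto simp: eventually_sequentially)
    qed
    show "AE x in lborel. norm (norm (f x - T (real n) (f x)) powr m) \<le> norm (f x) powr m" for n
      using m T_dist by (auto intro!: powr_mono2)
  qed measurable
  then have "eventually (\<lambda>n. (\<integral>x. norm (f x - T (real n) (f x)) powr m \<partial>lborel) < e1) sequentially"
    using e1 by (auto dest: order_tendstoD)
  then obtain n where n: "(\<integral>x. norm (f x - T (real n) (f x)) powr m \<partial>lborel) < e1"
    by (auto simp: eventually_sequentially)
  have int1: "integrable lborel (\<lambda>x. norm (f x - T (real n) (f x)) powr m)"
    by (rule Bochner_Integration.integrable_bound[OF int]) (use m T_dist in \<open>auto intro!: powr_mono2\<close>)
  have "f \<in> borel_measurable lebesgue" using f by (simp add: measurable_completion)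
  \<comment> \<open>Measurability in the gauge sense supplies continuous functions that converge off
    a negligible set.\<close>
  then have "f measurable_on UNIV"
    by (intro lebesgue_measurable_imp_measurable_on) (auto simp: lebesgue_on_UNIV_eq)
  then obtain N g where N: "negligible N" and g: "\<And>j. continuous_on UNIV (g j)"
      "\<And>x. x \<notin> N \<Longrightarrow> (\<lambda>j. g j x) \<longlonglongrightarrow> f x"
    by (auto simp: measurable_on_def)
  have Tg: "continuous_on UNIV (\<lambda>x. T (real n) (g j x))" for j
    by (rule continuous_on_compose2[OF T_cont g(1)]) auto
  have [measurable]: "(\<lambda>x. T (real n) (g j x)) \<in> borel_measurable borel" for j
    using Tg by (rule borel_measurable_continuous_onI)
  have AEN: "AE x in lborel. x \<notin> N"
  proof -
    have "AE x in lebesgue. x \<notin> N" using N by (intro AE_not_in) (simp add: negligible_iff_null_sets)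
    then show ?thesis by (simp add: AE_completion_iff)
  qed
  have [measurable]: "K \<in> sets borel" by (intro borel_closed compact_imp_closed K)
  have fin: "emeasure lborel K < \<infinity>"
    by (intro emeasure_bounded_finite compact_imp_bounded K)
  define B where "B x = indicator K x * (2 * real n) powr m" for x
  have Bi: "integrable lborel B"
    unfolding B_def using fin by (intro integrable_mult_left integrable_real_indicator) auto
  have Bb: "AE x in lborel. norm (indicator K x * norm (T (real n) (f x) - T (real n) (g j x)) powr m) \<le> B x" for j
  proof -
    have "norm (T (real n) (f x) - T (real n) (g j x)) \<le> 2 * real n" for x
      using norm_triangle_ineq4[of "T (real n) (f x)" "T (real n) (g j x)"] T_in[of "real n" "f x"] T_in[of "real n" "g j x"]
      by linarith
    then show ?thesis using m by (auto simp: B_def indicator_def intro!: powr_mono2)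
  qed
  have "(\<lambda>j. \<integral>x. indicator K x * norm (T (real n) (f x) - T (real n) (g j x)) powr m \<partial>lborel) \<longlonglongrightarrow> (\<integral>x. 0 \<partial>(lborel :: 'a measure))"
  proof (rule integral_dominated_convergence[OF _ _ Bi _ Bb])
    show "AE x in lborel. (\<lambda>j. indicator K x * norm (T (real n) (f x) - T (real n) (g j x)) powr m) \<longlonglongrightarrow> 0"
      using AEN
    proof eventually_elim
      case (elim x)
      have "isCont (T (real n)) (f x)"
        using T_cont[of "real n"] by (simp add: continuous_on_eq_continuous_at)
      from isCont_tendsto_compose[OF this g(2)[OF elim]]
      have "(\<lambda>j. norm (T (real n) (f x) - T (real n) (g j x)) powr m) \<longlonglongrightarrow> norm (T (real n) (f x) - T (real n) (f x)) powr m"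
        using m by (intro tendsto_powr' tendsto_intros) auto
      from tendsto_mult[OF tendsto_const[of "indicator K x"] this] show ?case using m by simp
    qed
  qed measurable
  then have "eventually (\<lambda>j. (\<integral>x. indicator K x * norm (T (real n) (f x) - T (real n) (g j x)) powr m \<partial>lborel) < e1) sequentially"
    using e1 by (auto dest: order_tendstoD)
  then obtain j where j: "(\<integral>x. indicator K x * norm (T (real n) (f x) - T (real n) (g j x)) powr m \<partial>lborel) < e1"
    by (auto simp: eventually_sequentially)
  have int2: "integrable lborel (\<lambda>x. indicator K x * norm (T (real n) (f x) - T (real n) (g j x)) powr m)"
    by (rule Bochner_Integration.integrable_bound[OF Bi]) (use Bb[of j] in \<open>auto simp: B_def\<close>)
  define G where "G x = T (real n) (g j x)" for x
  define D where "D x = 2 powr m * (norm (f x - T (real n) (f x)) powr m + indicator K x * norm (T (real n) (f x) - T (real n) (g j x)) powr m)" for x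
  have intD: "integrable lborel D" unfolding D_def using int1 int2 by auto
  have "(\<integral>\<^sup>+x. indicator K x * ennreal (norm (f x - G x) powr m) \<partial>lborel) \<le> (\<integral>\<^sup>+x. ennreal (D x) \<partial>lborel)"
  proof (rule nn_integral_mono)
    fix x
    have "norm (f x - G x) powr m \<le> (norm (f x - T (real n) (f x)) + norm (T (real n) (f x) - G x)) powr m"
      using m norm_triangle_ineq[of "f x - T (real n) (f x)" "T (real n) (f x) - G x"] by (intro powr_mono2) auto
    also have "\<dots> \<le> 2 powr m * (norm (f x - T (real n) (f x)) powr m + norm (T (real n) (f x) - G x) powr m)"
      using m by (intro powr_add_le) auto
    finally show "indicator K x * ennreal (norm (f x - G x) powr m) \<le> ennreal (D x)"
      by (cases "x \<in> K") (auto simp: D_def G_def)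
  qed
  also have "\<dots> = ennreal (integral\<^sup>L lborel D)"
    by (rule nn_integral_eq_integral[OF intD]) (simp add: D_def)
  also have "integral\<^sup>L lborel D \<le> 2 powr m * (e1 + e1)"
    unfolding D_def using n j int1 int2 by simp
  also have "2 powr m * (e1 + e1) = \<epsilon>" by (simp add: e1_def)
  finally show thesis using that[of G] Tg G_def by (simp add: ennreal_leI)
qed

text \<open>Plays the role of Young's inequality for the weight \<open>1 + t powr (m - 1)\<close>.\<close>

lemma weight_interpolation:
  fixes t d \<kappa> m :: real
  assumes "t \<ge> 0" "d \<ge> 0" "\<kappa> > 0" "m > 1"
  shows "(1 + t powr (m - 1)) * d \<le> 2 * \<kappa> * (1 + t powr m) + 2 * \<kappa> powr (1 - m) * d powr m"
    and "1 + t powr (m - 1) \<le> 2 * (1 + t powr m)"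
proof -
  define M where "M = max 1 t"
  have M1: "M \<ge> 1" "t \<le> M" by (auto simp: M_def)
  have M2: "M powr m \<le> 1 + t powr m" by (auto simp: M_def max_def)
  have W: "1 + t powr (m - 1) \<le> 2 * M powr (m - 1)"
    using powr_mono2[of "m - 1" t M] powr_mono2[of "m - 1" 1 M] assms M1 by simp
  have Mm: "M powr (m - 1) * M = M powr m"
    using M1 by (simp add: powr_diff)
  have "M powr (m - 1) \<le> M powr m" using M1 by (intro powr_mono) auto
  then have "M powr (m - 1) \<le> 1 + t powr m" using M2 by (rule order_trans)
  with W show "1 + t powr (m - 1) \<le> 2 * (1 + t powr m)"
    by (meson mult_left_mono order_trans zero_le_numeral)
  show "(1 + t powr (m - 1)) * d \<le> 2 * \<kappa> * (1 + t powr m) + 2 * \<kappa> powr (1 - m) * d powr m"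
  \<comment> \<open>Either \<open>d\<close> is small against \<open>M\<close>, and weight times
    \<open>d\<close> is at most \<open>2 * \<kappa>\<close> times \<open>M powr m\<close>, or
    \<open>M\<close> is at most d/\<kappa> and everything is bounded by a multiple of
    \<open>d powr m\<close>.\<close>
  proof (cases "d \<le> \<kappa> * M")
    case True
    have "(1 + t powr (m - 1)) * d \<le> (2 * M powr (m - 1)) * (\<kappa> * M)"
      using W True assms by (intro mult_mono) auto
    also have "\<dots> = 2 * \<kappa> * M powr m" using Mm by (simp add: mult_ac)
    also have "\<dots> \<le> 2 * \<kappa> * (1 + t powr m)" using M2 assms by simp
    finally show ?thesis by (simp add: add_increasing2)
  next
    case False
    have "\<kappa> * M > 0" using assms M1 by (intro mult_pos_pos) auto
    then have d: "d > 0" "M \<le> d / \<kappa>" using False assms by (auto simp: field_simps)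
    have "(1 + t powr (m - 1)) * d \<le> (2 * (d / \<kappa>) powr (m - 1)) * d"
      using W d assms M1 powr_mono2[of "m - 1" M "d / \<kappa>"] by (intro mult_right_mono) auto
    also have "\<dots> = 2 * \<kappa> powr (1 - m) * d powr m"
      using d assms by (simp add: powr_divide powr_diff field_simps)
    finally show ?thesis using assms by (simp add: add_increasing)
  qed
qed

lemma lborel_nn_integral_translate:
  fixes f :: "'a::euclidean_space \<Rightarrow> ennreal"
  assumes "f \<in> borel_measurable borel"
  shows "(\<integral>\<^sup>+x. f (x + v) \<partial>lborel) = integral\<^sup>N lborel f"
proof -
  have "integral\<^sup>N lborel f = integral\<^sup>N (distr lborel borel ((+) v)) f"
    by (simp add: lborel_distr_plus)
  also have "\<dots> = (\<integral>\<^sup>+x. f (v + x) \<partial>lborel)"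
    by (rule nn_integral_distr) (use assms in auto)
  finally show ?thesis by (simp add: add.commute)
qed

text \<open>The weight comes from the flux: a difference of fluxes is of order 1 + |f|^(m-1), and
  with \<open>f\<close> only in L^m it has to be paired with an error in L^m. Replacing
  \<open>f\<close> by a continuous \<open>G\<close> leaves two such errors, controlled by
  \<open>weight_interpolation\<close>, and the modulus of continuity of \<open>G\<close> on
  \<open>K\<close>.\<close>

lemma Lm_translation_continuity:
  fixes f :: "'a::euclidean_space \<Rightarrow> 'b::euclidean_space"
  assumes m: "m > 1" and f[measurable]: "f \<in> borel_measurable borel"
    and A: "compact A" and K: "compact K" and d0: "\<delta>0 > 0"
    and AK: "\<And>x z. x \<in> A \<Longrightarrow> norm z \<le> \<delta>0 \<Longrightarrow> x + z \<in> K"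
    and int: "integrable lborel (\<lambda>x. norm (f x) powr m)" and eta: "\<eta> > 0"
  obtains \<delta> where "0 < \<delta>" "\<delta> \<le> \<delta>0"
    "\<And>z. norm z \<le> \<delta> \<Longrightarrow>
      (\<integral>\<^sup>+x. indicator A x * ennreal ((1 + norm (f x) powr (m - 1)) * norm (f (x + z) - f x)) \<partial>lborel) \<le> ennreal \<eta>"
proof -
  have [measurable]: "A \<in> sets borel" "K \<in> sets borel"
    by (intro borel_closed compact_imp_closed A K)+
  define P where "P x = indicator A x * (1 + norm (f x) powr m)" for x
  have Pi: "integrable lborel P"
  proof -
    have "integrable lborel (indicat_real A)"
      using emeasure_bounded_finite[OF compact_imp_bounded[OF A]] by (intro integrable_real_indicator) auto
    moreover have "integrable lborel (\<lambda>x. indicator A x * norm (f x) powr m)"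
      by (rule Bochner_Integration.integrable_bound[OF int]) (auto simp: indicator_def)
    ultimately show ?thesis unfolding P_def by (simp add: distrib_left)
  qed
  define I where "I = integral\<^sup>L lborel P"
  have I0: "I \<ge> 0" unfolding I_def P_def by (intro Bochner_Integration.integral_nonneg) auto
  \<comment> \<open>Budget: \<open>4 * \<kappa> + 2 * \<omega>\<close> equals \<eta>/(2(I+1)), so
    the terms multiplying \<open>P\<close> use at most half of \<eta>; the two L^m errors of size
    \<eta>/(4c), each multiplied by \<open>c\<close>, use the other half. The added 1 avoids
    division by zero.\<close>
  define \<kappa> where "\<kappa> = \<eta> / (16 * (I + 1))"
  define \<omega> where "\<omega> = \<eta> / (8 * (I + 1))"
  have k: "\<kappa> > 0" and w: "\<omega> > 0" using eta I0 by (auto simp: \<kappa>_def \<omega>_def)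
  define c where "c = 2 * \<kappa> powr (1 - m)"
  have c: "c > 0" using k by (simp add: c_def)
  obtain G where G: "continuous_on UNIV G"
    "(\<integral>\<^sup>+x. indicator K x * ennreal (norm (f x - G x) powr m) \<partial>lborel) \<le> ennreal (\<eta> / (4 * c))"
    using Lm_continuous_approx[OF _ f K int, of "\<eta> / (4 * c)"] m eta c by auto
  have [measurable]: "G \<in> borel_measurable borel" using G(1) by (rule borel_measurable_continuous_onI)
  have "uniformly_continuous_on K G"
    using compact_uniformly_continuous[OF continuous_on_subset[OF G(1)] K] by auto
  then obtain d where d: "d > 0" "\<And>x y. x \<in> K \<Longrightarrow> y \<in> K \<Longrightarrow> dist y x < d \<Longrightarrow> dist (G y) (G x) < \<omega>"
    using w unfolding uniformly_continuous_on_def by metis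
  show thesis
  proof (rule that[of "min \<delta>0 (d / 2)"])
    fix z :: 'a assume z: "norm z \<le> min \<delta>0 (d / 2)"
    define E where "E x = indicator K x * norm (f x - G x) powr m" for x
    have [measurable]: "E \<in> borel_measurable borel" unfolding E_def by measurable
    have E0: "E x \<ge> 0" for x by (simp add: E_def)
    have Ei: "(\<integral>\<^sup>+x. ennreal (E x) \<partial>lborel) \<le> ennreal (\<eta> / (4 * c))"
    proof -
      have "ennreal (E x) = indicator K x * ennreal (norm (f x - G x) powr m)" for x
        by (auto simp: E_def indicator_def)
      then show ?thesis using G(2) by simp
    qed
    have pt: "indicator A x * ennreal ((1 + norm (f x) powr (m - 1)) * norm (f (x + z) - f x))
       \<le> ennreal ((4 * \<kappa> + 2 * \<omega>) * P x) + (ennreal c * ennreal (E (x + z)) + ennreal c * ennreal (E x))" for x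
    proof (cases "x \<in> A")
      case True
      define W where "W = 1 + norm (f x) powr (m - 1)"
      have xK: "x \<in> K" "x + z \<in> K" using AK[OF True, of 0] AK[OF True, of z] z d0 by auto
      have tri: "norm (f (x + z) - f x) \<le> norm (f (x + z) - G (x + z)) + \<omega> + norm (f x - G x)"
      proof -
        have "dist (G (x + z)) (G x) < \<omega>"
          using d z by (intro d(2) xK) (auto simp: dist_norm)
        moreover have "f (x + z) - f x = (f (x + z) - G (x + z)) + (G (x + z) - G x) - (f x - G x)" by simp
        ultimately show ?thesis
          using norm_triangle_ineq[of "f (x + z) - G (x + z)" "G (x + z) - G x"]
            norm_triangle_ineq4[of "(f (x + z) - G (x + z)) + (G (x + z) - G x)" "f x - G x"]
          by (simp add: dist_norm)
      qed
      have W0: "W \<ge> 0" by (simp add: W_def)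
      have "W * norm (f (x + z) - f x) \<le> W * (norm (f (x + z) - G (x + z)) + \<omega> + norm (f x - G x))"
        using tri W0 by (rule mult_left_mono)
      also have "\<dots> = W * norm (f (x + z) - G (x + z)) + W * norm (f x - G x) + W * \<omega>"
        by (simp add: algebra_simps)
      also have "\<dots> \<le> (2 * \<kappa> * P x + c * E (x + z)) + (2 * \<kappa> * P x + c * E x) + 2 * P x * \<omega>"
        using weight_interpolation(1)[of "norm (f x)" "norm (f (x + z) - G (x + z))" \<kappa> m]
          weight_interpolation(1)[of "norm (f x)" "norm (f x - G x)" \<kappa> m]
          weight_interpolation(2)[of "norm (f x)" 0 \<kappa> m] k m True xK w
        by (intro add_mono mult_right_mono) (auto simp: W_def P_def E_def c_def)
      also have "\<dots> = (4 * \<kappa> + 2 * \<omega>) * P x + (c * E (x + z) + c * E x)" by (simp add: algebra_simps)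
      finally have "ennreal (W * norm (f (x + z) - f x)) \<le> ennreal ((4 * \<kappa> + 2 * \<omega>) * P x + (c * E (x + z) + c * E x))"
        by (rule ennreal_leI)
      also have "\<dots> = ennreal ((4 * \<kappa> + 2 * \<omega>) * P x) + (ennreal c * ennreal (E (x + z)) + ennreal c * ennreal (E x))"
        using k w c E0 by (simp add: ennreal_plus ennreal_mult P_def)
      finally show ?thesis using True by (simp add: W_def)
    qed simp
    have "(\<integral>\<^sup>+x. indicator A x * ennreal ((1 + norm (f x) powr (m - 1)) * norm (f (x + z) - f x)) \<partial>lborel)
      \<le> (\<integral>\<^sup>+x. ennreal ((4 * \<kappa> + 2 * \<omega>) * P x) + (ennreal c * ennreal (E (x + z)) + ennreal c * ennreal (E x)) \<partial>lborel)"
      by (rule nn_integral_mono) (rule pt)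
    also have "\<dots> = (\<integral>\<^sup>+x. ennreal ((4 * \<kappa> + 2 * \<omega>) * P x) \<partial>lborel) +
        (ennreal c * (\<integral>\<^sup>+x. ennreal (E (x + z)) \<partial>lborel) + ennreal c * (\<integral>\<^sup>+x. ennreal (E x) \<partial>lborel))"
      using borel_measurable_integrable[OF Pi] by (simp add: nn_integral_add nn_integral_cmult)
    also have "(\<integral>\<^sup>+x. ennreal (E (x + z)) \<partial>lborel) = (\<integral>\<^sup>+x. ennreal (E x) \<partial>lborel)"
      by (rule lborel_nn_integral_translate[of "\<lambda>x. ennreal (E x)"]) measurable
    also have "(\<integral>\<^sup>+x. ennreal ((4 * \<kappa> + 2 * \<omega>) * P x) \<partial>lborel) = ennreal ((4 * \<kappa> + 2 * \<omega>) * I)"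
    proof -
      have "P x \<ge> 0" for x by (simp add: P_def)
      then show ?thesis unfolding I_def using k w Pi by (subst nn_integral_eq_integral) auto
    qed
    also have "ennreal ((4 * \<kappa> + 2 * \<omega>) * I) + (ennreal c * (\<integral>\<^sup>+x. ennreal (E x) \<partial>lborel) + ennreal c * (\<integral>\<^sup>+x. ennreal (E x) \<partial>lborel))
      \<le> ennreal ((4 * \<kappa> + 2 * \<omega>) * I) + (ennreal c * ennreal (\<eta> / (4 * c)) + ennreal c * ennreal (\<eta> / (4 * c)))"
      by (intro add_mono mult_left_mono Ei) auto
    also have "\<dots> = ennreal ((4 * \<kappa> + 2 * \<omega>) * I + (c * (\<eta> / (4 * c)) + c * (\<eta> / (4 * c))))"
    proof -
      have "ennreal c * ennreal (\<eta> / (4 * c)) = ennreal (c * (\<eta> / (4 * c)))"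
        using c eta by (intro ennreal_mult[symmetric]) auto
      moreover have "(4 * \<kappa> + 2 * \<omega>) * I \<ge> 0" using k w I0 by auto
      moreover have "c * (\<eta> / (4 * c)) \<ge> 0" using c eta by auto
      ultimately show ?thesis by (simp only: ennreal_plus add_nonneg_nonneg)
    qed
    also have "\<dots> \<le> ennreal \<eta>"
    proof (rule ennreal_leI)
      have "(4 * \<kappa> + 2 * \<omega>) * I = \<eta> / 2 * (I / (I + 1))" 
      proof -
        have "4 * \<kappa> + 2 * \<omega> = \<eta> / 2 * (1 / (I + 1))"
          unfolding \<kappa>_def \<omega>_def using I0 by (simp add: divide_simps) (simp add: algebra_simps)
        then show ?thesis by (simp only: mult.assoc) simp
      qed
      also have "\<dots> \<le> \<eta> / 2 * 1" using eta I0 by (intro mult_left_mono) auto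
      finally show "(4 * \<kappa> + 2 * \<omega>) * I + (c * (\<eta> / (4 * c)) + c * (\<eta> / (4 * c))) \<le> \<eta>"
        using c by simp
    qed
    finally show "(\<integral>\<^sup>+x. indicator A x * ennreal ((1 + norm (f x) powr (m - 1)) * norm (f (x + z) - f x)) \<partial>lborel) \<le> ennreal \<eta>" .
  qed (use d0 d in auto)
qed

text \<open>A weak gradient is only Lebesgue measurable, while shifting and exchanging integrals
  below call for Borel functions; the representative is built coordinate by coordinate.\<close>

lemma lebesgue_borel_representative:
  fixes g :: "'a::euclidean_space \<Rightarrow> 'b::euclidean_space"
  assumes "g \<in> borel_measurable lebesgue"
  obtains f where "f \<in> borel_measurable borel" "AE x in lborel. g x = f x"
proof -
  have "\<exists>h. h \<in> borel_measurable lborel \<and> (AE x in lborel. g x \<bullet> b = h x)" for b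
    using completion_ex_borel_measurable_real[of "\<lambda>x. g x \<bullet> b" lborel] assms by auto
  then obtain h where h: "\<And>b. h b \<in> borel_measurable lborel" "\<And>b. AE x in lborel. g x \<bullet> b = h b x"
    by metis
  have "(\<lambda>x. \<Sum>b\<in>Basis. h b x *\<^sub>R b) \<in> borel_measurable borel"
    using h(1) by auto
  moreover have "AE x in lborel. g x = (\<Sum>b\<in>Basis. h b x *\<^sub>R b)"
  proof -
    have "AE x in lborel. \<forall>b\<in>Basis. g x \<bullet> b = h b x"
      by (rule AE_finite_allI) (use h in auto)
    then show ?thesis
    proof eventually_elim
      case (elim x)
      have "g x = (\<Sum>b\<in>Basis. (g x \<bullet> b) *\<^sub>R b)" by (simp add: euclidean_representation)
      also have "\<dots> = (\<Sum>b\<in>Basis. h b x *\<^sub>R b)" using elim by (intro sum.cong) auto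
      finally show ?case .
    qed
  qed
  ultimately show thesis by (rule that)
qed

text \<open>The reflected and shifted kernel is the test function that turns the definition of a
  weak gradient into a formula for the gradient of a convolution.\<close>

lemma Ck_reflect:
  fixes \<rho> :: "'a::euclidean_space \<Rightarrow> real"
  shows "Ck k \<rho> \<Longrightarrow> Ck k (\<lambda>y. \<rho> (x - y))"
proof (induction k arbitrary: \<rho>)
  case 0
  then show ?case by (auto intro!: continuous_on_compose2[of UNIV \<rho>] continuous_intros)
next
  case (Suc k)
  have d: "(\<rho> has_derivative (\<lambda>h. \<Sum>b\<in>Basis. (h \<bullet> b) * frechet_derivative \<rho> (at z) b)) (at z)" for z
    using Ck_on_Suc_derivative[of k UNIV \<rho> z] Suc.prems by (simp add: Ck_on_UNIV[symmetric])
  show ?case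
    unfolding Ck_on_UNIV[symmetric]
  proof (rule Ck_on_SucI[where D="\<lambda>b y. (-1) * frechet_derivative \<rho> (at (x - y)) b"])
    fix y
    have "((\<lambda>y. x - y) has_derivative (\<lambda>h. - h)) (at y)"
      by (auto intro!: derivative_eq_intros)
    from has_derivative_compose[OF this d]
    show "((\<lambda>y. \<rho> (x - y)) has_derivative (\<lambda>h. \<Sum>b\<in>Basis. (h \<bullet> b) * ((-1) * frechet_derivative \<rho> (at (x - y)) b))) (at y)"
      by simp
  next
    fix b :: 'a assume "b \<in> Basis"
    then show "Ck_on k UNIV (\<lambda>y. (-1) * frechet_derivative \<rho> (at (x - y)) b)"
      using Suc.IH[of "\<lambda>z. frechet_derivative \<rho> (at z) b"] Suc.prems
      by (intro Ck_on_mult Ck_on_const) (auto simp: Ck_on_UNIV)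
  qed auto
qed

lemma frechet_derivative_reflect:
  fixes \<rho> :: "'a::euclidean_space \<Rightarrow> real"
  assumes "\<rho> differentiable (at (x - y))"
  shows "frechet_derivative (\<lambda>y. \<rho> (x - y)) (at y) b = - frechet_derivative \<rho> (at (x - y)) b"
proof -
  have d: "(\<rho> has_derivative frechet_derivative \<rho> (at (x - y))) (at (x - y))"
    using assms by (simp add: frechet_derivative_works[symmetric])
  have "((\<lambda>y. x - y) has_derivative (\<lambda>h. - h)) (at y)"
    by (auto intro!: derivative_eq_intros)
  from frechet_derivative_at[OF has_derivative_compose[OF this d]]
  show ?thesis using linear_neg[OF has_derivative_linear[OF d]] by metis
qed

lemma mollifier_minus: "mollifier e (- z) = mollifier e z"
  by (simp add: mollifier_def bump_def)

text \<open>Links the gauge integral over a box, in which convolutions are differentiated, with the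
  Lebesgue integral, in which they are estimated.\<close>

lemma integral_cbox_eq_lborel:
  fixes F :: "'a::euclidean_space \<Rightarrow> real"
  assumes "continuous_on UNIV F" "\<And>x. x \<notin> cbox a c \<Longrightarrow> F x = 0"
  shows "integral (cbox a c) F = integral\<^sup>L lborel F"
proof -
  have "integrable lborel F"
    by (rule integrable_compact_support[of "cbox a c"]) (use assms in \<open>auto intro: continuous_on_subset\<close>)
  from has_integral_integral_lborel[OF this] have 1: "(F has_integral integral\<^sup>L lborel F) UNIV" .
  have "(F has_integral integral (cbox a c) F) (cbox a c)"
    by (intro integrable_integral integrable_continuous continuous_on_subset[OF assms(1)]) auto
  then have "(F has_integral integral (cbox a c) F) UNIV"
    by (rule has_integral_on_superset) (use assms in auto)
  with 1 show ?thesis by (rule has_integral_unique[symmetric])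
qed

text \<open>\<open>v\<close> is a mollification of \<open>u\<close>. Its gradient is the mollified
  weak gradient, so its error at \<open>x\<close> is at most the average of |f(x+z) - f(x)| against
  the mollifier; Fubini and translation continuity finish. The weight is built into the error
  because the comparison multiplies the error of the gradient by a difference of fluxes.\<close>

lemma W1loc_smooth_approx:
  fixes u :: "'a::euclidean_space \<Rightarrow> real"
  assumes m: "m > 1" and \<Omega>: "open \<Omega>" and u: "continuous_on \<Omega> u" and W: "W1loc m \<Omega> u Du"
    and A: "compact A" "A \<subseteq> \<Omega>" and \<eta>: "\<eta> > 0"
  obtains v where "smooth_fun v" "\<And>x. x \<in> A \<Longrightarrow> \<bar>v x - u x\<bar> \<le> \<eta>"
    "(\<integral>\<^sup>+x. indicator A x * ennreal ((1 + norm (Du x) powr (m - 1)) * norm (grad v x - Du x)) \<partial>lebesgue) \<le> ennreal \<eta>"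
proof -
  obtain d1 where d1: "d1 > 0" "(\<Union>x\<in>A. cball x d1) \<subseteq> \<Omega>"
    using compact_subset_open_imp_cball_epsilon_subset[OF A(1) \<Omega> A(2)] by blast
  \<comment> \<open>\<open>K\<close> is the closed \<open>d1\<close>-neighbourhood of
    \<open>A\<close>: mollification at a scale of at most \<open>d1\<close> sees, from points of
    \<open>A\<close>, only values on \<open>K\<close>.\<close>
  define K where "K = {x + z | x z. x \<in> A \<and> z \<in> cball 0 d1}"
  have K: "compact K" unfolding K_def by (rule compact_sums[OF A(1) compact_cball])
  have AK: "x + z \<in> K" if "x \<in> A" "norm z \<le> d1" for x z
    using that by (auto simp: K_def)
  have AK': "y \<in> K" if "x \<in> A" "norm (y - x) \<le> d1" for x y
    using AK[OF that] by simp
  have AsubK: "A \<subseteq> K" using AK[of _ 0] d1 by force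
  have K\<Omega>: "K \<subseteq> \<Omega>"
    using d1(2) by (force simp: K_def dist_norm)
  have [measurable]: "A \<in> sets borel" "K \<in> sets borel" "\<Omega> \<in> sets borel"
    using \<Omega> by (auto intro: borel_closed compact_imp_closed A K)
  \<comment> \<open>A Tietze extension makes the convolution smooth on the whole space; its values
    off \<open>K\<close> are not seen from \<open>A\<close>.\<close>
  obtain U where U: "continuous_on UNIV U" "\<And>x. x \<in> K \<Longrightarrow> U x = u x"
    using Tietze_unbounded[of K u UNIV] continuous_on_subset[OF u K\<Omega>] compact_imp_closed[OF K] by auto
  obtain a where a: "K \<subseteq> cbox (-a) a"
    using bounded_subset_cbox_symmetric[OF compact_imp_bounded[OF K]] by blast
  have Wg: "weak_grad \<Omega> u Du" and Lm: "Lloc m \<Omega> (\<lambda>x. norm (Du x))" and L1: "Lloc 1 \<Omega> (\<lambda>x. norm (Du x))"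
    using W by (auto simp: W1loc_def weak_grad_def)
  have meas\<Omega>: "(\<lambda>x. indicator \<Omega> x *\<^sub>R Du x) \<in> borel_measurable lebesgue"
    using Wg by (simp add: weak_grad_def set_borel_measurable_def)
  have "(\<lambda>x. indicator K x *\<^sub>R (indicator \<Omega> x *\<^sub>R Du x)) \<in> borel_measurable lebesgue"
    by (rule borel_measurable_scaleR[OF _ meas\<Omega>]) (intro borel_measurable_indicator; auto)
  moreover have "indicator K x *\<^sub>R (indicator \<Omega> x *\<^sub>R Du x) = indicator K x *\<^sub>R Du x" for x
    using K\<Omega> by (auto simp: indicator_def)
  ultimately have measK: "(\<lambda>x. indicator K x *\<^sub>R Du x) \<in> borel_measurable lebesgue" by (simp only:)
  obtain f where f[measurable]: "f \<in> borel_measurable borel" and fAE: "AE x in lborel. indicator K x *\<^sub>R Du x = f x"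
    by (rule lebesgue_borel_representative[OF measK])
  have fAE': "AE x in lebesgue. indicator K x *\<^sub>R Du x = f x" using fAE by (rule AE_completion)
  have int_fm: "integrable lborel (\<lambda>x. norm (f x) powr m)"
  proof -
    have i1: "integrable lebesgue (\<lambda>x. indicator K x *\<^sub>R \<bar>norm (Du x)\<bar> powr m)"
      using Lm K K\<Omega> by (simp add: Lloc_def set_integrable_def)
    have i2: "AE x in lebesgue. indicator K x *\<^sub>R \<bar>norm (Du x)\<bar> powr m = norm (f x) powr m"
      using fAE'
    proof eventually_elim
      case (elim x)
      then show ?case by (cases "x \<in> K") auto
    qed
    have "integrable lebesgue (\<lambda>x. norm (f x) powr m)"
      by (rule integrable_cong_AE_imp[OF i1 _ i2]) (auto intro: measurable_completion)
    then show ?thesis by (subst (asm) integrable_completion) auto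
  qed
  have int_f: "integrable lborel f"
  proof -
    have i1: "integrable lebesgue (\<lambda>x. indicator K x *\<^sub>R norm (Du x))"
      using L1 K K\<Omega> by (simp add: Lloc_def set_integrable_def)
    have i2: "AE x in lebesgue. indicator K x *\<^sub>R norm (Du x) = norm (f x)"
      using fAE'
    proof eventually_elim
      case (elim x)
      then show ?case by (cases "x \<in> K") auto
    qed
    have "integrable lebesgue (\<lambda>x. norm (f x))"
      by (rule integrable_cong_AE_imp[OF i1 _ i2]) (auto intro: measurable_completion)
    then have "integrable lborel (\<lambda>x. norm (f x))" by (subst (asm) integrable_completion) auto
    then show ?thesis by (subst (asm) integrable_norm_iff) auto
  qed
  obtain d2 where d2: "0 < d2" "d2 \<le> d1" "\<And>z. norm z \<le> d2 \<Longrightarrow>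
      (\<integral>\<^sup>+x. indicator A x * ennreal ((1 + norm (f x) powr (m - 1)) * norm (f (x + z) - f x)) \<partial>lborel) \<le> ennreal \<eta>"
    using Lm_translation_continuity[OF m f A(1) K d1(1) AK int_fm \<eta>] by blast
  have "uniformly_continuous_on K U"
    using compact_uniformly_continuous[OF continuous_on_subset[OF U(1)] K] by auto
  then obtain d3 where d3: "d3 > 0" "\<And>x y. x \<in> K \<Longrightarrow> y \<in> K \<Longrightarrow> dist y x < d3 \<Longrightarrow> dist (U y) (U x) < \<eta>"
    using \<eta> unfolding uniformly_continuous_on_def by metis
  \<comment> \<open>\<open>d2\<close> controls the gradients and \<open>d3\<close> the values;
    halving \<open>d3\<close> gives the strict inequality used with uniform continuity.\<close>
  define e where "e = min d2 (d3 / 2)"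
  have e: "e > 0" "e \<le> d1" "e \<le> d2" "e < d3" using d1 d2 d3 by (auto simp: e_def)
  define \<rho> where "\<rho> = (mollifier e :: 'a \<Rightarrow> real)"
  note mf = mollifier_facts[OF e(1), where 'a='a, folded \<rho>_def]
  have \<rho>c: "continuous_on UNIV \<rho>" and \<rho>d: "\<And>x. \<rho> differentiable (at x)"
    and \<rho>dc: "\<And>b. b \<in> Basis \<Longrightarrow> continuous_on UNIV (\<lambda>x. frechet_derivative \<rho> (at x) b)"
    using mf(1)[of "Suc 0"] by auto
  have [measurable]: "\<rho> \<in> borel_measurable borel" using \<rho>c by (rule borel_measurable_continuous_onI)
  have \<rho>sym: "\<rho> (x - y) = \<rho> (y - x)" for x y
    using mollifier_minus[of e "y - x"] by (simp add: \<rho>_def)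
  have \<rho>d0: "frechet_derivative \<rho> (at z) b = 0" if "norm z > e" for z b
  proof -
    have "(\<rho> has_derivative (\<lambda>_. 0)) (at z)"
      by (rule has_derivative_transform_within_open[where s="- cball 0 e" and f="\<lambda>_. 0"])
         (use that mf(3) in auto)
    then show ?thesis using frechet_derivative_at by metis
  qed
  define v where "v x = integral (cbox (-a) a) (\<lambda>y. \<rho> (x - y) * U y)" for x
  have vC: "Ck k v" for k
    unfolding v_def[abs_def] using mf(1) U(1) by (rule Ck_convolution)
  have shift1: "(\<integral>y. \<rho> (x - y) \<partial>lborel) = 1" and shiftint: "integrable lborel (\<lambda>y. \<rho> (x - y))" for x
  proof -
    have "integrable lborel (\<lambda>y. \<rho> (x - y))"
    proof (rule integrable_compact_support[of "cball x e"])
      show "continuous_on (cball x e) (\<lambda>y. \<rho> (x - y))"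
        by (intro continuous_on_compose2[OF \<rho>c] continuous_intros) auto
      show "\<rho> (x - y) = 0" if "y \<notin> cball x e" for y
        using that mf(3)[of "x - y"] by (auto simp: dist_norm)
    qed auto
    then show "integrable lborel (\<lambda>y. \<rho> (x - y))" .
    have "(\<integral>y. \<rho> (x - y) \<partial>lborel) = (\<integral>y. \<rho> (y + (- x)) \<partial>lborel)"
      using \<rho>sym[of x] by simp
    also have "\<dots> = 1" using lborel_integral_translate[of \<rho> "-x"] mf(5) by simp
    finally show "(\<integral>y. \<rho> (x - y) \<partial>lborel) = 1" .
  qed
  have far: "x \<in> A \<Longrightarrow> y \<notin> K \<Longrightarrow> norm (x - y) > e" for x y
    using AK'[of x y] e(2) by (metis norm_minus_commute not_less order_trans)
  have far': "x \<in> A \<Longrightarrow> y \<notin> cbox (-a) a \<Longrightarrow> norm (x - y) > e" for x y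
    using far a by blast
  have v_close: "\<bar>v x - u x\<bar> \<le> \<eta>" if x: "x \<in> A" for x
  proof -
    have xK: "x \<in> K" using AsubK x by auto
    have cont: "continuous_on UNIV (\<lambda>y. \<rho> (x - y) * U y)"
      by (intro continuous_intros continuous_on_compose2[OF \<rho>c] U(1)) auto
    have z: "\<rho> (x - y) * U y = 0" if "y \<notin> cbox (-a) a" for y
      using mf(3)[of "x - y"] far'[OF x that] by simp
    have i: "integrable lborel (\<lambda>y. \<rho> (x - y) * U y)"
      by (rule integrable_compact_support[of "cbox (-a) a"]) (use z in \<open>auto intro: continuous_on_subset[OF cont]\<close>)
    have "v x = (\<integral>y. \<rho> (x - y) * U y \<partial>lborel)"
      unfolding v_def by (rule integral_cbox_eq_lborel[OF cont z])
    moreover have "u x = (\<integral>y. \<rho> (x - y) * U x \<partial>lborel)"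
      using shift1[of x] shiftint[of x] U(2)[OF xK] by simp
    ultimately have "v x - u x = (\<integral>y. \<rho> (x - y) * U y - \<rho> (x - y) * U x \<partial>lborel)"
      using i shiftint[of x] by simp
    also have "norm \<dots> \<le> (\<integral>y. \<rho> (x - y) * \<eta> \<partial>lborel)"
    proof (rule Bochner_Integration.integral_norm_bound_integral)
      show "integrable lborel (\<lambda>y. \<rho> (x - y) * U y - \<rho> (x - y) * U x)" using i shiftint[of x] by simp
      show "integrable lborel (\<lambda>y. \<rho> (x - y) * \<eta>)" using shiftint[of x] by simp
      fix y
      show "norm (\<rho> (x - y) * U y - \<rho> (x - y) * U x) \<le> \<rho> (x - y) * \<eta>"
      proof (cases "norm (x - y) \<ge> e")
        case True
        then show ?thesis using mf(3)[of "x - y"] by simp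
      next
        case False
        then have y: "norm (y - x) < e" by (simp add: norm_minus_commute)
        then have "y \<in> K" using AK'[OF x, of y] e by simp
        then have "dist (U y) (U x) < \<eta>" using d3(2)[OF xK] y e(4) by (simp add: dist_norm)
        then have "\<rho> (x - y) * \<bar>U y - U x\<bar> \<le> \<rho> (x - y) * \<eta>"
          using mf(2) by (intro mult_left_mono) (auto simp: dist_real_def)
        then show ?thesis using mf(2)[of "x - y"] by (simp add: right_diff_distrib[symmetric] abs_mult)
      qed
    qed
    also have "\<dots> = \<eta>" using shift1[of x] shiftint[of x] by simp
    finally show ?thesis by simp
  qed
  have f\<rho>i: "integrable lborel (\<lambda>y. \<rho> (x - y) *\<^sub>R f y)" for x
  proof -
    have "compact (\<rho> ` cball 0 e)" by (intro compact_continuous_image continuous_on_subset[OF \<rho>c]) auto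
    then obtain M where M: "\<And>z. z \<in> cball 0 e \<Longrightarrow> norm (\<rho> z) \<le> M"
      using compact_imp_bounded by (force simp: bounded_iff)
    have M': "\<rho> z \<le> max M 0" for z
      using M[of z] mf(3)[of z] by (cases "norm z \<le> e") auto
    show ?thesis
    proof (rule Bochner_Integration.integrable_bound)
      show "integrable lborel (\<lambda>y. max M 0 * norm (f y))" using int_f by auto
      show "AE y in lborel. norm (\<rho> (x - y) *\<^sub>R f y) \<le> norm (max M 0 * norm (f y))"
        using M' mf(2) by (auto intro!: mult_right_mono)
    qed measurable
  qed
  \<comment> \<open>The weak gradient is tested with \<open>\<lambda>y. \<rho> (x - y)\<close>.
    Differentiating in \<open>y\<close> instead of \<open>x\<close> produces a minus sign, which
    cancels the one in the definition of the weak gradient.\<close>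
  have grad_v: "grad v x = (\<integral>y. \<rho> (x - y) *\<^sub>R f y \<partial>lborel)" if x: "x \<in> A" for x
  proof (rule euclidean_eqI)
    fix b :: 'a assume b: "b \<in> Basis"
    have xK: "x \<in> K" using AsubK x by auto
    have tf: "test_fun \<Omega> (\<lambda>y. \<rho> (x - y))"
    proof -
      have sub: "tsupport (\<lambda>y. \<rho> (x - y)) \<subseteq> cball x e"
        unfolding tsupport_def
      proof (rule closure_minimal)
        show "{y. \<rho> (x - y) \<noteq> 0} \<subseteq> cball x e"
          using mf(3) by (force simp: dist_norm)
      qed simp
      moreover have "cball x e \<subseteq> \<Omega>" using d1(2) x e(2) by fastforce
      moreover have "compact (tsupport (\<lambda>y. \<rho> (x - y)))"
        using sub bounded_subset[OF bounded_cball] by (simp add: compact_eq_bounded_closed tsupport_def)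
      ultimately show ?thesis using Ck_reflect[OF mf(1)] by (auto simp: test_fun_def smooth_fun_def)
    qed
    have fd: "frechet_derivative (\<lambda>y. \<rho> (x - y)) (at y) b = - frechet_derivative \<rho> (at (x - y)) b" for y
      by (rule frechet_derivative_reflect[OF \<rho>d])
    have cont: "continuous_on UNIV (\<lambda>y. frechet_derivative \<rho> (at (x - y)) b * U y)"
      by (intro continuous_intros continuous_on_compose2[OF \<rho>dc[OF b]] U(1)) auto
    have z: "frechet_derivative \<rho> (at (x - y)) b * U y = 0" if "y \<notin> cbox (-a) a" for y
      using \<rho>d0[of "x - y"] far'[OF x that] by simp
    have "(v has_derivative (\<lambda>h. \<Sum>b\<in>Basis. (h \<bullet> b) *
        integral (cbox (-a) a) (\<lambda>y. frechet_derivative \<rho> (at (x - y)) b * U y))) (at x)"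
      unfolding v_def[abs_def] by (rule convolution_has_derivative[OF mf(1) U(1)])
    from frechet_derivative_at[OF this, symmetric]
    have "grad v x \<bullet> b = integral (cbox (-a) a) (\<lambda>y. frechet_derivative \<rho> (at (x - y)) b * U y)"
      using b by (simp add: grad_def inner_sum_left inner_Basis if_distrib[of "\<lambda>c. c * _"] if_distrib[of "\<lambda>c. _ * c"] cong: if_cong)
    also have "\<dots> = (\<integral>y. frechet_derivative \<rho> (at (x - y)) b * U y \<partial>lborel)"
      by (rule integral_cbox_eq_lborel[OF cont z])
    also have "\<dots> = (LINT y:\<Omega>|lebesgue. frechet_derivative \<rho> (at (x - y)) b * U y)"
      by (rule set_lebesgue_integral_compact_support[OF K continuous_on_subset[OF cont] _ K\<Omega>, symmetric])
         (use \<rho>d0 far[OF x] in auto)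
    also have "\<dots> = (LINT y:\<Omega>|lebesgue. - (u y * frechet_derivative (\<lambda>y. \<rho> (x - y)) (at y) b))"
    proof -
      have "frechet_derivative \<rho> (at (x - y)) b * U y = - (u y * frechet_derivative (\<lambda>y. \<rho> (x - y)) (at y) b)" for y
        using fd[of y] U(2)[of y] \<rho>d0[of "x - y" b] far[OF x, of y] by (cases "y \<in> K") auto
      then show ?thesis by simp
    qed
    also have "\<dots> = - (LINT y:\<Omega>|lebesgue. u y * frechet_derivative (\<lambda>y. \<rho> (x - y)) (at y) b)"
      by (simp add: set_lebesgue_integral_def)
    also have "\<dots> = (LINT y:\<Omega>|lebesgue. (Du y \<bullet> b) * \<rho> (x - y))"
      using Wg tf b by (simp add: weak_grad_def)
    also have "\<dots> = (\<integral>y. (\<rho> (x - y) *\<^sub>R f y) \<bullet> b \<partial>lebesgue)"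
      unfolding set_lebesgue_integral_def
    proof (rule integral_cong_AE)
      have "(\<lambda>y. ((indicator \<Omega> y *\<^sub>R Du y) \<bullet> b) * \<rho> (x - y)) \<in> borel_measurable lebesgue"
        using meas\<Omega> by (intro borel_measurable_times borel_measurable_inner) (auto intro: measurable_completion)
      then show "(\<lambda>y. indicator \<Omega> y *\<^sub>R ((Du y \<bullet> b) * \<rho> (x - y))) \<in> borel_measurable lebesgue"
        by (simp add: mult_ac)
      show "(\<lambda>y. (\<rho> (x - y) *\<^sub>R f y) \<bullet> b) \<in> borel_measurable lebesgue"
        by (auto intro: measurable_completion)
      show "AE y in lebesgue. indicator \<Omega> y *\<^sub>R ((Du y \<bullet> b) * \<rho> (x - y)) = (\<rho> (x - y) *\<^sub>R f y) \<bullet> b"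
        using fAE'
      proof eventually_elim
        case (elim y)
        show ?case
        proof (cases "y \<in> K")
          case True
          then show ?thesis using elim K\<Omega> by (auto simp: mult_ac)
        next
          case False
          then show ?thesis using mf(3)[of "x - y"] far[OF x False] by simp
        qed
      qed
    qed
    also have "\<dots> = (\<integral>y. (\<rho> (x - y) *\<^sub>R f y) \<bullet> b \<partial>lborel)"
      by (rule integral_completion) measurable
    also have "\<dots> = (\<integral>y. \<rho> (x - y) *\<^sub>R f y \<partial>lborel) \<bullet> b"
      using f\<rho>i by (intro integral_inner_left) auto
    finally show "grad v x \<bullet> b = (\<integral>y. \<rho> (x - y) *\<^sub>R f y \<partial>lborel) \<bullet> b" .
  qed
  have grad_diff: "ennreal (norm (grad v x - f x)) \<le> (\<integral>\<^sup>+z. ennreal (\<rho> z * norm (f (x + z) - f x)) \<partial>lborel)" if x: "x \<in> A" for x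
  proof -
    have "grad v x - f x = (\<integral>y. \<rho> (x - y) *\<^sub>R f y \<partial>lborel) - (\<integral>y. \<rho> (x - y) *\<^sub>R f x \<partial>lborel)"
      using shift1[of x] shiftint[of x] grad_v[OF x] by simp
    also have "\<dots> = (\<integral>y. \<rho> (x - y) *\<^sub>R f y - \<rho> (x - y) *\<^sub>R f x \<partial>lborel)"
      using f\<rho>i shiftint[of x] by (intro Bochner_Integration.integral_diff[symmetric]) auto
    finally have "grad v x - f x = (\<integral>y. \<rho> (x - y) *\<^sub>R f y - \<rho> (x - y) *\<^sub>R f x \<partial>lborel)" .
    then have "ennreal (norm (grad v x - f x)) \<le> (\<integral>\<^sup>+y. ennreal (norm (\<rho> (x - y) *\<^sub>R f y - \<rho> (x - y) *\<^sub>R f x)) \<partial>lborel)"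
      using integral_norm_bound_ennreal[of lborel "\<lambda>y. \<rho> (x - y) *\<^sub>R f y - \<rho> (x - y) *\<^sub>R f x"] f\<rho>i shiftint[of x] by simp
    also have "\<dots> = (\<integral>\<^sup>+y. (\<lambda>z. ennreal (\<rho> z * norm (f (x + z) - f x))) (y + (- x)) \<partial>lborel)"
      using mf(2) \<rho>sym[of x] by (simp add: scaleR_right_diff_distrib[symmetric])
    also have "\<dots> = (\<integral>\<^sup>+z. ennreal (\<rho> z * norm (f (x + z) - f x)) \<partial>lborel)"
      by (rule lborel_nn_integral_translate) measurable
    finally show ?thesis .
  qed
  define Wt where "Wt x = indicator A x * (1 + norm (f x) powr (m - 1))" for x
  have Wt0: "Wt x \<ge> 0" for x by (simp add: Wt_def)
  have [measurable]: "Wt \<in> borel_measurable borel" unfolding Wt_def by measurable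
  have "(\<integral>\<^sup>+x. indicator A x * ennreal ((1 + norm (Du x) powr (m - 1)) * norm (grad v x - Du x)) \<partial>lebesgue)
      = (\<integral>\<^sup>+x. indicator A x * ennreal ((1 + norm (Du x) powr (m - 1)) * norm (grad v x - Du x)) \<partial>lborel)"
    by (rule nn_integral_completion)
  also have "\<dots> \<le> (\<integral>\<^sup>+x. (\<integral>\<^sup>+z. ennreal (Wt x) * ennreal (\<rho> z * norm (f (x + z) - f x)) \<partial>lborel) \<partial>lborel)"
  proof (rule nn_integral_mono_AE)
    show "AE x in lborel. indicator A x * ennreal ((1 + norm (Du x) powr (m - 1)) * norm (grad v x - Du x))
      \<le> (\<integral>\<^sup>+z. ennreal (Wt x) * ennreal (\<rho> z * norm (f (x + z) - f x)) \<partial>lborel)"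
      using fAE
    proof eventually_elim
      case (elim x)
      show ?case
      proof (cases "x \<in> A")
        case True
        then have "Du x = f x" using elim AsubK by auto
        then have "indicator A x * ennreal ((1 + norm (Du x) powr (m - 1)) * norm (grad v x - Du x))
          = ennreal (Wt x) * ennreal (norm (grad v x - f x))"
          using True by (simp add: Wt_def ennreal_mult)
        also have "\<dots> \<le> ennreal (Wt x) * (\<integral>\<^sup>+z. ennreal (\<rho> z * norm (f (x + z) - f x)) \<partial>lborel)"
          by (intro mult_left_mono grad_diff True) auto
        also have "\<dots> = (\<integral>\<^sup>+z. ennreal (Wt x) * ennreal (\<rho> z * norm (f (x + z) - f x)) \<partial>lborel)"
          by (rule nn_integral_cmult[symmetric]) measurable
        finally show ?thesis .
      qed simp
    qed
  qed
  \<comment> \<open>Exchanging the integrals leaves, for each fixed shift \<open>z\<close> of length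
    at most \<open>d2\<close>, the quantity already bounded by \<eta>; longer shifts carry no
    mollifier mass.\<close>
  also have "\<dots> = (\<integral>\<^sup>+z. (\<integral>\<^sup>+x. ennreal (Wt x) * ennreal (\<rho> z * norm (f (x + z) - f x)) \<partial>lborel) \<partial>lborel)"
    by (rule lborel_pair.Fubini') measurable
  also have "\<dots> \<le> (\<integral>\<^sup>+z. ennreal (\<rho> z) * ennreal \<eta> \<partial>lborel)"
  proof (rule nn_integral_mono)
    fix z
    have "(\<integral>\<^sup>+x. ennreal (Wt x) * ennreal (\<rho> z * norm (f (x + z) - f x)) \<partial>lborel)
        = (\<integral>\<^sup>+x. ennreal (\<rho> z) * (indicator A x * ennreal ((1 + norm (f x) powr (m - 1)) * norm (f (x + z) - f x))) \<partial>lborel)"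
      using mf(2) by (intro nn_integral_cong) (auto simp: Wt_def ennreal_mult mult_ac split: split_indicator)
    also have "\<dots> = ennreal (\<rho> z) * (\<integral>\<^sup>+x. indicator A x * ennreal ((1 + norm (f x) powr (m - 1)) * norm (f (x + z) - f x)) \<partial>lborel)"
      by (rule nn_integral_cmult) measurable
    also have "\<dots> \<le> ennreal (\<rho> z) * ennreal \<eta>"
    proof (cases "norm z \<le> d2")
      case True
      then show ?thesis by (intro mult_left_mono d2(3)) auto
    next
      case False
      then show ?thesis using mf(3)[of z] e(3) by simp
    qed
    finally show "(\<integral>\<^sup>+x. ennreal (Wt x) * ennreal (\<rho> z * norm (f (x + z) - f x)) \<partial>lborel) \<le> ennreal (\<rho> z) * ennreal \<eta>" .
  qed
  also have "\<dots> = (\<integral>\<^sup>+z. ennreal (\<rho> z) \<partial>lborel) * ennreal \<eta>"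
    by (rule nn_integral_multc) measurable
  also have "(\<integral>\<^sup>+z. ennreal (\<rho> z) \<partial>lborel) = 1"
    using mf(2,4,5) by (simp add: nn_integral_eq_integral)
  finally show thesis
    using that[of v] vC v_close by (simp add: smooth_fun_def)
qed

section \<open>Radial powers and the flux\<close>

abbreviation flux :: "real \<Rightarrow> ('a::euclidean_space \<Rightarrow> 'a) \<Rightarrow> ('a \<Rightarrow> real) \<Rightarrow> 'a \<Rightarrow> real" where
  "flux m D \<phi> x \<equiv> norm (D x) powr (m - 2) * (D x \<bullet> grad \<phi> x)"

abbreviation riesz_pow :: "real \<Rightarrow> real \<Rightarrow> ('a::euclidean_space \<Rightarrow> real) \<Rightarrow> 'a \<Rightarrow> ennreal" where
  "riesz_pow \<alpha> p u \<equiv> riesz_conv \<alpha> (\<lambda>y. u y powr p)"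

definition Kfun :: "real \<Rightarrow> nat \<Rightarrow> real \<Rightarrow> real" where
  "Kfun m N b = b powr (m - 1) * ((m - 1) * b + m - real N)"

lemma open_ext_dom: "open (ext_dom :: 'a::euclidean_space set)"
  by (simp add: ext_dom_def open_Compl)

lemma ext_dom_iff: "x \<in> ext_dom \<longleftrightarrow> norm x > 1"
  by (auto simp: ext_dom_def)

lemma ext_dom_nonzero: "x \<in> ext_dom \<Longrightarrow> x \<noteq> 0"
  by (auto simp: ext_dom_def)

lemma borel_ext_dom[measurable]: "(ext_dom :: 'a::euclidean_space set) \<in> sets borel"
  by (simp add: open_ext_dom borel_open)

lemma lebesgue_ext_dom[measurable]: "(ext_dom :: 'a::euclidean_space set) \<in> sets lebesgue"
  using borel_ext_dom by auto

lemma norm_powr_has_derivative: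
  fixes x :: "'a::euclidean_space"
  assumes "x \<noteq> 0"
  shows "((\<lambda>x. norm x powr a) has_derivative (\<lambda>h. a * norm x powr (a - 2) * (x \<bullet> h))) (at x)"
proof -
  have n: "(norm has_derivative (\<lambda>h. x \<bullet> h / norm x)) (at x)"
    using has_derivative_norm[OF assms] by (simp add: sgn_div_norm inner_commute divide_inverse mult.commute)
  have p: "((\<lambda>t. t powr a) has_real_derivative a * norm x powr (a - 1)) (at (norm x))"
    using assms by (intro has_real_derivative_powr) auto
  have "((\<lambda>x. norm x powr a) has_derivative (\<lambda>h. a * norm x powr (a - 1) * (x \<bullet> h / norm x))) (at x)"
    using has_derivative_compose[OF n p[unfolded has_field_derivative_def]] by simp
  moreover have "norm x powr (a - 1) = norm x powr (a - 2) * norm x"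
    using assms powr_add[of "norm x" "a - 2" 1] by simp
  ultimately show ?thesis using assms by (simp add: mult.assoc)
qed

lemma inner_grad: "h \<bullet> grad \<phi> x = (\<Sum>b\<in>Basis. (h \<bullet> b) * frechet_derivative \<phi> (at x) b)"
  by (simp add: grad_def inner_sum_right mult.commute)

lemma grad_eqI:
  assumes "(\<phi> has_derivative (\<lambda>h. h \<bullet> g)) (at x)"
  shows "grad \<phi> x = g"
proof -
  have "frechet_derivative \<phi> (at x) = (\<lambda>h. h \<bullet> g)"
    using frechet_derivative_at[OF assms] by simp
  then have "grad \<phi> x = (\<Sum>b\<in>Basis. (g \<bullet> b) *\<^sub>R b)" by (simp add: grad_def inner_commute)
  then show ?thesis by (simp add: euclidean_representation)
qed

lemma continuous_on_grad: "smooth_fun v \<Longrightarrow> continuous_on UNIV (grad v)"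
proof -
  assume "smooth_fun v"
  then have "Ck (Suc 0) v" by (simp add: smooth_fun_def del: Ck.simps)
  then show ?thesis unfolding grad_def[abs_def] by (intro continuous_intros) auto
qed

lemma test_fun_grad:
  assumes "test_fun \<Omega> \<phi>"
  shows "continuous_on UNIV (grad \<phi>)" "x \<notin> tsupport \<phi> \<Longrightarrow> grad \<phi> x = 0"
    "\<exists>C\<ge>0. \<forall>x. norm (grad \<phi> x) \<le> C"
proof -
  show c: "continuous_on UNIV (grad \<phi>)"
    using assms by (intro continuous_on_grad) (auto simp: test_fun_def)
  show z: "x \<notin> tsupport \<phi> \<Longrightarrow> grad \<phi> x = 0" for x
    using test_fun_facts(7)[OF assms] by (simp add: grad_def)
  have "compact (grad \<phi> ` tsupport \<phi>)"
    using test_fun_facts(4)[OF assms] by (intro compact_continuous_image continuous_on_subset[OF c]) auto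
  then obtain C where C: "\<And>x. x \<in> tsupport \<phi> \<Longrightarrow> norm (grad \<phi> x) \<le> C"
    using compact_imp_bounded by (force simp: bounded_iff)
  have "norm (grad \<phi> x) \<le> max C 0" for x
    using C[of x] z[of x] by (cases "x \<in> tsupport \<phi>") auto
  then show "\<exists>C\<ge>0. \<forall>x. norm (grad \<phi> x) \<le> C" by (intro exI[of _ "max C 0"]) auto
qed

lemma continuous_on_norm_powr_ext_dom:
  "continuous_on (ext_dom :: 'a::euclidean_space set) (\<lambda>x. norm x powr a)"
  by (intro continuous_intros) (use ext_dom_nonzero in auto)

text \<open>Weak form of div(|x|^(-a) x) = (N - a) |x|^(-a), summed from integrations by parts in
  each coordinate. This is the explicit divergence from which \<open>Kfun\<close> arises.\<close>

lemma radial_field_integral: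
  fixes \<phi> :: "'a::euclidean_space \<Rightarrow> real"
  assumes t: "test_fun ext_dom \<phi>"
  shows "(LINT x:ext_dom|lebesgue. norm x powr (- a) * (x \<bullet> grad \<phi> x))
       = (a - real DIM('a)) * (LINT x:ext_dom|lebesgue. norm x powr (- a) * \<phi> x)"
proof -
  note tf = test_fun_facts[OF t]
  define g' where "g' b x h = norm x powr (- a) * (h \<bullet> b) + ((- a) * norm x powr (- a - 2) * (x \<bullet> h)) * (x \<bullet> b)" for b x h :: 'a
  have d: "((\<lambda>x. norm x powr (- a) * (x \<bullet> b)) has_derivative g' b x) (at x)" if "x \<in> ext_dom" for b x :: 'a
  proof -
    have "x \<noteq> 0" using that by (rule ext_dom_nonzero)
    moreover have "((\<lambda>x. x \<bullet> b) has_derivative (\<lambda>h. h \<bullet> b)) (at x)" by (auto intro!: derivative_eq_intros)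
    ultimately show ?thesis
      using has_derivative_mult[OF norm_powr_has_derivative, of x "\<lambda>x. x \<bullet> b" "\<lambda>h. h \<bullet> b" "- a"]
      by (simp add: g'_def[abs_def])
  qed
  have cg': "continuous_on ext_dom (\<lambda>x. g' b x b)" for b :: 'a
    unfolding g'_def by (intro continuous_intros continuous_on_norm_powr_ext_dom)
  have ibp: "(LINT x:ext_dom|lebesgue. (norm x powr (- a) * (x \<bullet> b)) * frechet_derivative \<phi> (at x) b)
       = - (LINT x:ext_dom|lebesgue. g' b x b * \<phi> x)" if "b \<in> Basis" for b
    by (rule test_fun_integration_by_parts[OF open_ext_dom t d cg' that])
  have i1: "set_integrable lebesgue ext_dom (\<lambda>x. (norm x powr (- a) * (x \<bullet> b)) * frechet_derivative \<phi> (at x) b)"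
    if "b \<in> Basis" for b
  proof (rule set_integrable_compact_support[OF tf(4) _ _ tf(5)])
    show "continuous_on (tsupport \<phi>) (\<lambda>x. (norm x powr (- a) * (x \<bullet> b)) * frechet_derivative \<phi> (at x) b)"
      by (intro continuous_intros continuous_on_subset[OF continuous_on_norm_powr_ext_dom tf(5)]
          continuous_on_subset[OF tf(3)[OF that]]) auto
  qed (use tf in auto)
  have i2: "set_integrable lebesgue ext_dom (\<lambda>x. g' b x b * \<phi> x)" for b
  proof (rule set_integrable_compact_support[OF tf(4) _ _ tf(5)])
    show "continuous_on (tsupport \<phi>) (\<lambda>x. g' b x b * \<phi> x)"
      by (intro continuous_intros continuous_on_subset[OF cg' tf(5)] continuous_on_subset[OF tf(1)]) auto
  qed (use tf in auto)
  have "(LINT x:ext_dom|lebesgue. norm x powr (- a) * (x \<bullet> grad \<phi> x))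
     = (LINT x:ext_dom|lebesgue. \<Sum>b\<in>Basis. (norm x powr (- a) * (x \<bullet> b)) * frechet_derivative \<phi> (at x) b)"
    by (simp add: inner_grad sum_distrib_left mult_ac)
  also have "\<dots> = (\<Sum>b\<in>Basis. LINT x:ext_dom|lebesgue. (norm x powr (- a) * (x \<bullet> b)) * frechet_derivative \<phi> (at x) b)"
    using i1 unfolding set_lebesgue_integral_def set_integrable_def scaleR_sum_right
    by (intro Bochner_Integration.integral_sum) auto
  also have "\<dots> = (\<Sum>b\<in>Basis. - (LINT x:ext_dom|lebesgue. g' b x b * \<phi> x))"
    by (intro sum.cong ibp refl)
  also have "\<dots> = - (LINT x:ext_dom|lebesgue. \<Sum>b\<in>Basis. g' b x b * \<phi> x)"
    using i2 unfolding set_lebesgue_integral_def set_integrable_def scaleR_sum_right sum_negf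
    by (subst Bochner_Integration.integral_sum) auto
  also have "(LINT x:ext_dom|lebesgue. \<Sum>b\<in>Basis. g' b x b * \<phi> x)
     = (LINT x:ext_dom|lebesgue. (real DIM('a) - a) * (norm x powr (- a) * \<phi> x))"
  proof (rule set_lebesgue_integral_cong)
    show "\<forall>x. x \<in> ext_dom \<longrightarrow> (\<Sum>b\<in>Basis. g' b x b * \<phi> x) = (real DIM('a) - a) * (norm x powr (- a) * \<phi> x)"
    proof (intro allI impI)
      fix x :: 'a assume "x \<in> ext_dom"
      then have x: "norm x > 0" using ext_dom_nonzero by simp
      have "(\<Sum>b\<in>Basis. g' b x b) = real DIM('a) * norm x powr (- a) - a * norm x powr (- a - 2) * (\<Sum>b\<in>Basis. (x \<bullet> b) * (x \<bullet> b))"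
        by (simp add: g'_def sum.distrib sum_subtractf sum_distrib_left mult_ac)
      also have "(\<Sum>b\<in>Basis. (x \<bullet> b) * (x \<bullet> b)) = norm x powr 2"
        using x by (simp add: euclidean_inner[symmetric] power2_norm_eq_inner[symmetric])
      also have "a * norm x powr (- a - 2) * norm x powr 2 = a * norm x powr (- a)"
        by (simp add: mult.assoc powr_add[symmetric] del: powr_numeral)
      finally have s: "(\<Sum>b\<in>Basis. g' b x b) = (real DIM('a) - a) * norm x powr (- a)"
        by (simp add: algebra_simps)
      show "(\<Sum>b\<in>Basis. g' b x b * \<phi> x) = (real DIM('a) - a) * (norm x powr (- a) * \<phi> x)"
        unfolding sum_distrib_right[symmetric] s by simp
    qed
  qed simp
  also have "- (LINT x:ext_dom|lebesgue. (real DIM('a) - a) * (norm x powr (- a) * \<phi> x))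
    = (a - real DIM('a)) * (LINT x:ext_dom|lebesgue. norm x powr (- a) * \<phi> x)"
    unfolding set_integral_mult_right by (simp add: left_diff_distrib)
  finally show ?thesis .
qed

section \<open>The flux of a radial power\<close>

definition power_grad :: "real \<Rightarrow> real \<Rightarrow> 'a::euclidean_space \<Rightarrow> 'a" where
  "power_grad c \<gamma> x = (- (c * \<gamma> * norm x powr (- \<gamma> - 2))) *\<^sub>R x"

lemma power_has_derivative:
  fixes x :: "'a::euclidean_space"
  assumes "x \<noteq> 0"
  shows "((\<lambda>x. c * norm x powr (- \<gamma>)) has_derivative (\<lambda>h. h \<bullet> power_grad c \<gamma> x)) (at x)"
  using has_derivative_mult_right[OF norm_powr_has_derivative[OF assms, of "- \<gamma>"], of c]
  by (simp add: power_grad_def inner_commute mult_ac)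

lemma norm_power_grad:
  assumes "c > 0" "\<gamma> > 0" "x \<noteq> 0"
  shows "norm (power_grad c \<gamma> x) = c * \<gamma> * norm x powr (- \<gamma> - 1)"
proof -
  have "norm x powr (- \<gamma> - 2) * norm x powr 1 = norm x powr (- \<gamma> - 1)"
    unfolding powr_add[symmetric] by (rule arg_cong) simp
  then show ?thesis using assms by (simp add: power_grad_def)
qed

text \<open>The nonlinear flux of c |x|^(-\<gamma>) is again a constant times a radial field
  |x|^(-a) x, now with a = \<gamma>(m-1) + m, so that \<open>radial_field_integral\<close>
  applies.\<close>

lemma power_flux_eq:
  assumes "c > 0" "\<gamma> > 0" "x \<noteq> 0"
  shows "norm (power_grad c \<gamma> x) powr (m - 2) * (power_grad c \<gamma> x \<bullet> y)
     = - ((c * \<gamma>) powr (m - 1)) * (norm x powr (- (\<gamma> * (m - 1) + m)) * (x \<bullet> y))"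
proof -
  have "norm (power_grad c \<gamma> x) powr (m - 2) = (c * \<gamma>) powr (m - 2) * norm x powr ((- \<gamma> - 1) * (m - 2))"
    using assms by (simp add: norm_power_grad powr_mult powr_powr)
  then have "norm (power_grad c \<gamma> x) powr (m - 2) * (power_grad c \<gamma> x \<bullet> y)
    = - (((c * \<gamma>) powr (m - 2) * (c * \<gamma>)) * (norm x powr ((- \<gamma> - 1) * (m - 2)) * norm x powr (- \<gamma> - 2)) * (x \<bullet> y))"
    by (simp add: power_grad_def mult_ac)
  also have "(c * \<gamma>) powr (m - 2) * (c * \<gamma>) = (c * \<gamma>) powr (m - 1)"
    using assms powr_add[of "c * \<gamma>" "m - 2" 1] by simp
  also have "norm x powr ((- \<gamma> - 1) * (m - 2)) * norm x powr (- \<gamma> - 2) = norm x powr (- (\<gamma> * (m - 1) + m))"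
    unfolding powr_add[symmetric] by (simp add: algebra_simps)
  finally show ?thesis by simp
qed

text \<open>With a = \<gamma>(m-1) + m, the factor a - N times (c \<gamma>)^(m-1) is c^(m-1)
  K(\<gamma>); this is where the formula for \<open>Kfun\<close> originates.\<close>

lemma power_flux_integral:
  fixes \<phi> :: "'a::euclidean_space \<Rightarrow> real"
  assumes t: "test_fun ext_dom \<phi>" and c: "c > 0" "\<gamma> > 0"
  shows "(LINT x:ext_dom|lebesgue. flux m (power_grad c \<gamma>) \<phi> x)
    = - (c powr (m - 1) * Kfun m DIM('a) \<gamma> * (LINT x:ext_dom|lebesgue. norm x powr (- (\<gamma> * (m - 1) + m)) * \<phi> x))"
proof -
  have "(LINT x:ext_dom|lebesgue. flux m (power_grad c \<gamma>) \<phi> x)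
    = (LINT x:ext_dom|lebesgue. - ((c * \<gamma>) powr (m - 1)) * (norm x powr (- (\<gamma> * (m - 1) + m)) * (x \<bullet> grad \<phi> x)))"
    by (rule set_lebesgue_integral_cong) (simp, use power_flux_eq[OF c ext_dom_nonzero] in blast)
  also have "\<dots> = - ((c * \<gamma>) powr (m - 1)) * ((\<gamma> * (m - 1) + m - real DIM('a)) * (LINT x:ext_dom|lebesgue. norm x powr (- (\<gamma> * (m - 1) + m)) * \<phi> x))"
    unfolding set_integral_mult_right radial_field_integral[OF t] ..
  also have "(c * \<gamma>) powr (m - 1) = c powr (m - 1) * \<gamma> powr (m - 1)" using c by (simp add: powr_mult)
  finally show ?thesis by (simp add: Kfun_def mult_ac)
qed

text \<open>Expanding the product and applying Cauchy-Schwarz to the mixed terms reduces the claim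
  to the monotonicity of t^(m-1) on the half-line, evaluated at the two norms.\<close>

lemma flux_monotone:
  fixes a b :: "'a::euclidean_space"
  assumes "m > 1"
  shows "(norm a powr (m - 2) *\<^sub>R a - norm b powr (m - 2) *\<^sub>R b) \<bullet> (a - b) \<ge> 0"
proof -
  have p: "t powr (m - 2) * t = t powr (m - 1)" if "t \<ge> 0" for t :: real
    using that powr_add[of t "m - 2" 1] by (cases "t = 0") auto
  have "(norm a powr (m - 2) *\<^sub>R a - norm b powr (m - 2) *\<^sub>R b) \<bullet> (a - b)
     = norm a powr (m - 2) * norm a * norm a + norm b powr (m - 2) * norm b * norm b
       - (norm a powr (m - 2) + norm b powr (m - 2)) * (a \<bullet> b)"
    by (simp add: inner_diff_left inner_diff_right algebra_simps inner_commute dot_square_norm power2_eq_square)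
  also have "\<dots> \<ge> norm a powr (m - 2) * norm a * norm a + norm b powr (m - 2) * norm b * norm b
       - (norm a powr (m - 2) + norm b powr (m - 2)) * (norm a * norm b)"
    using norm_cauchy_schwarz[of a b] by (intro diff_left_mono mult_left_mono) auto
  also have "norm a powr (m - 2) * norm a * norm a + norm b powr (m - 2) * norm b * norm b
       - (norm a powr (m - 2) + norm b powr (m - 2)) * (norm a * norm b)
     = (norm a powr (m - 2) * norm a - norm b powr (m - 2) * norm b) * (norm a - norm b)"
    by (simp add: algebra_simps)
  also have "\<dots> = (norm a powr (m - 1) - norm b powr (m - 1)) * (norm a - norm b)" by (simp add: p)
  also have "\<dots> \<ge> 0"
    using assms powr_mono2[of "m - 1" "norm a" "norm b"] powr_mono2[of "m - 1" "norm b" "norm a"]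
    by (cases "norm a \<le> norm b") (auto intro: mult_nonpos_nonpos)
  finally show ?thesis .
qed

lemma norm_flux: "norm (norm a powr (m - 2) *\<^sub>R a) = norm a powr (m - 1)"
  using powr_add[of "norm a" "m - 2" 1] by (cases "a = 0") auto

text \<open>The flux has modulus |Du|^(m-1), which is at most a multiple of 1 + |Du|^m, and the
  gradient of \<open>\<phi>\<close> is bounded with compact support.\<close>

lemma flux_integrable:
  assumes m: "m > 1" and W: "W1loc m ext_dom u Du" and t: "test_fun ext_dom \<phi>"
  shows "set_integrable lebesgue ext_dom (\<lambda>x. flux m Du \<phi> x)"
proof -
  note tf = test_fun_facts[OF t]
  define K where "K = tsupport \<phi>"
  have K: "compact K" "K \<subseteq> ext_dom" using tf by (auto simp: K_def)
  have [measurable]: "K \<in> sets borel" by (intro borel_closed compact_imp_closed K)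
  obtain C where C: "C \<ge> 0" "\<And>x. norm (grad \<phi> x) \<le> C" using test_fun_grad(3)[OF t] by auto
  have measD: "(\<lambda>x. indicator ext_dom x *\<^sub>R Du x) \<in> borel_measurable lebesgue"
    using W by (simp add: W1loc_def weak_grad_def set_borel_measurable_def)
  have "integrable lebesgue (\<lambda>x. indicator K x *\<^sub>R \<bar>norm (Du x)\<bar> powr m)"
    using W K by (simp add: W1loc_def Lloc_def set_integrable_def)
  moreover have "integrable lebesgue (indicat_real K)"
    using emeasure_bounded_finite[OF compact_imp_bounded[OF K(1)]] by (intro integrable_real_indicator) auto
  ultimately have "integrable lebesgue (\<lambda>x. (2 * C) * (indicat_real K x + indicator K x *\<^sub>R \<bar>norm (Du x)\<bar> powr m))"
    by (intro integrable_mult_right Bochner_Integration.integrable_add)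
  then show ?thesis
    unfolding set_integrable_def
  proof (rule Bochner_Integration.integrable_bound)
    define D where "D x = indicator ext_dom x *\<^sub>R Du x" for x
    have [measurable]: "D \<in> borel_measurable lebesgue" using measD by (simp add: D_def[abs_def])
    have [measurable]: "grad \<phi> \<in> borel_measurable lebesgue"
      using borel_measurable_continuous_onI[OF test_fun_grad(1)[OF t]] by (simp add: measurable_completion)
    have "(\<lambda>x. norm (D x) powr (m - 2) * (D x \<bullet> grad \<phi> x)) \<in> borel_measurable lebesgue" by measurable
    moreover have "norm (D x) powr (m - 2) * (D x \<bullet> grad \<phi> x) = indicator ext_dom x *\<^sub>R (flux m Du \<phi> x)" for x
      by (auto simp: D_def indicator_def)
    ultimately show "(\<lambda>x. indicator ext_dom x *\<^sub>R (flux m Du \<phi> x)) \<in> borel_measurable lebesgue"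
      by simp
    show "AE x in lebesgue. norm (indicator ext_dom x *\<^sub>R (flux m Du \<phi> x))
      \<le> norm ((2 * C) * (indicat_real K x + indicator K x *\<^sub>R \<bar>norm (Du x)\<bar> powr m))"
    proof (rule AE_I2)
      fix x
      show "norm (indicator ext_dom x *\<^sub>R (flux m Du \<phi> x))
      \<le> norm ((2 * C) * (indicat_real K x + indicator K x *\<^sub>R \<bar>norm (Du x)\<bar> powr m))"
      proof (cases "x \<in> K")
        case True
        have "norm (flux m Du \<phi> x) = \<bar>(norm (Du x) powr (m - 2) *\<^sub>R Du x) \<bullet> grad \<phi> x\<bar>"
          by simp
        also have "\<dots> \<le> norm (Du x) powr (m - 1) * norm (grad \<phi> x)"
          using Cauchy_Schwarz_ineq2[of "norm (Du x) powr (m - 2) *\<^sub>R Du x" "grad \<phi> x"] by (simp only: norm_flux)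
        also have "\<dots> \<le> (2 * (1 + norm (Du x) powr m)) * C"
          using C weight_interpolation(2)[of "norm (Du x)" 0 1 m] m by (intro mult_mono) auto
        finally show ?thesis using True K C by (auto simp: mult_ac)
      next
        case False
        then have "grad \<phi> x = 0" using test_fun_grad(2)[OF t] by (simp add: K_def)
        then show ?thesis by simp
      qed
    qed
  qed
qed

section \<open>Comparison principle\<close>

lemma smooth_fun_has_derivative:
  assumes "smooth_fun v"
  shows "(v has_derivative (\<lambda>h. h \<bullet> grad v x)) (at x)"
proof -
  have "Ck_on (Suc 0) UNIV v" using assms by (simp add: smooth_fun_def Ck_on_UNIV del: Ck.simps)
  from Ck_on_Suc_derivative[OF this, of x] show ?thesis by (simp add: inner_grad)
qed

text \<open>A smooth substitute for the positive part of \<open>W\<close>, restricted to an annulus.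
  Since \<open>W < 0\<close> on both bounding spheres, the cut to zero takes place where
  \<open>flat_exp 0 (W x)\<close> already vanishes. The index 2 in the gradient comes from
  differentiating \<open>flat_exp 0\<close>.\<close>

lemma annulus_test_fun:
  fixes v :: "'a::euclidean_space \<Rightarrow> real" and b c rin rout \<epsilon> :: real
  assumes R: "1 < rin" and v: "smooth_fun v"
  defines "W \<equiv> \<lambda>x. c * norm x powr (- b) - \<epsilon> - v x"
  defines "A \<equiv> {x. rin \<le> norm x \<and> norm x \<le> rout}"
  defines "\<phi> \<equiv> \<lambda>x. if x \<in> A then flat_exp 0 (W x) else 0"
  assumes neg: "\<And>x. norm x = rin \<Longrightarrow> W x < 0" "\<And>x. norm x = rout \<Longrightarrow> W x < 0"
  shows "test_fun ext_dom \<phi>" "tsupport \<phi> \<subseteq> {x\<in>A. W x \<ge> 0}"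
    "grad \<phi> x = (if x \<in> A then flat_exp 2 (W x) else 0) *\<^sub>R (power_grad c b x - grad v x)"
proof -
  have vC: "Ck_on k UNIV v" for k using v by (simp add: smooth_fun_def Ck_on_UNIV)
  have A0: "x \<noteq> 0" if "x \<in> A" for x using that R by (auto simp: A_def)
  have WC: "Ck_on k (- {0}) W" for k
    unfolding W_def using Ck_on_norm_powr vC[THEN Ck_on_subset]
    by (intro Ck_on_diff Ck_on_mult Ck_on_const) auto
  have Wc: "continuous_on (- {0}) W" using Ck_on_continuous[OF WC] .
  have A: "compact A"
  proof -
    have "A = cball 0 rout - ball 0 rin" by (auto simp: A_def)
    then show ?thesis by (simp add: compact_diff)
  qed
  \<comment> \<open>Two open sets cover the space: on \<open>T1\<close> the formula with
    \<open>W\<close> holds, on \<open>T2\<close> the function is zero. The bounding spheres lie in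
    \<open>T2\<close> by the sign assumptions, and the origin because \<open>rin\<close> is
    positive.\<close>
  define T1 where "T1 = {x::'a. rin < norm x \<and> norm x < rout}"
  define T2 where "T2 = {x::'a. norm x < rin} \<union> {x. rout < norm x} \<union> {x \<in> - {0}. W x \<in> {..<0}}"
  have T1: "open T1" unfolding T1_def by (intro open_Collect_conj open_Collect_less continuous_intros)
  have "open {x \<in> - {0}. W x \<in> {..<0}}"
    using continuous_open_preimage[OF Wc _ open_lessThan, of 0] by (simp add: vimage_def Int_def open_Compl)
  then have T2: "open T2" unfolding T2_def by (intro open_Un open_Collect_less continuous_intros)
  have T12: "x \<in> T1 \<or> x \<in> T2" for x
    using neg(1)[of x] neg(2)[of x] R by (auto simp: T1_def T2_def not_less)
  have T1A: "T1 \<subseteq> A" by (auto simp: T1_def A_def)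
  have phi1: "\<phi> x = flat_exp 0 (W x)" if "x \<in> T1" for x using that T1A by (auto simp: \<phi>_def)
  have T2W: "x \<in> T2 \<Longrightarrow> x \<in> A \<Longrightarrow> W x < 0" for x by (auto simp: T2_def A_def)
  have phi2: "\<phi> x = 0" if "x \<in> T2" for x
    using T2W[OF that] by (auto simp: \<phi>_def flat_exp_def)
  have "Ck_on k UNIV \<phi>" for k
  proof (rule Ck_on_local)
    fix x :: 'a
    show "\<exists>T. open T \<and> x \<in> T \<and> Ck_on k T \<phi>"
    proof (cases "x \<in> T1")
      case True
      have "Ck_on k T1 (\<lambda>x. flat_exp 0 (W x))"
        by (rule Ck_on_compose[OF T1 open_UNIV _ Ck_on_flat_exp Ck_on_subset[OF WC]]) (use T1A A0 in auto)
      then have "Ck_on k T1 \<phi>" using Ck_on_cong[OF T1 phi1] by simp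
      with True T1 show ?thesis by blast
    next
      case False
      then have "x \<in> T2" using T12 by blast
      moreover have "Ck_on k T2 \<phi>" using Ck_on_cong[OF T2 phi2] Ck_on_const[OF T2] by simp
      ultimately show ?thesis using T2 by blast
    qed
  qed
  then have sm: "smooth_fun \<phi>" by (simp add: smooth_fun_def Ck_on_UNIV)
  have "closed (A \<inter> W -` {0..})"
    by (rule continuous_closed_preimage) (use A A0 Wc compact_imp_closed in \<open>auto intro: continuous_on_subset\<close>)
  then have "closed {x\<in>A. W x \<ge> 0}" by (simp add: vimage_def Int_def)
  moreover have "{x. \<phi> x \<noteq> 0} \<subseteq> {x\<in>A. W x \<ge> 0}" by (auto simp: \<phi>_def flat_exp_def split: if_splits)
  ultimately show ts: "tsupport \<phi> \<subseteq> {x\<in>A. W x \<ge> 0}"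
    unfolding tsupport_def by (intro closure_minimal)
  then have "tsupport \<phi> \<subseteq> A" by auto
  moreover have "A \<subseteq> ext_dom" using R by (auto simp: A_def ext_dom_iff)
  moreover have "closed (tsupport \<phi>)" by (simp add: tsupport_def)
  moreover have "compact (A \<inter> tsupport \<phi>)" using calculation A by (intro compact_Int_closed)
  ultimately show "test_fun ext_dom \<phi>"
    using sm by (auto simp: test_fun_def Int_absorb1)
  show "grad \<phi> x = (if x \<in> A then flat_exp 2 (W x) else 0) *\<^sub>R (power_grad c b x - grad v x)"
  proof (cases "x \<in> T1")
    case True
    then have x0: "x \<noteq> 0" using T1A A0 by auto
    have dW: "(W has_derivative (\<lambda>h. h \<bullet> (power_grad c b x - grad v x))) (at x)"
      unfolding W_def
      using has_derivative_diff[OF has_derivative_diff[OF power_has_derivative[OF x0, of c b] has_derivative_const[of \<epsilon>]] smooth_fun_has_derivative[OF v, of x]]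
      by (simp add: inner_diff_right)
    have "(flat_exp 0 has_derivative (*) (flat_exp 2 (W x))) (at (W x))"
      using flat_exp_deriv[of 0 "W x"] by (simp add: has_field_derivative_def numeral_2_eq_2)
    from has_derivative_compose[OF dW this]
    have "((\<lambda>x. flat_exp 0 (W x)) has_derivative (\<lambda>h. h \<bullet> (flat_exp 2 (W x) *\<^sub>R (power_grad c b x - grad v x)))) (at x)"
      by simp
    then have "(\<phi> has_derivative (\<lambda>h. h \<bullet> (flat_exp 2 (W x) *\<^sub>R (power_grad c b x - grad v x)))) (at x)"
      by (rule has_derivative_transform_within_open[OF _ T1 True]) (simp add: phi1)
    from grad_eqI[OF this] show ?thesis using True T1A by auto
  next
    case False
    then have x2: "x \<in> T2" using T12 by blast
    have "(\<phi> has_derivative (\<lambda>h. h \<bullet> 0)) (at x)"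
      by (rule has_derivative_transform_within_open[OF _ T2 x2, of "\<lambda>_. 0"]) (auto simp: phi2)
    from grad_eqI[OF this] show ?thesis using T2W[OF x2] by (auto simp: flat_exp_def)
  qed
qed

text \<open>A local form of -\<Delta>_m u + lam |x|^(-m) u^(m-1) \<ge> 0, keeping of the nonlocal
  term only what has been moved into \<open>lam\<close>. The bound \<open>\<phi> x \<le> 1\<close>
  lets the nonlocal integral be compared with the assumed local integrability; the restriction to
  \<open>u x < 1\<close> is affordable because the barrier stays below 1.\<close>

definition weak_super :: "real \<Rightarrow> real \<Rightarrow> real \<Rightarrow> ('a::euclidean_space \<Rightarrow> real) \<Rightarrow> ('a \<Rightarrow> 'a) \<Rightarrow> bool" where
  "weak_super m lam R u Du \<longleftrightarrow>
    (\<forall>\<phi>. test_fun ext_dom \<phi> \<and> (\<forall>x. 0 \<le> \<phi> x \<and> \<phi> x \<le> 1) \<and> (\<forall>x\<in>tsupport \<phi>. R < norm x \<and> u x < 1) \<longrightarrow>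
      0 \<le> (LINT x:ext_dom|lebesgue. flux m Du \<phi> x)
         + lam * (LINT x:ext_dom|lebesgue. norm x powr (- m) * u x powr (m - 1) * \<phi> x))"

lemma Kfun_pos: "m > 1 \<Longrightarrow> real N \<le> m \<Longrightarrow> b > 0 \<Longrightarrow> Kfun m N b > 0"
proof -
  assume "m > 1" "real N \<le> m" "b > 0"
  moreover from this have "(m - 1) * b > 0" by simp
  ultimately have "(m - 1) * b + m - real N > 0" "b powr (m - 1) > 0" by (linarith, simp)
  then show ?thesis by (simp add: Kfun_def)
qed

text \<open>Turns the error bound, given as a nonnegative integral, into a Bochner integral that can
  be subtracted. Measurability of \<open>Du\<close> is available through its product with the
  indicator of the exterior domain.\<close>

lemma gradient_error_integrable:
  fixes Du :: "'a::euclidean_space \<Rightarrow> 'a"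
  assumes W: "W1loc m ext_dom u Du" and A: "compact A" "A \<subseteq> ext_dom" and v: "smooth_fun v"
    and bound: "(\<integral>\<^sup>+x. indicator A x * ennreal ((1 + norm (Du x) powr (m - 1)) * norm (grad v x - Du x)) \<partial>lebesgue) \<le> ennreal \<eta>"
    and \<eta>: "\<eta> \<ge> 0"
  defines "E \<equiv> \<lambda>x. indicator A x * ((1 + norm (Du x) powr (m - 1)) * norm (grad v x - Du x))"
  shows "integrable lebesgue E" "integral\<^sup>L lebesgue E \<le> \<eta>"
proof -
  have [measurable]: "A \<in> sets lebesgue" using A by (simp add: lmeasurable_compact fmeasurableD)
  have measD: "(\<lambda>x. indicator ext_dom x *\<^sub>R Du x) \<in> borel_measurable lebesgue"
    using W by (simp add: W1loc_def weak_grad_def set_borel_measurable_def)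
  define D where "D x = indicator ext_dom x *\<^sub>R Du x" for x
  have [measurable]: "D \<in> borel_measurable lebesgue" using measD by (simp add: D_def[abs_def])
  have [measurable]: "grad v \<in> borel_measurable lebesgue"
    using borel_measurable_continuous_onI[OF continuous_on_grad[OF v]] by (simp add: measurable_completion)
  have Eeq: "E = (\<lambda>x. indicator A x * ((1 + norm (D x) powr (m - 1)) * norm (grad v x - D x)))"
    using A by (auto simp: E_def D_def indicator_def fun_eq_iff)
  have [measurable]: "E \<in> borel_measurable lebesgue" unfolding Eeq by measurable
  have E0: "E x \<ge> 0" for x by (auto simp: E_def)
  have eE: "ennreal (E x) = indicator A x * ennreal ((1 + norm (Du x) powr (m - 1)) * norm (grad v x - Du x))" for x
    by (auto simp: E_def indicator_def)
  have nn: "(\<integral>\<^sup>+x. ennreal (E x) \<partial>lebesgue) \<le> ennreal \<eta>" using bound by (simp add: eE)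
  show i: "integrable lebesgue E"
    by (rule integrableI_bounded) (use nn E0 in \<open>auto intro: le_less_trans\<close>)
  have "ennreal (integral\<^sup>L lebesgue E) \<le> ennreal \<eta>"
    using nn nn_integral_eq_integral[OF i] E0 by simp
  then show "integral\<^sup>L lebesgue E \<le> \<eta>" using \<eta> by simp
qed

text \<open>
  The barrier \<open>w = c |x| powr (-b) - \<epsilon>\<close> is tested with a smoothed positive part of \<open>w - u\<close>,
  where \<open>u\<close> is replaced by a smooth approximation. Its support is compact because \<open>w < 0 < u\<close> far
  out; there the flux difference is monotone up to the approximation error, while the
  zero-order term is bounded below.
\<close>

lemma weak_super_lower_bound:
  fixes u :: "'a::euclidean_space \<Rightarrow> real"
  assumes m: "m > 1" and N: "real DIM('a) \<le> m" and b: "b > 0"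
    and u: "continuous_on ext_dom u" and pos: "\<And>x. x \<in> ext_dom \<Longrightarrow> u x > 0" and W: "W1loc m ext_dom u Du"
    and R: "R \<ge> 1" and super: "weak_super m (Kfun m DIM('a) b) R u Du"
  shows "\<exists>c>0. \<forall>x. norm x \<ge> R + 1 \<longrightarrow> c * norm x powr (- b) \<le> u x"
proof -
  define lam where "lam = Kfun m DIM('a) b"
  have lam: "lam > 0" using Kfun_pos[OF m N b] by (simp add: lam_def)
  define R1 where "R1 = R + 1"
  have R1: "R1 > 1" "R1 > 0" "R < R1" using R by (auto simp: R1_def)
  have sph: "sphere (0::'a) R1 \<subseteq> ext_dom" using R1 by (auto simp: ext_dom_iff)
  obtain xm where xm: "xm \<in> sphere (0::'a) R1" "\<And>x. x \<in> sphere 0 R1 \<Longrightarrow> u xm \<le> u x"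
    using continuous_attains_inf[OF compact_sphere _ continuous_on_subset[OF u sph]] R1 by auto
  \<comment> \<open>Strictly below the minimum of \<open>u\<close> on the inner sphere, so that
    \<open>x0\<close> cannot lie there; at most 1/4, so that \<open>u < 1\<close> wherever the
    barrier is above \<open>u\<close>.\<close>
  define s where "s = min (u xm) (1/2) / 2"
  have s: "s > 0" "s < u xm" "s \<le> 1/4" using pos[of xm] xm(1) sph by (auto simp: s_def min_def)
  define c where "c = s * R1 powr b"
  have c: "c > 0" using s R1 by (simp add: c_def)
  have cR1: "c * R1 powr (- b) = s" using R1 by (simp add: c_def powr_minus field_simps)
  have cle: "c * norm x powr (- b) \<le> s" if "norm x \<ge> R1" for x :: 'a
  proof -
    have "norm x powr (- b) \<le> R1 powr (- b)" using that R1 b by (intro powr_mono2') auto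
    then show ?thesis using cR1 c by (metis mult_left_mono less_imp_le)
  qed
  have "c * norm x0 powr (- b) \<le> u x0" if x0: "norm x0 \<ge> R1" for x0
  proof (rule ccontr)
    assume "\<not> ?thesis"
    then have lt: "u x0 < c * norm x0 powr (- b)" by simp
    have x0ext: "x0 \<in> ext_dom" using x0 R1 by (simp add: ext_dom_iff)
    have x0R: "norm x0 > R1"
      using xm(2)[of x0] lt cle[OF x0] s x0 by (cases "norm x0 = R1") auto
    \<comment> \<open>Half of the violation at \<open>x0\<close>: the barrier lowered by
      \<open>\<epsilon>\<close> still exceeds \<open>u x0\<close> by \<open>\<epsilon>\<close>, but
      is negative far out.\<close>
    define \<epsilon> where "\<epsilon> = (c * norm x0 powr (- b) - u x0) / 2"
    have e: "\<epsilon> > 0" "\<epsilon> \<le> 1/8" using lt cle[OF x0] s pos[OF x0ext] by (auto simp: \<epsilon>_def)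
    have "((\<lambda>r. c * r powr (- b)) \<longlongrightarrow> 0) at_top"
      using tendsto_mult_right_zero[OF tendsto_neg_powr[OF _ filterlim_ident], of "- b" c] b by simp
    then have "eventually (\<lambda>r. c * r powr (- b) < \<epsilon> / 2) at_top"
      by (rule order_tendstoD) (use e in simp)
    then have "eventually (\<lambda>r. c * r powr (- b) < \<epsilon> / 2 \<and> r > norm x0) at_top"
      by (intro eventually_conj eventually_gt_at_top)
    \<comment> \<open>At the outer radius the lowered barrier is below -\<epsilon>/2 and
      \<open>u\<close> is positive, so an approximation error of at most \<epsilon>/8 cannot make
      \<open>w\<close> nonnegative there.\<close>
    then obtain R2 where R2: "c * R2 powr (- b) < \<epsilon> / 2" "R2 > norm x0"
      by (auto simp: eventually_at_top_linorder)
    define A where "A = {x::'a. R1 \<le> norm x \<and> norm x \<le> R2}"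
    have Ac: "compact A"
    proof -
      have "A = cball 0 R2 - ball 0 R1" by (auto simp: A_def)
      then show ?thesis by (simp add: compact_diff)
    qed
    have Aext: "A \<subseteq> ext_dom" using R1 by (auto simp: A_def ext_dom_iff)
    have A0: "x \<noteq> 0" if "x \<in> A" for x using that Aext ext_dom_nonzero by auto
    \<comment> \<open>Bounds the modulus of the barrier's flux on the annulus, where |x| \<ge>
      1.\<close>
    define M where "M = (c * b) powr (m - 1)"
    have M: "norm (power_grad c b x) powr (m - 1) \<le> M" if "x \<in> A" for x :: 'a
    proof -
      have "norm x powr (- b - 1) \<le> 1 powr (- b - 1)"
        using that R1 b by (intro powr_mono2') (auto simp: A_def)
      then have "norm (power_grad c b x) \<le> c * b"
        using norm_power_grad[OF c b A0[OF that]] c b by (simp add: mult_le_cancel_left1)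
      then show ?thesis unfolding M_def using m by (intro powr_mono2) auto
    qed
    have M0: "M \<ge> 0" by (simp add: M_def)
    have "compact (flat_exp 2 ` {0..1})"
      using Ck_on_continuous[OF Ck_on_flat_exp[of 0 2]]
      by (intro compact_continuous_image) (auto intro: continuous_on_subset)
    then obtain H0 where H0: "\<And>t. t \<in> {0..1} \<Longrightarrow> norm (flat_exp 2 t) \<le> H0"
      using compact_imp_bounded by (force simp: bounded_iff)
    \<comment> \<open>Bounds the factor \<open>flat_exp 2 (w x)\<close> in the gradient of the test
      function, since \<open>w x \<le> 1\<close> on the annulus.\<close>
    define H where "H = max H0 1"
    have H: "flat_exp 2 t \<le> H" if "t \<le> 1" for t
      using H0[of t] that by (cases "t \<le> 0") (auto simp: H_def flat_exp_def)
    have H1: "H > 0" by (simp add: H_def)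
    define g where "g x = c * norm x powr (- b) - \<epsilon> - u x" for x
    have gc: "continuous_on ext_dom g"
      unfolding g_def by (intro continuous_intros continuous_on_norm_powr_ext_dom u)
    have gx0: "g x0 = \<epsilon>" by (simp add: g_def \<epsilon>_def field_simps)
    have "open (ext_dom \<inter> g -` {\<epsilon>/2<..})"
      by (rule continuous_open_preimage[OF gc open_ext_dom open_greaterThan])
    moreover have "open {x::'a. R1 < norm x \<and> norm x < R2}"
      by (intro open_Collect_conj open_Collect_less continuous_intros)
    ultimately have "open (ext_dom \<inter> g -` {\<epsilon>/2<..} \<inter> {x. R1 < norm x \<and> norm x < R2})" by (rule open_Int)
    moreover have "x0 \<in> ext_dom \<inter> g -` {\<epsilon>/2<..} \<inter> {x. R1 < norm x \<and> norm x < R2}"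
      using gx0 e x0ext x0R R2 by auto
    ultimately obtain r where r: "r > 0" "cball x0 r \<subseteq> ext_dom \<inter> g -` {\<epsilon>/2<..} \<inter> {x. R1 < norm x \<and> norm x < R2}"
      using open_contains_cball by metis
    \<comment> \<open>The difference of the zero-order terms. It uses the barrier without the shift
      \<open>\<epsilon>\<close>: subtracting a constant does not change the gradient, so the flux
      still satisfies the equation of the unshifted power.\<close>
    define Z where "Z x = norm x powr (- m) * ((c * norm x powr (- b)) powr (m - 1) - u x powr (m - 1))" for x
    have Zc: "continuous_on ext_dom Z"
      unfolding Z_def
      by (intro continuous_intros continuous_on_norm_powr_ext_dom u)
         (use c pos ext_dom_nonzero in \<open>force simp: less_imp_neq\<close>)+
    have Zpos: "Z x > 0" if "x \<in> ext_dom" "u x < c * norm x powr (- b)" for x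
      using that pos[OF that(1)] ext_dom_nonzero[OF that(1)] m powr_less_mono2[of "m - 1" "u x" "c * norm x powr (- b)"]
      by (simp add: Z_def)
    obtain xz where xz: "xz \<in> cball x0 r" "\<And>x. x \<in> cball x0 r \<Longrightarrow> Z xz \<le> Z x"
      using continuous_attains_inf[OF compact_cball _ continuous_on_subset[OF Zc], of x0 r] r by auto
    define k2 where "k2 = Z xz"
    have k2: "k2 > 0" unfolding k2_def using xz(1) r(2) e by (intro Zpos) (auto simp: g_def)
    define k1 where "k1 = flat_exp 0 (\<epsilon> / 4)"
    have k1: "k1 > 0" using e by (simp add: k1_def flat_exp_def)
    define V where "V = measure lborel (ball x0 r)"
    have V: "V > 0" unfolding V_def by (rule content_ball_pos[OF r(1)])
    \<comment> \<open>The accuracy is fixed last. \<open>k1 * k2 * V\<close> bounds from below the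
      gain of the zero-order term on the ball around \<open>x0\<close>, whatever the approximation
      is. The second entry makes the flux error at most half of \<open>lam\<close> times that bound;
      the first keeps \<open>w\<close> at least \<epsilon>/4 on the ball.\<close>
    define \<eta> where "\<eta> = min (\<epsilon> / 8) (lam * (k1 * k2 * V) / (2 * (H * (M + 1))))"
    have eta: "\<eta> > 0" "\<eta> \<le> \<epsilon> / 8" "H * (M + 1) * \<eta> \<le> lam * (k1 * k2 * V) / 2"
    proof -
      have p: "lam * (k1 * k2 * V) > 0" "H * (M + 1) > 0" using lam k1 k2 V H1 M0 by auto
      show "\<eta> > 0" using e p by (auto simp: \<eta>_def)
      show "\<eta> \<le> \<epsilon> / 8" unfolding \<eta>_def by (rule min.cobounded1)
      have "H * (M + 1) * \<eta> \<le> H * (M + 1) * (lam * (k1 * k2 * V) / (2 * (H * (M + 1))))"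
        unfolding \<eta>_def using p by (intro mult_left_mono min.cobounded2) auto
      then show "H * (M + 1) * \<eta> \<le> lam * (k1 * k2 * V) / 2" using H1 M0 by simp
    qed
    obtain v where v: "smooth_fun v" "\<And>x. x \<in> A \<Longrightarrow> \<bar>v x - u x\<bar> \<le> \<eta>"
      "(\<integral>\<^sup>+x. indicator A x * ennreal ((1 + norm (Du x) powr (m - 1)) * norm (grad v x - Du x)) \<partial>lebesgue) \<le> ennreal \<eta>"
      using W1loc_smooth_approx[OF m open_ext_dom u W Ac Aext eta(1)] by blast
    define w where "w x = c * norm x powr (- b) - \<epsilon> - v x" for x
    define \<phi> where "\<phi> x = (if x \<in> A then flat_exp 0 (w x) else 0)" for x
    have neg1: "w x < 0" if "norm x = R1" for x
    proof -
      have "x \<in> A" using that x0R R2 by (auto simp: A_def)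
      then show ?thesis using v(2)[of x] xm(2)[of x] cle[of x] that s e eta by (auto simp: w_def)
    qed
    have neg2: "w x < 0" if "norm x = R2" for x
    proof -
      have "x \<in> A" using that x0R R2 by (auto simp: A_def)
      then show ?thesis using v(2)[of x] pos[of x] Aext R2 that e eta by (force simp: w_def)
    qed
    note at = annulus_test_fun[OF R1(1) v(1), where c=c and b=b and \<epsilon>=\<epsilon> and rout=R2, folded A_def w_def, folded \<phi>_def, OF neg1 neg2]
    have t: "test_fun ext_dom \<phi>" and ts: "tsupport \<phi> \<subseteq> {x \<in> A. 0 \<le> w x}"
      and gp: "\<And>x. grad \<phi> x = (if x \<in> A then flat_exp 2 (w x) else 0) *\<^sub>R (power_grad c b x - grad v x)"
      using at by auto
    have wle: "w x \<le> 1" if "x \<in> A" for x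
    proof -
      have "c * norm x powr (- b) \<le> 1/4" using cle[of x] that s by (auto simp: A_def)
      then show ?thesis using v(2)[OF that] pos[of x] that Aext e eta by (auto simp: w_def)
    qed
    have phi01: "0 \<le> \<phi> x \<and> \<phi> x \<le> 1" for x
      by (auto simp: \<phi>_def flat_exp_nonneg flat_exp_0_le_1)
    \<comment> \<open>On the support the shift \<open>\<epsilon>\<close> outweighs the error
      \<open>\<eta>\<close>, so \<open>u\<close> itself, not only \<open>v\<close>, lies below the
      unshifted barrier.\<close>
    have ults: "u x < c * norm x powr (- b)" "u x < 1" if "x \<in> A" "0 \<le> w x" for x
    proof -
      have "u x \<le> c * norm x powr (- b) - \<epsilon> + \<eta>" using v(2)[OF that(1)] that(2) by (auto simp: w_def)
      moreover have "c * norm x powr (- b) \<le> 1/4" using cle[of x] that s by (auto simp: A_def)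
      ultimately show "u x < c * norm x powr (- b)" "u x < 1" using e eta by auto
    qed
    have cond: "\<forall>x\<in>tsupport \<phi>. R < norm x \<and> u x < 1"
    proof
      fix x assume "x \<in> tsupport \<phi>"
      then have "x \<in> A" "0 \<le> w x" using ts by auto
      then show "R < norm x \<and> u x < 1" using ults(2) R1(3) by (auto simp: A_def)
    qed
    have S: "0 \<le> (LINT x:ext_dom|lebesgue. flux m Du \<phi> x)
         + lam * (LINT x:ext_dom|lebesgue. norm x powr (- m) * u x powr (m - 1) * \<phi> x)"
      unfolding lam_def by (rule super[unfolded weak_super_def, rule_format]) (use t phi01 cond in blast)
    have Wd: "(LINT x:ext_dom|lebesgue. flux m (power_grad c b) \<phi> x)
      = - (lam * (LINT x:ext_dom|lebesgue. norm x powr (- m) * (c * norm x powr (- b)) powr (m - 1) * \<phi> x))"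
    proof -
      have "c powr (m - 1) * (LINT x:ext_dom|lebesgue. norm x powr (- (b * (m - 1) + m)) * \<phi> x)
        = (LINT x:ext_dom|lebesgue. c powr (m - 1) * (norm x powr (- (b * (m - 1) + m)) * \<phi> x))"
        by (simp only: set_integral_mult_right)
      also have "\<dots> = (LINT x:ext_dom|lebesgue. norm x powr (- m) * (c * norm x powr (- b)) powr (m - 1) * \<phi> x)"
      proof (rule set_lebesgue_integral_cong[OF lebesgue_ext_dom], intro allI impI)
        fix x :: 'a
        have "norm x powr (- (b * (m - 1) + m)) = norm x powr (- m) * norm x powr (- b * (m - 1))"
          unfolding powr_add[symmetric] by (simp add: algebra_simps)
        moreover have "(c * norm x powr (- b)) powr (m - 1) = c powr (m - 1) * norm x powr (- b * (m - 1))"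
          using c by (simp add: powr_mult powr_powr)
        ultimately show "c powr (m - 1) * (norm x powr (- (b * (m - 1) + m)) * \<phi> x)
           = norm x powr (- m) * (c * norm x powr (- b)) powr (m - 1) * \<phi> x" by simp
      qed
      finally show ?thesis
        using power_flux_integral[OF t c b, of m] by (simp add: lam_def mult_ac)
    qed
    note tf = test_fun_facts[OF t]
    have ci1: "set_integrable lebesgue ext_dom (\<lambda>x. norm x powr (- m) * (c * norm x powr (- b)) powr (m - 1) * \<phi> x)"
    proof (rule set_integrable_compact_support[OF tf(4) continuous_on_subset[OF _ tf(5)] _ tf(5)])
      show "continuous_on ext_dom (\<lambda>x. norm x powr (- m) * (c * norm x powr (- b)) powr (m - 1) * \<phi> x)"
        by (intro continuous_intros continuous_on_norm_powr_ext_dom continuous_on_subset[OF tf(1)])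
           (use c ext_dom_nonzero in \<open>force simp: less_imp_neq\<close>)+
    qed (use tf in auto)
    have ci2: "set_integrable lebesgue ext_dom (\<lambda>x. norm x powr (- m) * u x powr (m - 1) * \<phi> x)"
    proof (rule set_integrable_compact_support[OF tf(4) continuous_on_subset[OF _ tf(5)] _ tf(5)])
      show "continuous_on ext_dom (\<lambda>x. norm x powr (- m) * u x powr (m - 1) * \<phi> x)"
        by (intro continuous_intros continuous_on_norm_powr_ext_dom continuous_on_subset[OF tf(1)] u)
           (use pos in \<open>force simp: less_imp_neq\<close>)+
    qed (use tf in auto)
    have J: "(LINT x:ext_dom|lebesgue. Z x * \<phi> x) =
       (LINT x:ext_dom|lebesgue. norm x powr (- m) * (c * norm x powr (- b)) powr (m - 1) * \<phi> x)
       - (LINT x:ext_dom|lebesgue. norm x powr (- m) * u x powr (m - 1) * \<phi> x)"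
      using set_integral_diff(2)[OF ci1 ci2] by (simp add: Z_def algebra_simps)
    have Ji: "set_integrable lebesgue ext_dom (\<lambda>x. Z x * \<phi> x)"
      using set_integral_diff(1)[OF ci1 ci2] by (simp add: Z_def algebra_simps)
    have Jge: "k1 * k2 * V \<le> (LINT x:ext_dom|lebesgue. Z x * \<phi> x)"
    proof -
      have "k1 * k2 * V = (\<integral>x. k1 * k2 * indicator (ball x0 r) x \<partial>lebesgue)"
        by (simp add: V_def)
      also have "\<dots> \<le> (LINT x:ext_dom|lebesgue. Z x * \<phi> x)"
        unfolding set_lebesgue_integral_def
      proof (rule integral_mono)
        show "integrable lebesgue (\<lambda>x. k1 * k2 * indicat_real (ball x0 r) x)"
          using emeasure_lborel_ball_finite[of x0 r] by (intro integrable_mult_right integrable_real_indicator) auto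
        show "integrable lebesgue (\<lambda>x. indicator ext_dom x *\<^sub>R (Z x * \<phi> x))"
          using Ji by (simp add: set_integrable_def)
        fix x
        show "k1 * k2 * indicat_real (ball x0 r) x \<le> indicator ext_dom x *\<^sub>R (Z x * \<phi> x)"
        proof (cases "x \<in> ball x0 r")
          case True
          then have xc: "x \<in> cball x0 r" by simp
          then have xA: "x \<in> A" "x \<in> ext_dom" "g x > \<epsilon> / 2" using r(2) by (auto simp: A_def)
          then have "w x \<ge> \<epsilon> / 4" using v(2)[of x] eta e by (auto simp: g_def w_def)
          then have "- 1 / (\<epsilon> / 4) \<le> - 1 / w x"
            using e frac_le[of 1 1 "\<epsilon> / 4" "w x"] unfolding minus_divide_left[symmetric] by linarith
          then have "k1 \<le> \<phi> x" using xA e \<open>w x \<ge> \<epsilon> / 4\<close> by (simp add: \<phi>_def k1_def flat_exp_def)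
          moreover have "k2 \<le> Z x" using xz(2)[OF xc] by (simp add: k2_def)
          ultimately have "k2 * k1 \<le> Z x * \<phi> x" using k1 k2 by (intro mult_mono) auto
          then show ?thesis using True xA by (simp add: mult.commute)
        next
          case False
          have "Z x * \<phi> x \<ge> 0" if "x \<in> ext_dom"
          proof (cases "x \<in> A \<and> 0 \<le> w x")
            case True
            then show ?thesis using Zpos[OF that ults(1)] phi01 by (simp add: less_imp_le)
          next
            case False
            then have "\<phi> x = 0" by (auto simp: \<phi>_def flat_exp_def)
            then show ?thesis by simp
          qed
          then show ?thesis using False by (auto simp: indicator_def)
        qed
      qed
      finally show ?thesis .
    qed
    define E where "E x = indicator A x * ((1 + norm (Du x) powr (m - 1)) * norm (grad v x - Du x))" for x
    have Ei: "integrable lebesgue E" and Eb: "integral\<^sup>L lebesgue E \<le> \<eta>"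
      using gradient_error_integrable[OF W Ac Aext v(1) v(3)] eta by (auto simp: E_def[abs_def])
    have fi1: "set_integrable lebesgue ext_dom (\<lambda>x. flux m (power_grad c b) \<phi> x)"
    proof (rule set_integrable_compact_support[OF tf(4) continuous_on_subset[OF _ tf(5)] _ tf(5)])
      have "continuous_on ext_dom (\<lambda>x. - ((c * b) powr (m - 1)) * (norm x powr (- (b * (m - 1) + m)) * (x \<bullet> grad \<phi> x)))"
        by (intro continuous_intros continuous_on_norm_powr_ext_dom continuous_on_subset[OF test_fun_grad(1)[OF t]]) auto
      then show "continuous_on ext_dom (\<lambda>x. flux m (power_grad c b) \<phi> x)"
        by (rule continuous_on_eq) (use power_flux_eq[OF c b ext_dom_nonzero] in metis)
    qed (use test_fun_grad(2)[OF t] in auto)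
    note fi2 = flux_integrable[OF m W t]
    have I: "(LINT x:ext_dom|lebesgue. flux m (power_grad c b) \<phi> x)
        - (LINT x:ext_dom|lebesgue. flux m Du \<phi> x) \<ge> - (H * (M + 1) * \<eta>)"
    proof -
      have "- (H * (M + 1) * \<eta>) \<le> (\<integral>x. - (H * (M + 1) * E x) \<partial>lebesgue)"
        using Eb H1 M0 by simp
      also have "\<dots> \<le> (LINT x:ext_dom|lebesgue. flux m (power_grad c b) \<phi> x
          - flux m Du \<phi> x)"
        unfolding set_lebesgue_integral_def
      proof (rule integral_mono)
        show "integrable lebesgue (\<lambda>x. - (H * (M + 1) * E x))" using Ei by simp
        show "integrable lebesgue (\<lambda>x. indicator ext_dom x *\<^sub>R (flux m (power_grad c b) \<phi> x
          - flux m Du \<phi> x))"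
          using set_integral_diff(1)[OF fi1 fi2] by (simp add: set_integrable_def)
        fix x
        show "- (H * (M + 1) * E x) \<le> indicator ext_dom x *\<^sub>R (flux m (power_grad c b) \<phi> x
          - flux m Du \<phi> x)"
        proof (cases "x \<in> A")
          case True
          define Fw where "Fw = norm (power_grad c b x) powr (m - 2) *\<^sub>R power_grad c b x"
          define Fu where "Fu = norm (Du x) powr (m - 2) *\<^sub>R Du x"
          define h where "h = flat_exp 2 (w x)"
          have h: "0 \<le> h" "h \<le> H" using H[OF wle[OF True]] flat_exp_nonneg by (auto simp: h_def)
          have nF: "norm (Fw - Fu) \<le> M + norm (Du x) powr (m - 1)"
            using norm_triangle_ineq4[of Fw Fu] M[OF True] unfolding Fw_def Fu_def norm_flux by linarith
          have "(M + 1) * (1 + norm (Du x) powr (m - 1)) \<ge> M + norm (Du x) powr (m - 1)"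
            using M0 by (simp add: algebra_simps)
          with nF have nF2: "norm (Fw - Fu) \<le> (M + 1) * (1 + norm (Du x) powr (m - 1))" by linarith
          have "flux m (power_grad c b) \<phi> x - flux m Du \<phi> x
             = (Fw - Fu) \<bullet> grad \<phi> x" by (simp add: Fw_def Fu_def inner_diff_left)
          \<comment> \<open>The gradient of the test function contains \<open>grad v\<close> instead
            of \<open>Du\<close>. Adding and subtracting \<open>Du\<close> separates the monotone
            part, which has the good sign, from an error weighted by the flux difference.\<close>
          also have "\<dots> = h * ((Fw - Fu) \<bullet> (power_grad c b x - Du x)) - h * ((Fw - Fu) \<bullet> (grad v x - Du x))"
            using True by (simp add: gp h_def inner_diff_right algebra_simps)
          finally have eq: "flux m (power_grad c b) \<phi> x - flux m Du \<phi> x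
             = h * ((Fw - Fu) \<bullet> (power_grad c b x - Du x)) - h * ((Fw - Fu) \<bullet> (grad v x - Du x))" .
          have "h * ((Fw - Fu) \<bullet> (power_grad c b x - Du x)) \<ge> 0"
            unfolding Fw_def Fu_def by (intro mult_nonneg_nonneg h flux_monotone m)
          moreover have "h * ((Fw - Fu) \<bullet> (grad v x - Du x)) \<le> H * (((M + 1) * (1 + norm (Du x) powr (m - 1))) * norm (grad v x - Du x))"
          proof -
            have "(Fw - Fu) \<bullet> (grad v x - Du x) \<le> norm (Fw - Fu) * norm (grad v x - Du x)"
              by (rule norm_cauchy_schwarz)
            also have "\<dots> \<le> ((M + 1) * (1 + norm (Du x) powr (m - 1))) * norm (grad v x - Du x)"
              by (intro mult_right_mono nF2) auto
            finally have 1: "(Fw - Fu) \<bullet> (grad v x - Du x) \<le> ((M + 1) * (1 + norm (Du x) powr (m - 1))) * norm (grad v x - Du x)" .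
            have "h * ((Fw - Fu) \<bullet> (grad v x - Du x)) \<le> h * (((M + 1) * (1 + norm (Du x) powr (m - 1))) * norm (grad v x - Du x))"
              using 1 h by (intro mult_left_mono) auto
            also have "\<dots> \<le> H * (((M + 1) * (1 + norm (Du x) powr (m - 1))) * norm (grad v x - Du x))"
              using h M0 by (intro mult_right_mono) auto
            finally show ?thesis .
          qed
          ultimately show ?thesis unfolding eq using True Aext by (auto simp: E_def mult_ac)
        next
          case False
          then show ?thesis by (simp add: E_def gp)
        qed
      qed
      also have "\<dots> = (LINT x:ext_dom|lebesgue. flux m (power_grad c b) \<phi> x)
        - (LINT x:ext_dom|lebesgue. flux m Du \<phi> x)"
        by (rule set_integral_diff(2)[OF fi1 fi2])
      finally show ?thesis .
    qed
    \<comment> \<open>The supersolution inequality and the exact barrier equation are subtracted: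
      the gain of the zero-order term is at most the flux error, although \<open>\<eta>\<close>
      makes that error at most half of a lower bound for the gain.\<close>
    have "lam * (LINT x:ext_dom|lebesgue. Z x * \<phi> x) \<le> H * (M + 1) * \<eta>"
      using S I unfolding Wd J by (simp add: right_diff_distrib)
    moreover have "lam * (k1 * k2 * V) \<le> lam * (LINT x:ext_dom|lebesgue. Z x * \<phi> x)"
      using Jge lam by simp
    moreover have "lam * (k1 * k2 * V) > 0" using lam k1 k2 V by simp
    ultimately show False using eta(3) by linarith
  qed
  then show ?thesis using c unfolding R1_def by blast
qed

section \<open>Lower bounds for the Riesz potential\<close>

lemma riesz_const_pos: "0 < \<alpha> \<Longrightarrow> \<alpha> < real N \<Longrightarrow> riesz_const N \<alpha> > 0"
  by (simp add: riesz_const_def Gamma_real_pos)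

definition shell :: "real \<Rightarrow> 'a::euclidean_space set" where
  "shell r = ball 0 (2 * r) - cball 0 r"

lemma shell_iff: "x \<in> shell r \<longleftrightarrow> r < norm x \<and> norm x < 2 * r"
  by (auto simp: shell_def)

lemma borel_shell[measurable]: "(shell r :: 'a::euclidean_space set) \<in> sets borel"
  by (simp add: shell_def)

text \<open>The volume is 2^N - 1 times that of the ball of radius \<open>r\<close>, and 2^N - 1 is
  at least 1.\<close>

lemma emeasure_shell_ge:
  assumes "r > 0"
  shows "emeasure lborel (shell r :: 'a::euclidean_space set) \<ge> ennreal (unit_ball_vol (real DIM('a)) * r ^ DIM('a))"
proof -
  have "emeasure lborel (shell r :: 'a set) = emeasure lborel (ball (0::'a) (2 * r)) - emeasure lborel (cball (0::'a) r)"
    unfolding shell_def using assms emeasure_lborel_cball_finite[of "0::'a" r] by (intro emeasure_Diff) auto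
  also have "\<dots> = ennreal (unit_ball_vol (real DIM('a)) * (2 * r) ^ DIM('a)) - ennreal (unit_ball_vol (real DIM('a)) * r ^ DIM('a))"
    using assms by (simp add: emeasure_ball emeasure_cball)
  also have "\<dots> = ennreal (unit_ball_vol (real DIM('a)) * (2 * r) ^ DIM('a) - unit_ball_vol (real DIM('a)) * r ^ DIM('a))"
    using assms by (intro ennreal_minus) auto
  also have "\<dots> \<ge> ennreal (unit_ball_vol (real DIM('a)) * r ^ DIM('a))"
  proof (rule ennreal_leI)
    have "(2::real) ^ DIM('a) \<ge> 2"
      using power_increasing[of 1 "DIM('a)" "2::real"] DIM_positive[where 'a='a] by simp
    then have "(2 * r) ^ DIM('a) \<ge> 2 * r ^ DIM('a)"
      using assms by (simp add: power_mult_distrib)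
    then have "unit_ball_vol (real DIM('a)) * (2 * r) ^ DIM('a) \<ge> unit_ball_vol (real DIM('a)) * (2 * r ^ DIM('a))"
      by (intro mult_left_mono) auto
    then show "unit_ball_vol (real DIM('a)) * r ^ DIM('a)
      \<le> unit_ball_vol (real DIM('a)) * (2 * r) ^ DIM('a) - unit_ball_vol (real DIM('a)) * r ^ DIM('a)"
      by (simp add: algebra_simps)
  qed
  finally show ?thesis .
qed

lemma unit_ball_vol_DIM_pos: "unit_ball_vol (real DIM('a::euclidean_space)) > 0"
  by (simp add: unit_ball_vol_def Gamma_real_pos)

text \<open>If p b were at most \<alpha>, the integrand would dominate a multiple of |y|^(-N), whose
  mass on every dyadic shell is at least a fixed positive number; but the shell masses of an
  integrable function tend to zero.\<close>

lemma lower_bound_exponent: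
  fixes u :: "'a::euclidean_space \<Rightarrow> real"
  assumes \<alpha>: "0 < \<alpha>" "\<alpha> < real DIM('a)" and p: "p > 0" and c: "c > 0" and R: "R \<ge> 2"
    and lower: "\<And>x. norm x \<ge> R \<Longrightarrow> c * norm x powr (- b) \<le> u x"
    and fin: "(\<integral>\<^sup>+ y. indicator ext_dom y * ennreal (u y powr p / (1 + norm y powr (real DIM('a) - \<alpha>))) \<partial>lebesgue) < \<infinity>"
  shows "p * b > \<alpha>"
proof (rule ccontr)
  assume "\<not> p * b > \<alpha>"
  then have pb: "p * b \<le> \<alpha>" by simp
  define n where "n = real DIM('a)"
  define g where "g y = indicator {y::'a. norm y \<ge> R} y * (c powr p / 2 * norm y powr (- n))" for y
  have [measurable]: "g \<in> borel_measurable borel" unfolding g_def by measurable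
  have g0: "g y \<ge> 0" for y by (simp add: g_def)
  have "(\<integral>\<^sup>+ y. ennreal (g y) \<partial>lborel) \<le> (\<integral>\<^sup>+ y. indicator ext_dom y * ennreal (u y powr p / (1 + norm y powr (n - \<alpha>))) \<partial>lborel)"
  proof (rule nn_integral_mono)
    fix y :: 'a
    show "ennreal (g y) \<le> indicator ext_dom y * ennreal (u y powr p / (1 + norm y powr (n - \<alpha>)))"
    proof (cases "norm y \<ge> R")
      case True
      then have y: "norm y \<ge> 1" "y \<in> ext_dom" using R by (auto simp: ext_dom_iff)
      have "c powr p * norm y powr (- \<alpha>) \<le> c powr p * norm y powr (- b * p)"
        using y pb by (intro mult_left_mono powr_mono) (auto simp: mult.commute)
      also have "\<dots> = (c * norm y powr (- b)) powr p" using c by (simp add: powr_mult powr_powr)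
      also have "\<dots> \<le> u y powr p" using lower[OF True] c p by (intro powr_mono2) auto
      finally have 1: "c powr p * norm y powr (- \<alpha>) \<le> u y powr p" .
      have "norm y powr (n - \<alpha>) \<ge> 1" using y \<alpha> by (intro ge_one_powr_ge_zero) (auto simp: n_def)
      then have 2: "1 + norm y powr (n - \<alpha>) \<le> 2 * norm y powr (n - \<alpha>)" by simp
      have "c powr p / 2 * norm y powr (- n) = (c powr p * norm y powr (- \<alpha>)) / (2 * norm y powr (n - \<alpha>))"
      proof -
        have "norm y powr (- \<alpha>) / norm y powr (n - \<alpha>) = norm y powr (- n)"
          unfolding powr_diff[symmetric] by simp
        then show ?thesis by (metis mult.commute times_divide_times_eq)
      qed
      also have "\<dots> \<le> u y powr p / (1 + norm y powr (n - \<alpha>))"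
        using 1 2 y by (intro frac_le) (auto intro: add_pos_nonneg)
      finally show ?thesis using True y by (auto simp: g_def intro!: ennreal_leI)
    qed (simp add: g_def)
  qed
  also have "\<dots> < \<infinity>" using fin by (simp add: n_def nn_integral_completion)
  finally have gi: "integrable lborel g" using g0 by (intro integrableI_bounded) auto
  define r where "r k = 2 ^ k * R" for k :: nat
  have rpos: "r k > 0" and rR: "r k \<ge> R" for k using R by (auto simp: r_def mult_le_cancel_right1)
  have "(\<lambda>k. \<integral>y. indicator (shell (r k)) y * g y \<partial>lborel) \<longlonglongrightarrow> (\<integral>y. 0 \<partial>(lborel::'a measure))"
  proof (rule integral_dominated_convergence[where w=g])
    show "AE y in lborel. (\<lambda>k. indicator (shell (r k)) y * g y) \<longlonglongrightarrow> 0"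
    proof (rule AE_I2)
      fix y :: 'a
      obtain k0 where k0: "norm y < 2 ^ k0" using real_arch_pow[of 2 "norm y"] by auto
      have "indicator (shell (r k)) y * g y = 0" if "k \<ge> k0" for k
      proof -
        have "norm y < 2 ^ k" using k0 power_increasing[OF that, of "2::real"] by linarith
        also have "(2::real) ^ k \<le> r k" using R by (simp add: r_def mult_le_cancel_left1)
        finally show ?thesis by (simp add: indicator_def shell_iff)
      qed
      then show "(\<lambda>k. indicator (shell (r k)) y * g y) \<longlonglongrightarrow> 0"
        by (intro tendsto_eventually) (auto simp: eventually_sequentially)
    qed
  qed (use gi g0 in \<open>auto simp: indicator_def\<close>)
  then have lim: "(\<lambda>k. \<integral>y. indicator (shell (r k)) y * g y \<partial>lborel) \<longlonglongrightarrow> 0" by simp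
  \<comment> \<open>A lower bound of \<open>g\<close> on a shell times the lower bound for its
    volume; the radius cancels because the density has exponent -N.\<close>
  define \<kappa> where "\<kappa> = c powr p / 2 * 2 powr (- n) * unit_ball_vol n"
  have k: "\<kappa> > 0" using c unit_ball_vol_DIM_pos[where 'a='a] by (simp add: \<kappa>_def n_def)
  have "\<kappa> \<le> (\<integral>y. indicator (shell (r k)) y * g y \<partial>lborel)" for k
  proof -
    have int: "integrable lborel (\<lambda>y. indicator (shell (r k)) y * g y)"
      by (rule Bochner_Integration.integrable_bound[OF gi]) (auto simp: indicator_def)
    have "ennreal \<kappa> = ennreal (c powr p / 2 * (2 * r k) powr (- n)) * ennreal (unit_ball_vol n * r k powr n)"
    proof -
      have "r k powr (- n) * r k powr n = 1" using rpos[of k] by (simp add: powr_minus)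
      then have "\<kappa> = c powr p / 2 * (2 * r k) powr (- n) * (unit_ball_vol n * r k powr n)"
        using rpos[of k] by (simp add: \<kappa>_def powr_mult)
      then show ?thesis
        using unit_ball_vol_DIM_pos[where 'a='a] by (simp only: n_def) (intro ennreal_mult, auto)
    qed
    also have "\<dots> \<le> ennreal (c powr p / 2 * (2 * r k) powr (- n)) * emeasure lborel (shell (r k) :: 'a set)"
      using emeasure_shell_ge[OF rpos[of k], where 'a='a] rpos[of k]
      by (intro mult_left_mono) (auto simp: n_def powr_realpow)
    also have "\<dots> = (\<integral>\<^sup>+y. ennreal (c powr p / 2 * (2 * r k) powr (- n)) * indicator (shell (r k) :: 'a set) y \<partial>lborel)"
      by (subst nn_integral_cmult_indicator) auto
    also have "\<dots> \<le> (\<integral>\<^sup>+y. ennreal (indicator (shell (r k)) y * g y) \<partial>lborel)"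
    proof (rule nn_integral_mono)
      fix y :: 'a
      show "ennreal (c powr p / 2 * (2 * r k) powr (- n)) * indicator (shell (r k)) y \<le> ennreal (indicator (shell (r k)) y * g y)"
      proof (cases "y \<in> shell (r k)")
        case True
        then have y: "r k < norm y" "norm y < 2 * r k" by (auto simp: shell_iff)
        then have "(2 * r k) powr (- n) \<le> norm y powr (- n)"
          using rpos[of k] by (intro powr_mono2') (auto simp: n_def)
        then show ?thesis using True y rR[of k] c by (auto simp: g_def intro!: ennreal_leI mult_left_mono)
      qed simp
    qed
    also have "\<dots> = ennreal (\<integral>y. indicator (shell (r k)) y * g y \<partial>lborel)"
      using int g0 by (intro nn_integral_eq_integral) auto
    finally show ?thesis using k by (auto simp: ennreal_le_iff2)
  qed
  then have "\<kappa> \<le> 0" using LIMSEQ_le_const[OF lim] by auto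
  with k show False by simp
qed

text \<open>Kernel and density are replaced by constants on \<open>S\<close>. The point
  \<open>x\<close> itself has to be excluded: \<open>0 powr a\<close> is 0, so the formalised kernel
  vanishes at the singularity instead of being infinite.\<close>

lemma riesz_conv_ge:
  fixes x :: "'a::euclidean_space"
  assumes \<alpha>: "0 < \<alpha>" "\<alpha> < real DIM('a)" and S: "S \<in> sets borel" "S \<subseteq> ext_dom"
    and k: "k \<ge> 0" and y: "\<And>y. y \<in> S \<Longrightarrow> y \<noteq> x \<and> norm (x - y) \<le> \<rho> \<and> k \<le> g y"
  shows "ennreal (riesz_const DIM('a) \<alpha> * \<rho> powr (\<alpha> - real DIM('a)) * k) * emeasure lborel S \<le> riesz_conv \<alpha> g x"
proof -
  have "ennreal (riesz_const DIM('a) \<alpha> * \<rho> powr (\<alpha> - real DIM('a)) * k) * emeasure lborel S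
     = (\<integral>\<^sup>+y. ennreal (riesz_const DIM('a) \<alpha> * \<rho> powr (\<alpha> - real DIM('a)) * k) * indicator S y \<partial>lborel)"
    using S by (subst nn_integral_cmult_indicator) auto
  also have "\<dots> \<le> (\<integral>\<^sup>+y. indicator ext_dom y * ennreal (riesz_kernel \<alpha> (x - y) * g y) \<partial>lborel)"
  proof (rule nn_integral_mono)
    fix z
    show "ennreal (riesz_const DIM('a) \<alpha> * \<rho> powr (\<alpha> - real DIM('a)) * k) * indicator S z
       \<le> indicator ext_dom z * ennreal (riesz_kernel \<alpha> (x - z) * g z)"
    proof (cases "z \<in> S")
      case True
      note yz = y[OF True]
      have "\<rho> powr (\<alpha> - real DIM('a)) \<le> norm (x - z) powr (\<alpha> - real DIM('a))"
        using yz \<alpha> by (intro powr_mono2') auto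
      then have "riesz_const DIM('a) \<alpha> * \<rho> powr (\<alpha> - real DIM('a)) * k \<le> riesz_kernel \<alpha> (x - z) * g z"
        using yz k riesz_const_pos[OF \<alpha>] unfolding riesz_kernel_def by (intro mult_mono) auto
      then show ?thesis using True S by (auto intro!: ennreal_leI)
    qed simp
  qed
  also have "\<dots> = riesz_conv \<alpha> g x" by (simp add: riesz_conv_def nn_integral_completion)
  finally show ?thesis .
qed

text \<open>The fixed shell 2 < |y| < 4 carries a positive mass of u^p and is at distance at most 5
  |x| from every \<open>x\<close> with |x| \<ge> 1; this alone yields the rate
  |x|^(\<alpha>-N).\<close>

lemma riesz_conv_lower_far:
  fixes u :: "'a::euclidean_space \<Rightarrow> real"
  assumes \<alpha>: "0 < \<alpha>" "\<alpha> < real DIM('a)"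
    and u: "continuous_on ext_dom u" and pos: "\<And>x. x \<in> ext_dom \<Longrightarrow> u x > 0"
  shows "\<exists>c>0. \<forall>x. norm x \<ge> 1 \<longrightarrow> ennreal (c * norm x powr (\<alpha> - real DIM('a))) \<le> riesz_pow \<alpha> p u x"
proof -
  \<comment> \<open>The compact closure of the shell, on which the continuous positive function
    \<open>u y powr p\<close> attains a positive minimum.\<close>
  define B where "B = (cball 0 4 - ball 0 2 :: 'a set)"
  have B: "compact B" "B \<subseteq> ext_dom" by (auto simp: B_def compact_diff ext_dom_iff)
  have Bne: "B \<noteq> {}"
  proof -
    obtain b :: 'a where "b \<in> Basis" using nonempty_Basis by blast
    then have "3 *\<^sub>R b \<in> B" by (auto simp: B_def)
    then show ?thesis by auto
  qed
  have "continuous_on B (\<lambda>y. u y powr p)"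
    using pos B by (intro continuous_intros continuous_on_subset[OF u]) (auto simp: less_imp_neq[symmetric])
  from continuous_attains_inf[OF B(1) Bne this]
  obtain y0 where y0: "y0 \<in> B" "\<And>y. y \<in> B \<Longrightarrow> u y0 powr p \<le> u y powr p" by blast
  define k where "k = u y0 powr p"
  have k: "k > 0" using pos[of y0] y0 B by (auto simp: k_def)
  define V where "V = unit_ball_vol (real DIM('a)) * 2 ^ DIM('a)"
  have V: "V > 0" using unit_ball_vol_DIM_pos[where 'a='a] by (simp add: V_def)
  define c where "c = riesz_const DIM('a) \<alpha> * 5 powr (\<alpha> - real DIM('a)) * k * V"
  have c: "c > 0" using k V riesz_const_pos[OF \<alpha>] by (simp add: c_def)
  have "ennreal (c * norm x powr (\<alpha> - real DIM('a))) \<le> riesz_pow \<alpha> p u x" if x: "norm x \<ge> 1" for x :: 'a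
  proof -
    have "ennreal (c * norm x powr (\<alpha> - real DIM('a)))
       = ennreal (riesz_const DIM('a) \<alpha> * (5 * norm x) powr (\<alpha> - real DIM('a)) * k) * ennreal V"
      using k V riesz_const_pos[OF \<alpha>] by (simp add: c_def powr_mult ennreal_mult[symmetric] mult_ac)
    also have "\<dots> \<le> ennreal (riesz_const DIM('a) \<alpha> * (5 * norm x) powr (\<alpha> - real DIM('a)) * k) * emeasure lborel (shell 2 - {x})"
    proof (intro mult_left_mono)
      \<comment> \<open>Removing the singular point costs only a null set.\<close>
      have "emeasure lborel (shell 2 - {x}) = emeasure lborel (shell 2 :: 'a set)"
        by (intro emeasure_Diff_null_set) auto
      then show "ennreal V \<le> emeasure lborel (shell 2 - {x})" using emeasure_shell_ge[of 2, where 'a='a] by (simp add: V_def)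
    qed simp
    also have "\<dots> \<le> riesz_pow \<alpha> p u x"
    proof (rule riesz_conv_ge[OF \<alpha>])
      fix y assume "y \<in> shell 2 - {x}"
      then have y: "y \<noteq> x" "2 < norm y" "norm y < 4" by (auto simp: shell_iff)
      then have "y \<in> B" by (auto simp: B_def)
      then show "y \<noteq> x \<and> norm (x - y) \<le> 5 * norm x \<and> k \<le> u y powr p"
        using y x norm_triangle_ineq4[of x y] y0(2) by (auto simp: k_def)
    qed (use k in \<open>auto simp: shell_iff ext_dom_iff\<close>)
    finally show ?thesis .
  qed
  with c show ?thesis by blast
qed

text \<open>Contribution of the shell |x| < |y| < 2|x|: its volume is of order |x|^N, the kernel is
  at least a multiple of |x|^(\<alpha>-N), and the lower bound on \<open>u\<close> contributes
  |x|^(-p b). The strict inequality keeps \<open>x\<close> out of the shell.\<close>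

lemma riesz_conv_lower_near:
  fixes u :: "'a::euclidean_space \<Rightarrow> real"
  assumes \<alpha>: "0 < \<alpha>" "\<alpha> < real DIM('a)" and p: "p > 0" and c: "c > 0" and b: "b > 0" and R: "R \<ge> 1"
    and lower: "\<And>x. norm x \<ge> R \<Longrightarrow> c * norm x powr (- b) \<le> u x"
  shows "\<exists>c>0. \<forall>x. norm x \<ge> R \<longrightarrow> ennreal (c * norm x powr (\<alpha> - p * b)) \<le> riesz_pow \<alpha> p u x"
proof -
  define n where "n = real DIM('a)"
  define k where "k = c powr p * 2 powr (- b * p)"
  define V where "V = unit_ball_vol n"
  have V: "V > 0" using unit_ball_vol_DIM_pos[where 'a='a] by (simp add: V_def n_def)
  define d where "d = riesz_const DIM('a) \<alpha> * 3 powr (\<alpha> - n) * k * V"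
  have k: "k > 0" using c by (simp add: k_def)
  have d: "d > 0" using k V riesz_const_pos[OF \<alpha>] by (simp add: d_def)
  have "ennreal (d * norm x powr (\<alpha> - p * b)) \<le> riesz_pow \<alpha> p u x" if x: "norm x \<ge> R" for x :: 'a
  proof -
    have x0: "norm x > 0" using x R by linarith
    define kx where "kx = k * norm x powr (- b * p)"
    have kx: "kx > 0" using k x0 by (simp add: kx_def)
    have e: "norm x powr (\<alpha> - n) * norm x powr (- b * p) * norm x powr n = norm x powr (\<alpha> - p * b)"
      unfolding powr_add[symmetric] by (simp add: algebra_simps)
    have "d * norm x powr (\<alpha> - p * b) = (riesz_const DIM('a) \<alpha> * (3 * norm x) powr (\<alpha> - n) * kx) * (V * norm x powr n)"
      unfolding e[symmetric] by (simp add: d_def kx_def powr_mult mult_ac)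
    then have "ennreal (d * norm x powr (\<alpha> - p * b))
       = ennreal (riesz_const DIM('a) \<alpha> * (3 * norm x) powr (\<alpha> - n) * kx) * ennreal (V * norm x powr n)"
      using kx V riesz_const_pos[OF \<alpha>] by (simp add: ennreal_mult[symmetric])
    also have "\<dots> \<le> ennreal (riesz_const DIM('a) \<alpha> * (3 * norm x) powr (\<alpha> - n) * kx) * emeasure lborel (shell (norm x) :: 'a set)"
      using emeasure_shell_ge[OF x0, where 'a='a] x0 by (intro mult_left_mono) (auto simp: V_def n_def powr_realpow)
    also have "\<dots> \<le> riesz_pow \<alpha> p u x"
      unfolding n_def
    proof (rule riesz_conv_ge[OF \<alpha>])
      fix y :: 'a assume "y \<in> shell (norm x)"
      then have y: "norm x < norm y" "norm y < 2 * norm x" by (auto simp: shell_iff)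
      have "kx = c powr p * (2 * norm x) powr (- b * p)" by (simp add: kx_def k_def powr_mult)
      also have "\<dots> \<le> c powr p * norm y powr (- b * p)"
        using y x0 b p by (intro mult_left_mono powr_mono2') auto
      also have "\<dots> = (c * norm y powr (- b)) powr p" using c by (simp add: powr_mult powr_powr)
      also have "\<dots> \<le> u y powr p" using lower[of y] y x c p by (intro powr_mono2) auto
      finally have "kx \<le> u y powr p" .
      then show "y \<noteq> x \<and> norm (x - y) \<le> 3 * norm x \<and> kx \<le> u y powr p"
        using y norm_triangle_ineq4[of x y] by auto
    qed (use kx x R in \<open>auto simp: shell_iff ext_dom_iff\<close>)
    finally show ?thesis .
  qed
  with d show ?thesis by blast
qed

section \<open>The exponent \<open>\<beta>\<^sup>-\<close>\<close>

text \<open>Both factors are nonnegative and strictly increasing; here m \<ge> N enters, since it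
  keeps the linear factor nonnegative down to 0.\<close>

lemma Kfun_strict_mono:
  assumes "m > 1" "real N \<le> m" "0 \<le> s" "s < t"
  shows "Kfun m N s < Kfun m N t"
proof -
  have "(m - 1) * s < (m - 1) * t" using assms by simp
  moreover have "0 \<le> (m - 1) * s" using assms by simp
  ultimately have "(m - 1) * s + m - real N < (m - 1) * t + m - real N" "0 \<le> (m - 1) * s + m - real N"
    using assms by linarith+
  then show ?thesis
    unfolding Kfun_def using assms powr_less_mono2[of "m - 1" s t]
    by (intro mult_strict_mono) auto
qed

lemma continuous_on_Kfun:
  assumes "m > 1"
  shows "continuous_on {0..} (Kfun m N)"
  unfolding Kfun_def[abs_def] using assms by (intro continuous_intros continuous_on_powr') auto

lemma Gfun_uminus: "t \<ge> 0 \<Longrightarrow> Gfun m N (- t) = - Kfun m N t"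
  using powr_add[of t "m - 2" 1] by (cases "t = 0") (auto simp: Gfun_def Kfun_def algebra_simps)

lemma Kfun_surj:
  assumes "m > 1" "real N \<le> m" "lam > 0"
  obtains b where "b > 0" "Kfun m N b = lam"
proof -
  \<comment> \<open>Chosen so that the power factor is at least 1 and the linear factor at least
    \<open>lam\<close>.\<close>
  define B where "B = max 1 (lam / (m - 1))"
  have B0: "0 \<le> B" by (simp add: B_def le_max_iff_disj)
  have "B powr (m - 1) \<ge> 1" using assms by (intro ge_one_powr_ge_zero) (auto simp: B_def)
  moreover have "(m - 1) * B \<ge> lam" using assms by (auto simp: B_def max_def field_simps)
  ultimately have "Kfun m N B \<ge> 1 * lam"
    unfolding Kfun_def using assms by (intro mult_mono) auto
  moreover have "Kfun m N 0 = 0" using assms by (simp add: Kfun_def)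
  ultimately obtain b where b: "0 \<le> b" "b \<le> B" "Kfun m N b = lam"
    using IVT'[of "Kfun m N" 0 lam B] assms continuous_on_subset[OF continuous_on_Kfun[OF assms(1)]] B0 by auto
  then have "b \<noteq> 0" using assms by (auto simp: Kfun_def)
  with b that[of b] show thesis by simp
qed

text \<open>The infimum is attained at \<open>- b\<close>: further left, G(\<beta>) = -K(-\<beta>)
  is strictly below \<mu> by monotonicity of K.\<close>

lemma beta_minus_eq:
  assumes "m > 1" "real N \<le> m" "b > 0" "Kfun m N b = - \<mu>"
  shows "beta_minus m N \<mu> = - b"
  unfolding beta_minus_def
proof (rule cInf_eq_minimum)
  show "- b \<in> {\<beta>. \<mu> \<le> Gfun m N \<beta>}" using assms by (simp add: Gfun_uminus)
  fix \<beta> assume "\<beta> \<in> {\<beta>. \<mu> \<le> Gfun m N \<beta>}"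
  then have G: "\<mu> \<le> Gfun m N \<beta>" by simp
  show "- b \<le> \<beta>"
  proof (rule ccontr)
    assume "\<not> - b \<le> \<beta>"
    then have "b < - \<beta>" by simp
    then have "Kfun m N b < Kfun m N (- \<beta>)" using assms by (intro Kfun_strict_mono) auto
    moreover have "Gfun m N \<beta> = - Kfun m N (- \<beta>)" using Gfun_uminus[of "- \<beta>"] \<open>b < - \<beta>\<close> assms by simp
    ultimately show False using G assms by simp
  qed
qed

section \<open>Necessity\<close>

text \<open>The integral multiplied by the constant is nonnegative, and raising \<open>R\<close>
  only removes test functions.\<close>

lemma weak_super_mono:
  fixes u :: "'a::euclidean_space \<Rightarrow> real"
  assumes "weak_super m lam R u Du" "lam \<le> lam'" "R \<le> R'"
  shows "weak_super m lam' R' u Du"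
  unfolding weak_super_def
proof (intro allI impI)
  fix \<phi> :: "'a \<Rightarrow> real"
  assume a: "test_fun ext_dom \<phi> \<and> (\<forall>x. 0 \<le> \<phi> x \<and> \<phi> x \<le> 1) \<and> (\<forall>x\<in>tsupport \<phi>. R' < norm x \<and> u x < 1)"
  then have "\<forall>x\<in>tsupport \<phi>. R < norm x \<and> u x < 1" using assms(3) by auto
  with a assms(1) have 1: "0 \<le> (LINT x:ext_dom|lebesgue. flux m Du \<phi> x)
         + lam * (LINT x:ext_dom|lebesgue. norm x powr (- m) * u x powr (m - 1) * \<phi> x)"
    unfolding weak_super_def by blast
  have "(LINT x:ext_dom|lebesgue. norm x powr (- m) * u x powr (m - 1) * \<phi> x) \<ge> 0"
    unfolding set_lebesgue_integral_def using a by (intro Bochner_Integration.integral_nonneg) auto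
  from mult_right_mono[OF assms(2) this] 1
  show "0 \<le> (LINT x:ext_dom|lebesgue. flux m Du \<phi> x)
         + lam' * (LINT x:ext_dom|lebesgue. norm x powr (- m) * u x powr (m - 1) * \<phi> x)" by linarith
qed

text \<open>Where the nonlocal term is at least \<kappa> times the Hardy density, that part can be
  moved to the left and lowers the constant from -\<mu> to -\<mu> - \<kappa>. Only points beyond
  \<open>R\<close> with \<open>u x < 1\<close> matter, because the tests are supported
  there.\<close>

lemma solution_weak_super:
  fixes u :: "'a::euclidean_space \<Rightarrow> real"
  assumes m: "m > 1" and u: "continuous_on ext_dom u" and pos: "\<And>x. x \<in> ext_dom \<Longrightarrow> u x > 0"
    and W: "W1loc m ext_dom u Du"
    and fin: "\<And>K. compact K \<Longrightarrow> K \<subseteq> ext_dom \<Longrightarrow>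
          (\<integral>\<^sup>+ x. indicator K x * riesz_pow \<alpha> p u x * ennreal (u x powr q) \<partial>lebesgue) < \<infinity>"
    and ineq: "\<And>\<phi>. test_fun ext_dom \<phi> \<Longrightarrow> (\<And>x. \<phi> x \<ge> 0) \<Longrightarrow>
          (LINT x:ext_dom|lebesgue. flux m Du \<phi> x
               - \<mu> / norm x powr m * u x powr (m - 1) * \<phi> x)
          \<ge> enn2real (\<integral>\<^sup>+ x. indicator ext_dom x * riesz_pow \<alpha> p u x
                              * ennreal (u x powr q * \<phi> x) \<partial>lebesgue)"
    and k: "\<kappa> \<ge> 0"
    and lower: "\<And>x. x \<in> ext_dom \<Longrightarrow> norm x > R \<Longrightarrow> u x < 1 \<Longrightarrow>
       ennreal (\<kappa> * (norm x powr (- m) * u x powr (m - 1))) \<le> riesz_pow \<alpha> p u x * ennreal (u x powr q)"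
  shows "weak_super m (- \<mu> - \<kappa>) R u Du"
  unfolding weak_super_def
proof (intro allI impI)
  fix \<phi> :: "'a \<Rightarrow> real"
  assume a: "test_fun ext_dom \<phi> \<and> (\<forall>x. 0 \<le> \<phi> x \<and> \<phi> x \<le> 1) \<and> (\<forall>x\<in>tsupport \<phi>. R < norm x \<and> u x < 1)"
  then have t: "test_fun ext_dom \<phi>" and p01: "\<And>x. 0 \<le> \<phi> x" "\<And>x. \<phi> x \<le> 1"
    and sp: "\<And>x. x \<in> tsupport \<phi> \<Longrightarrow> R < norm x \<and> u x < 1" by auto
  note tf = test_fun_facts[OF t]
  define P where "P x = norm x powr (- m) * u x powr (m - 1) * \<phi> x" for x
  define J where "J = (LINT x:ext_dom|lebesgue. P x)"
  have Pi: "set_integrable lebesgue ext_dom P"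
  proof (rule set_integrable_compact_support[OF tf(4) continuous_on_subset[OF _ tf(5)] _ tf(5)])
    show "continuous_on ext_dom P" unfolding P_def
      by (intro continuous_intros continuous_on_norm_powr_ext_dom continuous_on_subset[OF tf(1)] u)
         (use pos in \<open>force simp: less_imp_neq\<close>)+
  qed (use tf in \<open>auto simp: P_def\<close>)
  define X where "X = (\<integral>\<^sup>+ x. indicator ext_dom x * riesz_pow \<alpha> p u x * ennreal (u x powr q * \<phi> x) \<partial>lebesgue)"
  have "X \<le> (\<integral>\<^sup>+ x. indicator (tsupport \<phi>) x * riesz_pow \<alpha> p u x * ennreal (u x powr q) \<partial>lebesgue)"
    unfolding X_def
  proof (rule nn_integral_mono)
    fix x
    show "indicator ext_dom x * riesz_pow \<alpha> p u x * ennreal (u x powr q * \<phi> x)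
      \<le> indicator (tsupport \<phi>) x * riesz_pow \<alpha> p u x * ennreal (u x powr q)"
    proof (cases "x \<in> tsupport \<phi>")
      case True
      then have "x \<in> ext_dom" using tf(5) by blast
      moreover have "ennreal (u x powr q * \<phi> x) \<le> ennreal (u x powr q)"
        using p01[of x] by (intro ennreal_leI) (simp add: mult_left_le)
      ultimately show ?thesis using True by (simp add: mult_left_mono)
    qed (simp add: tf(6))
  qed
  also have "\<dots> < \<infinity>" by (rule fin[OF tf(4,5)])
  \<comment> \<open>Finiteness is essential: \<open>enn2real\<close> sends infinity to 0, and the
    differential inequality would then say nothing about the nonlocal term.\<close>
  finally have Xfin: "X < \<infinity>" .
  have "ennreal (\<kappa> * J) \<le> X"
  proof -
    have P0: "P x \<ge> 0" for x using p01 by (simp add: P_def)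
    have "ennreal (\<kappa> * J) = (\<integral>\<^sup>+x. ennreal (\<kappa> * (indicator ext_dom x *\<^sub>R P x)) \<partial>lebesgue)"
    proof -
      have "\<kappa> * J = (\<integral>x. \<kappa> * (indicator ext_dom x *\<^sub>R P x) \<partial>lebesgue)"
        by (simp add: J_def set_lebesgue_integral_def)
      moreover have "integrable lebesgue (\<lambda>x. \<kappa> * (indicator ext_dom x *\<^sub>R P x))"
        using Pi unfolding set_integrable_def by (rule integrable_mult_right)
      ultimately show ?thesis using k P0 by (subst nn_integral_eq_integral) auto
    qed
    also have "\<dots> \<le> X"
      unfolding X_def
    proof (rule nn_integral_mono)
      fix x
      show "ennreal (\<kappa> * (indicator ext_dom x *\<^sub>R P x))
        \<le> indicator ext_dom x * riesz_pow \<alpha> p u x * ennreal (u x powr q * \<phi> x)"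
      proof (cases "x \<in> tsupport \<phi>")
        case True
        then have x: "x \<in> ext_dom" "R < norm x" "u x < 1" using tf(5) sp by auto
        have "ennreal (\<kappa> * (indicator ext_dom x *\<^sub>R P x)) = ennreal (\<kappa> * (norm x powr (- m) * u x powr (m - 1))) * ennreal (\<phi> x)"
          using x k p01 by (simp add: P_def ennreal_mult[symmetric] mult_ac)
        also have "\<dots> \<le> (riesz_pow \<alpha> p u x * ennreal (u x powr q)) * ennreal (\<phi> x)"
          using lower[OF x] by (intro mult_right_mono) auto
        also have "\<dots> = indicator ext_dom x * riesz_pow \<alpha> p u x * ennreal (u x powr q * \<phi> x)"
          using x p01 by (simp add: ennreal_mult mult_ac)
        finally show ?thesis .
      qed (simp add: P_def tf(6))
    qed
    finally show ?thesis .
  qed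
  then have "\<kappa> * J \<le> enn2real X" using Xfin by (simp add: ennreal_le_iff2 enn2real_nonneg ennreal_enn2real_if ennreal_leI)
       (metis enn2real_nonneg ennreal_enn2real ennreal_le_iff)
  also have "enn2real X \<le> (LINT x:ext_dom|lebesgue. flux m Du \<phi> x
               - \<mu> / norm x powr m * u x powr (m - 1) * \<phi> x)"
    unfolding X_def by (rule ineq[OF t p01(1)])
  also have "\<dots> = (LINT x:ext_dom|lebesgue. flux m Du \<phi> x - \<mu> * P x)"
    by (simp add: P_def powr_minus divide_inverse mult_ac)
  also have "\<dots> = (LINT x:ext_dom|lebesgue. flux m Du \<phi> x) - (LINT x:ext_dom|lebesgue. \<mu> * P x)"
    by (rule set_integral_diff(2)[OF flux_integrable[OF m W t]]) (use Pi in simp)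
  also have "(LINT x:ext_dom|lebesgue. \<mu> * P x) = \<mu> * J" by (simp add: J_def)
  finally show "0 \<le> (LINT x:ext_dom|lebesgue. flux m Du \<phi> x)
         + (- \<mu> - \<kappa>) * (LINT x:ext_dom|lebesgue. norm x powr (- m) * u x powr (m - 1) * \<phi> x)"
    unfolding J_def P_def by (simp add: algebra_simps)
qed

lemma pos_solution_necessary:
  fixes u :: "'a::euclidean_space \<Rightarrow> real"
  assumes m: "m > 1" and N: "real DIM('a) \<le> m" and p: "p > 0" and \<alpha>: "0 < \<alpha>" "\<alpha> < real DIM('a)"
    and sol: "pos_solution m \<mu> p q \<alpha> u"
  shows "\<exists>b>0. Kfun m DIM('a) b = - \<mu> \<and> \<mu> < 0 \<and> p * b > \<alpha> \<and>
     m + \<alpha> < b * (p + q - (m - 1)) \<and> m + \<alpha> - real DIM('a) < b * (q - (m - 1))"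
proof -
  define n where "n = real DIM('a)"
  define K where "K = Kfun m DIM('a)"
  from sol obtain Du where u: "continuous_on ext_dom u" and pos: "\<And>x. x \<in> ext_dom \<Longrightarrow> u x > 0"
    and W: "W1loc m ext_dom u Du"
    and fin: "\<And>K. compact K \<Longrightarrow> K \<subseteq> ext_dom \<Longrightarrow>
          (\<integral>\<^sup>+ x. indicator K x * riesz_pow \<alpha> p u x * ennreal (u x powr q) \<partial>lebesgue) < \<infinity>"
    and fin2: "(\<integral>\<^sup>+ y. indicator ext_dom y * ennreal (u y powr p / (1 + norm y powr (real DIM('a) - \<alpha>))) \<partial>lebesgue) < \<infinity>"
    and ineq: "\<And>\<phi>. test_fun ext_dom \<phi> \<Longrightarrow> (\<And>x. \<phi> x \<ge> 0) \<Longrightarrow>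
          (LINT x:ext_dom|lebesgue. flux m Du \<phi> x
               - \<mu> / norm x powr m * u x powr (m - 1) * \<phi> x)
          \<ge> enn2real (\<integral>\<^sup>+ x. indicator ext_dom x * riesz_pow \<alpha> p u x
                              * ennreal (u x powr q * \<phi> x) \<partial>lebesgue)"
    unfolding pos_solution_def by blast
  note sws = solution_weak_super[OF m u pos W fin ineq]
  have lower: "\<exists>c>0. \<forall>x. norm x \<ge> R + 1 \<longrightarrow> c * norm x powr (- b) \<le> u x" if "b > 0" "R \<ge> 1" "weak_super m (K b) R u Du" for b R
    using weak_super_lower_bound[OF m N that(1) u pos W that(2)] that(3) by (simp add: K_def)
  \<comment> \<open>A supersolution with constant K(\<alpha>/p) would be bounded below by a multiple
    of |x|^(-\<alpha>/p), whereas integrability requires p times the exponent to exceed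
    \<alpha>.\<close>
  have no: "\<not> weak_super m (K (\<alpha> / p)) R u Du" if "R \<ge> 1" for R
  proof
    assume "weak_super m (K (\<alpha> / p)) R u Du"
    from lower[OF _ that this] obtain c where "c > 0" "\<And>x. norm x \<ge> R + 1 \<Longrightarrow> c * norm x powr (- (\<alpha> / p)) \<le> u x"
      using \<alpha> p by auto
    then have "p * (\<alpha> / p) > \<alpha>"
      using that by (intro lower_bound_exponent[OF \<alpha> p _ _ _ fin2, of _ "R + 1"]) auto
    then show False using p by simp
  qed
  \<comment> \<open>With \<kappa> = 0 the nonlocal term is used only through its sign.\<close>
  have "weak_super m (- \<mu> - 0) 1 u Du" by (rule sws) auto
  then have ws0: "weak_super m (- \<mu>) 1 u Du" by (simp only: diff_0_right)
  have gt: "- \<mu> > K (\<alpha> / p)"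
    using no[of 1] weak_super_mono[OF ws0, of "K (\<alpha> / p)" 1] by (meson not_less order_refl)
  have Kp: "K (\<alpha> / p) > 0" unfolding K_def using \<alpha> p by (intro Kfun_pos m N) auto
  with gt have mu: "\<mu> < 0" by linarith
  obtain b where b: "b > 0" "K b = - \<mu>" using Kfun_surj[OF m N, of "- \<mu>"] mu by (auto simp: K_def)
  have bp: "b > \<alpha> / p"
  proof (rule ccontr)
    assume "\<not> b > \<alpha> / p"
    then have "K b \<le> K (\<alpha> / p)"
      using Kfun_strict_mono[OF m N, of b "\<alpha> / p"] b(1) by (cases "b = \<alpha> / p") (auto simp: K_def)
    with gt b show False by simp
  qed
  \<comment> \<open>The part of the Hardy constant that has to be absorbed to reach the forbidden
    value K(\<alpha>/p).\<close>
  define \<kappa> where "\<kappa> = - \<mu> - K (\<alpha> / p)"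
  have k: "\<kappa> > 0" using gt by (simp add: \<kappa>_def)
  text \<open>If the nonlocal term eventually dominates a growing multiple of the Hardy term, every Hardy
    constant is admissible, which the decay bound forbids.\<close>
  have absurd: False if cst: "c > 0" "\<theta> > 0" "R0 \<ge> 1"
    and low: "\<And>x. x \<in> ext_dom \<Longrightarrow> norm x \<ge> R0 \<Longrightarrow> u x < 1 \<Longrightarrow>
       ennreal (c * norm x powr \<theta> * (norm x powr (- m) * u x powr (m - 1))) \<le> riesz_pow \<alpha> p u x * ennreal (u x powr q)"
    for c \<theta> R0
  proof -
    have "filterlim (\<lambda>r. c * r powr \<theta>) at_top at_top"
      using cst by real_asymp
    then have "eventually (\<lambda>r. c * r powr \<theta> \<ge> \<kappa>) at_top" by (simp add: filterlim_at_top)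
    then obtain R where R: "\<And>r. r \<ge> R \<Longrightarrow> c * r powr \<theta> \<ge> \<kappa>" by (auto simp: eventually_at_top_linorder)
    have "weak_super m (- \<mu> - \<kappa>) (max R R0) u Du"
    proof (rule sws)
      fix x assume x: "x \<in> ext_dom" "max R R0 < norm x" "u x < 1"
      have "ennreal (\<kappa> * (norm x powr (- m) * u x powr (m - 1))) \<le> ennreal (c * norm x powr \<theta> * (norm x powr (- m) * u x powr (m - 1)))"
        using R[of "norm x"] x by (intro ennreal_leI mult_right_mono) auto
      also have "\<dots> \<le> riesz_pow \<alpha> p u x * ennreal (u x powr q)"
        using x by (intro low) auto
      finally show "ennreal (\<kappa> * (norm x powr (- m) * u x powr (m - 1))) \<le> riesz_pow \<alpha> p u x * ennreal (u x powr q)" .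
    qed (use k in auto)
    with no[of "max R R0"] cst show False by (simp add: \<kappa>_def)
  qed
  obtain c1 where c1: "c1 > 0" "\<And>x. norm x \<ge> 1 \<Longrightarrow> ennreal (c1 * norm x powr (\<alpha> - n)) \<le> riesz_pow \<alpha> p u x"
    using riesz_conv_lower_far[OF \<alpha> u pos, of p] unfolding n_def by blast
  \<comment> \<open>Writing u^q as u^(q-(m-1)) u^(m-1) compares the nonlocal term with the Hardy
    density; what remains to be supplied is a lower bound for u^(q-(m-1)).\<close>
  have nonlin: "ennreal (c * d * norm x powr (s + e) * u x powr (m - 1)) \<le> riesz_pow \<alpha> p u x * ennreal (u x powr q)"
    if "ennreal (c * norm x powr s) \<le> riesz_pow \<alpha> p u x" "c > 0" "d > 0"
      "d * norm x powr e \<le> u x powr (q - (m - 1))" "x \<in> ext_dom" for x c s d e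
  proof -
    have "c * d * norm x powr (s + e) * u x powr (m - 1) = (c * norm x powr s) * ((d * norm x powr e) * u x powr (m - 1))"
      by (simp add: powr_add mult_ac)
    also have "\<dots> \<le> (c * norm x powr s) * (u x powr (q - (m - 1)) * u x powr (m - 1))"
      using that by (intro mult_left_mono mult_right_mono) auto
    also have "u x powr (q - (m - 1)) * u x powr (m - 1) = u x powr q"
      unfolding powr_add[symmetric] by simp
    finally have "ennreal (c * d * norm x powr (s + e) * u x powr (m - 1)) \<le> ennreal ((c * norm x powr s) * u x powr q)"
      by (rule ennreal_leI)
    also have "\<dots> = ennreal (c * norm x powr s) * ennreal (u x powr q)"
      using that by (simp add: ennreal_mult)
    also have "\<dots> \<le> riesz_pow \<alpha> p u x * ennreal (u x powr q)"
      using that by (intro mult_right_mono) auto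
    finally show ?thesis .
  qed
  \<comment> \<open>For q \<le> m - 1 the factor u^(q-(m-1)) is at least 1 where
    \<open>u x < 1\<close>, and the far-field bound leaves the growth |x|^(m+\<alpha>-N), whose
    exponent is positive. Once q - (m-1) > 0 is known, lower bounds on \<open>u\<close> can be
    raised to that power.\<close>
  have q: "q > m - 1"
  proof (rule ccontr)
    assume "\<not> q > m - 1"
    then have q: "q \<le> m - 1" by simp
    show False
    proof (rule absurd[of c1 "m + \<alpha> - n" 1])
      fix x assume x: "x \<in> ext_dom" "norm x \<ge> 1" "u x < 1"
      have "1 powr (q - (m - 1)) \<le> u x powr (q - (m - 1))"
        using x pos[of x] q by (intro powr_mono2') auto
      then have "ennreal (c1 * 1 * norm x powr ((\<alpha> - n) + 0) * u x powr (m - 1)) \<le> riesz_pow \<alpha> p u x * ennreal (u x powr q)"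
        using c1(1) c1(2)[OF x(2)] x by (intro nonlin) auto
      moreover have "norm x powr (m + \<alpha> - n) * norm x powr (- m) = norm x powr (\<alpha> - n)"
        unfolding powr_add[symmetric] by simp
      ultimately show "ennreal (c1 * norm x powr (m + \<alpha> - n) * (norm x powr (- m) * u x powr (m - 1))) \<le> riesz_pow \<alpha> p u x * ennreal (u x powr q)"
        by (simp add: mult.assoc[symmetric]) (simp add: mult.assoc)
    qed (use c1 N \<alpha> in \<open>auto simp: n_def\<close>)
  qed
  \<comment> \<open>Conditions (iii) and (iv) are instances of one statement, for two exponents
    \<open>s\<close> of lower bounds on the potential.\<close>
  have critical: "m + s < b * (q - (m - 1))" if cst: "c > 0" "R0 \<ge> 1"
    and low: "\<And>x. norm x \<ge> R0 \<Longrightarrow> ennreal (c * norm x powr s) \<le> riesz_pow \<alpha> p u x" for s c R0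
  proof (rule ccontr)
    define d where "d = q - (m - 1)"
    have d: "d > 0" using q by (simp add: d_def)
    assume "\<not> m + s < b * (q - (m - 1))"
    then have ge: "m + s \<ge> b * d" by (simp add: d_def)
    have upow: "c' powr d * norm x powr (- b' * d) \<le> u x powr (q - (m - 1))"
      if "c' * norm x powr (- b') \<le> u x" "c' > 0" for c' b' x
    proof -
      have "c' powr d * norm x powr (- b' * d) = (c' * norm x powr (- b')) powr d"
        using that by (simp add: powr_mult powr_powr)
      also have "\<dots> \<le> u x powr d" using that d by (intro powr_mono2) auto
      finally show ?thesis by (simp add: d_def)
    qed
    from lower[OF b(1) _ ws0[folded b(2)]] obtain c2 where c2: "c2 > 0" "\<And>x. norm x \<ge> 2 \<Longrightarrow> c2 * norm x powr (- b) \<le> u x"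
      by auto
    \<comment> \<open>Even at equality m + s = b d the nonlocal term is at least \<open>k0\<close>
      times the Hardy density, because the lower bound on \<open>u\<close> has the matching
      exponent.\<close>
    define k0 where "k0 = c * c2 powr d"
    have k0: "k0 > 0" using cst c2 by (simp add: k0_def)
    have ws1: "weak_super m (- \<mu> - k0) (max 2 R0) u Du"
    proof (rule sws)
      fix x assume x: "x \<in> ext_dom" "max 2 R0 < norm x" "u x < 1"
      have "norm x powr (- m) \<le> norm x powr (s + (- b * d))"
        using x ge by (intro powr_mono) auto
      then have "k0 * (norm x powr (- m) * u x powr (m - 1)) \<le> c * c2 powr d * norm x powr (s + (- b * d)) * u x powr (m - 1)"
        using k0 unfolding k0_def mult.assoc by (intro mult_left_mono mult_right_mono) (use cst in auto)
      then have "ennreal (k0 * (norm x powr (- m) * u x powr (m - 1))) \<le> ennreal (c * c2 powr d * norm x powr (s + (- b * d)) * u x powr (m - 1))"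
        by (rule ennreal_leI)
      also have "\<dots> \<le> riesz_pow \<alpha> p u x * ennreal (u x powr q)"
        using x cst c2 by (intro nonlin low upow) auto
      finally show "ennreal (k0 * (norm x powr (- m) * u x powr (m - 1))) \<le> riesz_pow \<alpha> p u x * ennreal (u x powr q)" .
    qed (use k0 in auto)
    \<comment> \<open>Continuity of K at \<open>b\<close> turns the absorbed amount
      \<open>k0\<close> into a strictly smaller exponent, hence a strictly better lower bound on
      \<open>u\<close>.\<close>
    obtain b' where b': "0 < b'" "b' < b" "K b' \<ge> - \<mu> - k0"
    proof -
      have "continuous (at b within {0..}) K"
        using continuous_on_Kfun[OF m, of "DIM('a)"] b by (simp add: continuous_on_eq_continuous_within K_def)
      then obtain d' where d': "d' > 0" "\<And>x. x \<ge> 0 \<Longrightarrow> dist x b < d' \<Longrightarrow> dist (K x) (K b) < k0"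
        using k0 by (force simp: continuous_within_eps_delta)
      define b' where "b' = max (b / 2) (b - d' / 2)"
      have "0 < b'" "b' < b" "dist b' b < d'" using b d' by (auto simp: b'_def dist_real_def max_def)
      then show thesis using that[of b'] d'(2)[of b'] b(2) by (auto simp: dist_real_def)
    qed
    have "weak_super m (K b') (max 2 R0) u Du" by (rule weak_super_mono[OF ws1 b'(3)]) simp
    moreover have "1 \<le> max 2 R0" by (simp add: le_max_iff_disj)
    ultimately obtain c3 where c3: "c3 > 0" "\<And>x. norm x \<ge> max 2 R0 + 1 \<Longrightarrow> c3 * norm x powr (- b') \<le> u x"
      using lower[OF b'(1)] by blast
    \<comment> \<open>Since d > 0 and b' < b, the growth exponent m + s - b' d is strictly positive
      even if m + s = b d.\<close>
    show False
    proof (rule absurd[of "c * c3 powr d" "m + s - b' * d" "max 2 R0 + 1"])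
      have "b' * d < b * d" using b' d by simp
      then show "m + s - b' * d > 0" using ge by linarith
      fix x assume x: "x \<in> ext_dom" "max 2 R0 + 1 \<le> norm x" "u x < 1"
      have "ennreal (c * c3 powr d * norm x powr (s + (- b' * d)) * u x powr (m - 1)) \<le> riesz_pow \<alpha> p u x * ennreal (u x powr q)"
        using x cst c3 by (intro nonlin low upow) auto
      moreover have "norm x powr (s + (- b' * d)) = norm x powr (m + s - b' * d) * norm x powr (- m)"
        unfolding powr_add[symmetric] by (simp add: algebra_simps)
      ultimately show "ennreal (c * c3 powr d * norm x powr (m + s - b' * d) * (norm x powr (- m) * u x powr (m - 1))) \<le> riesz_pow \<alpha> p u x * ennreal (u x powr q)"
        by (simp only: mult.assoc)
    qed (use cst c3 in auto)
  qed
  from lower[OF b(1) _ ws0[folded b(2)]] obtain c2 where c2: "c2 > 0" "\<And>x. norm x \<ge> 2 \<Longrightarrow> c2 * norm x powr (- b) \<le> u x"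
    by auto
  obtain c4 where c4: "c4 > 0" "\<And>x. norm x \<ge> 2 \<Longrightarrow> ennreal (c4 * norm x powr (\<alpha> - p * b)) \<le> riesz_pow \<alpha> p u x"
    using riesz_conv_lower_near[OF \<alpha> p c2(1) b(1), of 2 u] c2(2) by auto
  \<comment> \<open>The far-field exponent gives (iv); the exponent coming from points comparable to
    \<open>x\<close> gives (iii).\<close>
  have "m + (\<alpha> - n) < b * (q - (m - 1))" by (rule critical[OF c1(1) _ c1(2)]) auto
  moreover have "m + (\<alpha> - p * b) < b * (q - (m - 1))" by (rule critical[OF c4(1) _ c4(2)]) auto
  moreover have "p * b > \<alpha>" using bp p by (simp add: field_simps)
  ultimately show ?thesis using b mu by (intro exI[of _ b]) (auto simp: K_def n_def algebra_simps)
qed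

section \<open>Upper bounds for the Riesz potential\<close>

text \<open>The function is dominated by a sum of constants on balls around the origin, and the
  assumed product bound makes the integrals of the summands a geometric series. Each point only
  needs some admissible index, so balls can replace disjoint shells.\<close>

lemma nn_integral_dyadic_bound:
  fixes f :: "'a::euclidean_space \<Rightarrow> ennreal"
  assumes f: "\<And>y. f y \<noteq> 0 \<Longrightarrow> \<exists>k::nat. norm y < r k \<and> f y \<le> ennreal (c k)"
    and r: "\<And>k. r k \<ge> 0" and c: "\<And>k. c k \<ge> 0"
    and M: "\<And>k. c k * r k ^ DIM('a) \<le> M * \<theta> ^ k" "M \<ge> 0" and \<theta>: "0 \<le> \<theta>" "\<theta> < 1"
  shows "integral\<^sup>N lborel f \<le> ennreal (unit_ball_vol (real DIM('a)) * M / (1 - \<theta>))"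
proof -
  have "integral\<^sup>N lborel f \<le> (\<integral>\<^sup>+y. (\<Sum>k. ennreal (c k) * indicator (ball 0 (r k)) y) \<partial>(lborel :: 'a measure))"
  proof (rule nn_integral_mono)
    fix y :: 'a
    show "f y \<le> (\<Sum>k. ennreal (c k) * indicator (ball 0 (r k)) y)"
    proof (cases "f y = 0")
      case False
      then obtain k where k: "norm y < r k" "f y \<le> ennreal (c k)" using f by blast
      define F where "F j = ennreal (c j) * indicator (ball 0 (r j)) y" for j
      have "f y \<le> F k" using k by (simp add: F_def)
      also have "\<dots> \<le> suminf F"
        using sum_le_suminf[of F "{k}"] by simp
      finally show ?thesis by (simp add: F_def[abs_def])
    qed simp
  qed
  also have "\<dots> = (\<Sum>k. \<integral>\<^sup>+y. ennreal (c k) * indicator (ball 0 (r k) :: 'a set) y \<partial>lborel)"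
    by (intro nn_integral_suminf borel_measurable_times_ennreal borel_measurable_indicator) auto
  also have "\<dots> \<le> (\<Sum>k. ennreal (unit_ball_vol (real DIM('a)) * M * \<theta> ^ k))"
  proof (intro suminf_le)
    fix k
    have "(\<integral>\<^sup>+y. ennreal (c k) * indicator (ball 0 (r k) :: 'a set) y \<partial>lborel) = ennreal (c k) * emeasure lborel (ball (0::'a) (r k))"
      by (rule nn_integral_cmult_indicator) auto
    also have "\<dots> = ennreal (unit_ball_vol (real DIM('a)) * (c k * r k ^ DIM('a)))"
      using r c by (simp add: emeasure_ball ennreal_mult[symmetric] mult_ac)
    also have "\<dots> \<le> ennreal (unit_ball_vol (real DIM('a)) * (M * \<theta> ^ k))"
      using M by (intro ennreal_leI mult_left_mono) auto
    finally show "(\<integral>\<^sup>+y. ennreal (c k) * indicator (ball 0 (r k) :: 'a set) y \<partial>lborel) \<le> ennreal (unit_ball_vol (real DIM('a)) * M * \<theta> ^ k)"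
      by (simp add: mult.assoc)
  qed auto
  also have "\<dots> = ennreal (unit_ball_vol (real DIM('a)) * M / (1 - \<theta>))"
  proof -
    have "(\<lambda>k. unit_ball_vol (real DIM('a)) * M * \<theta> ^ k) sums (unit_ball_vol (real DIM('a)) * M * (1 / (1 - \<theta>)))"
      using \<theta> by (intro sums_mult geometric_sums) auto
    then have "(\<Sum>k. ennreal (unit_ball_vol (real DIM('a)) * M * \<theta> ^ k)) = ennreal (unit_ball_vol (real DIM('a)) * M * (1 / (1 - \<theta>)))"
      by (rule suminf_ennreal_eq[rotated]) (use M(2) \<theta> in auto)
    then show ?thesis by simp
  qed
  finally show ?thesis .
qed

text \<open>Dyadic decomposition towards the origin with ratio 2^(a-N), summable because a < N. The
  scale R factors out, so the constant does not depend on it.\<close>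

lemma nn_integral_norm_powr_near_0:
  assumes a: "0 < a" "a < real DIM('a::euclidean_space)"
  obtains C where "C > 0" "\<And>R. R > 0 \<Longrightarrow> (\<integral>\<^sup>+y. ennreal (norm y powr (- a)) * indicator (ball 0 R) y \<partial>(lborel :: 'a measure)) \<le> ennreal (C * R powr (real DIM('a) - a))"
proof -
  define n where "n = real DIM('a)"
  define \<theta> where "\<theta> = 2 powr (a - n)"
  have \<theta>: "0 \<le> \<theta>" "\<theta> < 1" using a powr_less_mono[of "a - n" 0 2] by (auto simp: \<theta>_def n_def)
  define C where "C = unit_ball_vol n * 2 powr a / (1 - \<theta>)"
  have "(\<integral>\<^sup>+y. ennreal (norm y powr (- a)) * indicator (ball 0 R) y \<partial>(lborel :: 'a measure)) \<le> ennreal (C * R powr (n - a))" if R: "R > 0" for R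
  proof -
    have "(\<integral>\<^sup>+y. ennreal (norm y powr (- a)) * indicator (ball 0 R) y \<partial>(lborel :: 'a measure))
       \<le> ennreal (unit_ball_vol (real DIM('a)) * (2 powr a * R powr (n - a)) / (1 - \<theta>))"
    proof (rule nn_integral_dyadic_bound[where r="\<lambda>k. R / 2 ^ k" and c="\<lambda>k. (R / 2 ^ Suc k) powr (- a)"])
      fix y :: 'a assume "ennreal (norm y powr (- a)) * indicator (ball 0 R) y \<noteq> 0"
      then have y: "norm y > 0" "norm y < R" by (auto simp: indicator_def split: if_splits)
      obtain k0 where "R / norm y < 2 ^ k0" using real_arch_pow[of 2 "R / norm y"] by auto
      also have "(2::real) ^ k0 \<le> 2 ^ Suc k0" by simp
      finally have ex: "R / 2 ^ Suc k0 \<le> norm y" using y by (simp add: field_simps)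
      \<comment> \<open>The least index whose inner radius is at most |y|; minimality places
        \<open>y\<close> inside the corresponding outer radius.\<close>
      define k where "k = (LEAST k. R / 2 ^ Suc k \<le> norm y)"
      have k1: "R / 2 ^ Suc k \<le> norm y" unfolding k_def using ex by (rule LeastI)
      have k2: "norm y < R / 2 ^ k"
      proof (cases k)
        case 0
        then show ?thesis using y by simp
      next
        case (Suc j)
        then have "\<not> R / 2 ^ Suc j \<le> norm y" using not_less_Least[of j "\<lambda>k. R / 2 ^ Suc k \<le> norm y"] by (simp add: k_def)
        then show ?thesis using Suc by simp
      qed
      have "norm y powr (- a) \<le> (R / 2 ^ Suc k) powr (- a)"
        using k1 R a by (intro powr_mono2') auto
      then show "\<exists>k. norm y < R / 2 ^ k \<and> ennreal (norm y powr (- a)) * indicator (ball 0 R) y \<le> ennreal ((R / 2 ^ Suc k) powr (- a))"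
        using k2 y by (intro exI[of _ k]) (auto intro!: ennreal_leI)
    next
      fix k
      have "(R / 2 ^ Suc k) powr (- a) * (R / 2 ^ k) ^ DIM('a) = (R / 2 powr (real k + 1)) powr (- a) * (R / 2 powr real k) powr n"
        using R by (simp add: powr_realpow[symmetric] n_def powr_add mult.commute)
      also have "\<dots> = R powr (- a) * R powr n * (2 powr (- (real k + 1) * - a) * 2 powr (- real k * n))"
      proof -
        have q: "(R / 2 powr t) powr s = R powr s * 2 powr (- t * s)" for t s
          by (simp only: powr_divide powr_powr) (simp add: powr_minus_divide)
        show ?thesis unfolding q by (simp only: mult_ac)
      qed
      also have "\<dots> = R powr (n - a) * 2 powr (a + real k * (a - n))"
        unfolding powr_add[symmetric] by (simp add: algebra_simps)
      also have "\<dots> = 2 powr a * R powr (n - a) * \<theta> ^ k"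
        by (simp add: \<theta>_def powr_add powr_realpow[symmetric] powr_powr mult_ac)
      finally show "(R / 2 ^ Suc k) powr (- a) * (R / 2 ^ k) ^ DIM('a) \<le> 2 powr a * R powr (n - a) * \<theta> ^ k" by simp
    qed (use R \<theta> in auto)
    then show ?thesis by (simp add: C_def n_def mult_ac)
  qed
  moreover have "C > 0" using \<theta> unit_ball_vol_DIM_pos[where 'a='a] by (simp add: C_def n_def)
  ultimately show thesis using that by (simp add: n_def)
qed

text \<open>Mirror image of the preceding estimate: the shells grow, and a > N makes the ratio
  2^(N-a) less than 1.\<close>

lemma nn_integral_norm_powr_near_infinity:
  assumes a: "a > real DIM('a::euclidean_space)"
  obtains C where "C > 0" "\<And>R. R > 0 \<Longrightarrow> (\<integral>\<^sup>+y. ennreal (norm y powr (- a)) * indicator (- ball 0 R) y \<partial>(lborel :: 'a measure)) \<le> ennreal (C * R powr (real DIM('a) - a))"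
proof -
  define n where "n = real DIM('a)"
  define \<theta> where "\<theta> = 2 powr (n - a)"
  have \<theta>: "0 \<le> \<theta>" "\<theta> < 1" using a powr_less_mono[of "n - a" 0 2] by (auto simp: \<theta>_def n_def)
  have a0: "a > 0" using a by (meson le_less_trans of_nat_0_le_iff)
  define C where "C = unit_ball_vol n * 2 powr n / (1 - \<theta>)"
  have "(\<integral>\<^sup>+y. ennreal (norm y powr (- a)) * indicator (- ball 0 R) y \<partial>(lborel :: 'a measure)) \<le> ennreal (C * R powr (n - a))" if R: "R > 0" for R
  proof -
    have "(\<integral>\<^sup>+y. ennreal (norm y powr (- a)) * indicator (- ball 0 R) y \<partial>(lborel :: 'a measure))
       \<le> ennreal (unit_ball_vol (real DIM('a)) * (2 powr n * R powr (n - a)) / (1 - \<theta>))"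
    proof (rule nn_integral_dyadic_bound[where r="\<lambda>k. R * 2 ^ Suc k" and c="\<lambda>k. (R * 2 ^ k) powr (- a)"])
      fix y :: 'a assume "ennreal (norm y powr (- a)) * indicator (- ball 0 R) y \<noteq> 0"
      then have y: "norm y \<ge> R" by (auto simp: indicator_def split: if_splits)
      obtain k0 where "norm y / R < 2 ^ k0" using real_arch_pow[of 2 "norm y / R"] by auto
      also have "(2::real) ^ k0 \<le> 2 ^ Suc k0" by simp
      finally have ex: "norm y < R * 2 ^ Suc k0" using R by (simp add: field_simps)
      define k where "k = (LEAST k. norm y < R * 2 ^ Suc k)"
      have k1: "norm y < R * 2 ^ Suc k" unfolding k_def using ex by (rule LeastI)
      have k2: "R * 2 ^ k \<le> norm y"
      proof (cases k)
        case 0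
        then show ?thesis using y by simp
      next
        case (Suc j)
        then have "\<not> norm y < R * 2 ^ Suc j" using not_less_Least[of j "\<lambda>k. norm y < R * 2 ^ Suc k"] by (simp add: k_def)
        then show ?thesis using Suc by simp
      qed
      have "norm y powr (- a) \<le> (R * 2 ^ k) powr (- a)"
        using k2 R a0 by (intro powr_mono2') auto
      then show "\<exists>k. norm y < R * 2 ^ Suc k \<and> ennreal (norm y powr (- a)) * indicator (- ball 0 R) y \<le> ennreal ((R * 2 ^ k) powr (- a))"
        using k1 y by (intro exI[of _ k]) (auto intro!: ennreal_leI)
    next
      fix k
      have "(R * 2 ^ k) powr (- a) * (R * 2 ^ Suc k) ^ DIM('a) = (R * 2 powr real k) powr (- a) * (R * 2 powr (real k + 1)) powr n"
        using R by (simp add: powr_realpow[symmetric] n_def powr_add mult.commute)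
      also have "\<dots> = R powr (- a) * R powr n * (2 powr (real k * - a) * 2 powr ((real k + 1) * n))"
        using R by (simp add: powr_powr powr_mult mult_ac)
      also have "\<dots> = R powr (n - a) * 2 powr (n + real k * (n - a))"
        unfolding powr_add[symmetric] by (simp add: algebra_simps)
      also have "\<dots> = 2 powr n * R powr (n - a) * \<theta> ^ k"
        by (simp add: \<theta>_def powr_add powr_realpow[symmetric] powr_powr mult_ac)
      finally show "(R * 2 ^ k) powr (- a) * (R * 2 ^ Suc k) ^ DIM('a) \<le> 2 powr n * R powr (n - a) * \<theta> ^ k" by simp
    qed (use R \<theta> in auto)
    then show ?thesis by (simp add: C_def n_def mult_ac)
  qed
  moreover have "C > 0" using \<theta> unit_ball_vol_DIM_pos[where 'a='a] by (simp add: C_def n_def)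
  ultimately show thesis using that by (simp add: n_def)
qed

text \<open>Three regions at the scale r = |x|. Near the origin the kernel is of order
  r^(\<alpha>-N), and \<sigma> < N gives integrability of the power; at intermediate radii the power
  is of order r^(-\<sigma>), and the kernel is locally integrable; far out the product is of order
  |y|^(\<alpha>-N-\<sigma>), integrable because \<alpha> < \<sigma>. Each region contributes at most
  a multiple of r^(\<alpha>-\<sigma>).\<close>

lemma riesz_conv_power_upper:
  assumes \<alpha>: "0 < \<alpha>" "\<alpha> < \<sigma>" "\<sigma> < real DIM('a::euclidean_space)"
  obtains C where "C > 0" "\<And>x::'a. x \<noteq> 0 \<Longrightarrow> riesz_conv \<alpha> (\<lambda>y. norm y powr (- \<sigma>)) x \<le> ennreal (C * norm x powr (\<alpha> - \<sigma>))"
proof -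
  define n where "n = real DIM('a)"
  define A where "A = riesz_const DIM('a) \<alpha>"
  have A: "A > 0" unfolding A_def using \<alpha> by (intro riesz_const_pos) auto
  obtain C1 where C1: "C1 > 0" "\<And>R. R > 0 \<Longrightarrow> (\<integral>\<^sup>+y. ennreal (norm y powr (- \<sigma>)) * indicator (ball 0 R) y \<partial>(lborel :: 'a measure)) \<le> ennreal (C1 * R powr (n - \<sigma>))"
    by (rule nn_integral_norm_powr_near_0[of \<sigma>, where 'a='a, folded n_def]) (use \<alpha> in \<open>simp_all add: n_def\<close>)
  obtain C2 where C2: "C2 > 0" "\<And>R. R > 0 \<Longrightarrow> (\<integral>\<^sup>+y. ennreal (norm y powr (- (n - \<alpha>))) * indicator (ball 0 R) y \<partial>(lborel :: 'a measure)) \<le> ennreal (C2 * R powr (n - (n - \<alpha>)))"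
    by (rule nn_integral_norm_powr_near_0[of "n - \<alpha>", where 'a='a, folded n_def]) (use \<alpha> in \<open>simp_all add: n_def\<close>)
  obtain C3 where C3: "C3 > 0" "\<And>R. R > 0 \<Longrightarrow> (\<integral>\<^sup>+y. ennreal (norm y powr (- (n + \<sigma> - \<alpha>))) * indicator (- ball 0 R) y \<partial>(lborel :: 'a measure)) \<le> ennreal (C3 * R powr (n - (n + \<sigma> - \<alpha>)))"
    by (rule nn_integral_norm_powr_near_infinity[of "n + \<sigma> - \<alpha>", where 'a='a, folded n_def]) (use \<alpha> in \<open>simp_all add: n_def\<close>)
  define C where "C = A * (C1 * (1/2) powr (\<alpha> - \<sigma>) + (1/2) powr (- \<sigma>) * C2 * 3 powr \<alpha> + (1/2) powr (\<alpha> - n) * C3 * 2 powr (\<alpha> - \<sigma>))"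
  have "riesz_conv \<alpha> (\<lambda>y. norm y powr (- \<sigma>)) x \<le> ennreal (C * norm x powr (\<alpha> - \<sigma>))" if x: "x \<noteq> 0" for x :: 'a
  proof -
    define r where "r = norm x"
    have r: "r > 0" using x by (simp add: r_def)
    define T1 where "T1 y = ennreal (A * (r/2) powr (\<alpha> - n)) * (ennreal (norm y powr (- \<sigma>)) * indicator (ball 0 (r/2)) y)" for y :: 'a
    \<comment> \<open>Shifted by \<open>x\<close>, so that translation invariance moves the
      singularity of the kernel to the origin; |y| < 2r gives |x - y| < 3r.\<close>
    define T2 where "T2 y = ennreal (A * (r/2) powr (- \<sigma>)) * (ennreal (norm (y + (- x)) powr (- (n - \<alpha>))) * indicator (ball 0 (3 * r)) (y + (- x)))" for y :: 'a
    define T3 where "T3 y = ennreal (A * (1/2) powr (\<alpha> - n)) * (ennreal (norm y powr (- (n + \<sigma> - \<alpha>))) * indicator (- ball 0 (2 * r)) y)" for y :: 'a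
    have pt: "indicator ext_dom y * ennreal (riesz_kernel \<alpha> (x - y) * norm y powr (- \<sigma>)) \<le> T1 y + (T2 y + T3 y)" for y
    proof -
      have le: "indicator ext_dom y * ennreal (riesz_kernel \<alpha> (x - y) * norm y powr (- \<sigma>)) \<le> ennreal (A * norm (x - y) powr (\<alpha> - n) * norm y powr (- \<sigma>))"
        by (auto simp: indicator_def riesz_kernel_def A_def n_def)
      consider "norm y < r / 2" | "r / 2 \<le> norm y" "norm y < 2 * r" | "norm y \<ge> 2 * r" by linarith
      then have "ennreal (A * norm (x - y) powr (\<alpha> - n) * norm y powr (- \<sigma>)) \<le> T1 y \<or>
         ennreal (A * norm (x - y) powr (\<alpha> - n) * norm y powr (- \<sigma>)) \<le> T2 y \<or>
         ennreal (A * norm (x - y) powr (\<alpha> - n) * norm y powr (- \<sigma>)) \<le> T3 y"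
      proof cases
        case 1
        then have "norm (x - y) \<ge> r / 2" using norm_triangle_ineq2[of x y] by (simp add: r_def)
        then have "norm (x - y) powr (\<alpha> - n) \<le> (r / 2) powr (\<alpha> - n)" using r \<alpha> by (intro powr_mono2') (auto simp: n_def)
        then have "A * norm (x - y) powr (\<alpha> - n) * norm y powr (- \<sigma>) \<le> A * (r / 2) powr (\<alpha> - n) * norm y powr (- \<sigma>)"
          using A by (intro mult_right_mono mult_left_mono) auto
        then have "ennreal (A * norm (x - y) powr (\<alpha> - n) * norm y powr (- \<sigma>)) \<le> T1 y"
          using 1 A by (simp add: T1_def ennreal_mult[symmetric] ennreal_leI)
        then show ?thesis by simp
      next
        case 2
        then have d: "norm (x - y) < 3 * r" using norm_triangle_ineq4[of x y] by (simp add: r_def)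
        have "norm y powr (- \<sigma>) \<le> (r / 2) powr (- \<sigma>)" using 2 r \<alpha> by (intro powr_mono2') auto
        then have "A * norm (x - y) powr (\<alpha> - n) * norm y powr (- \<sigma>) \<le> A * norm (x - y) powr (\<alpha> - n) * (r / 2) powr (- \<sigma>)"
          using A by (intro mult_left_mono) auto
        then have "ennreal (A * norm (x - y) powr (\<alpha> - n) * norm y powr (- \<sigma>)) \<le> T2 y"
          using d A by (simp add: T2_def ennreal_mult[symmetric] ennreal_leI norm_minus_commute mult_ac)
        then show ?thesis by simp
      next
        case 3
        then have y: "norm y > 0" using r by linarith
        have "norm (x - y) \<ge> norm y / 2" using norm_triangle_ineq2[of y x] 3 by (simp add: r_def norm_minus_commute)
        then have "norm (x - y) powr (\<alpha> - n) \<le> (norm y / 2) powr (\<alpha> - n)" using y \<alpha> by (intro powr_mono2') (auto simp: n_def)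
        also have "\<dots> = (1/2) powr (\<alpha> - n) * norm y powr (\<alpha> - n)" using powr_mult[of "1/2" "norm y"] by simp
        finally have "A * norm (x - y) powr (\<alpha> - n) * norm y powr (- \<sigma>) \<le> A * ((1/2) powr (\<alpha> - n) * norm y powr (\<alpha> - n)) * norm y powr (- \<sigma>)"
          using A by (intro mult_right_mono mult_left_mono) auto
        also have "\<dots> = (A * (1/2) powr (\<alpha> - n)) * norm y powr (- (n + \<sigma> - \<alpha>))"
          by (simp only: mult.assoc powr_add[symmetric]) (simp add: algebra_simps)
        finally have "ennreal (A * norm (x - y) powr (\<alpha> - n) * norm y powr (- \<sigma>)) \<le> T3 y"
          using 3 A by (simp add: T3_def ennreal_mult[symmetric] ennreal_leI)
        then show ?thesis by simp
      qed
      then have "ennreal (A * norm (x - y) powr (\<alpha> - n) * norm y powr (- \<sigma>)) \<le> T1 y + (T2 y + T3 y)"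
      proof (elim disjE)
        assume "ennreal (A * norm (x - y) powr (\<alpha> - n) * norm y powr (- \<sigma>)) \<le> T1 y"
        then show ?thesis by (rule add_increasing2[OF zero_le])
      next
        assume "ennreal (A * norm (x - y) powr (\<alpha> - n) * norm y powr (- \<sigma>)) \<le> T2 y"
        then show ?thesis by (intro add_increasing[OF zero_le] add_increasing2[OF zero_le])
      next
        assume "ennreal (A * norm (x - y) powr (\<alpha> - n) * norm y powr (- \<sigma>)) \<le> T3 y"
        then show ?thesis by (intro add_increasing[OF zero_le])
      qed
      with le show ?thesis by (rule order_trans)
    qed
    have [measurable]: "ball (0::'a) s \<in> sets borel" for s by simp
    have [measurable]: "T1 \<in> borel_measurable borel" "T2 \<in> borel_measurable borel" "T3 \<in> borel_measurable borel"
      unfolding T1_def[abs_def] T2_def[abs_def] T3_def[abs_def] by measurable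
    have I1: "integral\<^sup>N lborel T1 \<le> ennreal (A * (C1 * (1/2) powr (\<alpha> - \<sigma>)) * r powr (\<alpha> - \<sigma>))"
    proof -
      have "integral\<^sup>N lborel T1 \<le> ennreal (A * (r/2) powr (\<alpha> - n)) * ennreal (C1 * (r/2) powr (n - \<sigma>))"
        unfolding T1_def using C1(2)[of "r/2"] r by (subst nn_integral_cmult) (auto intro!: mult_left_mono)
      also have "\<dots> = ennreal (A * (C1 * ((r/2) powr (\<alpha> - n) * (r/2) powr (n - \<sigma>))))"
        using A C1 by (simp add: ennreal_mult[symmetric] mult_ac)
      also have "(r/2) powr (\<alpha> - n) * (r/2) powr (n - \<sigma>) = (1/2 * r) powr (\<alpha> - \<sigma>)"
        unfolding powr_add[symmetric] by simp
      also have "(1/2 * r) powr (\<alpha> - \<sigma>) = (1/2) powr (\<alpha> - \<sigma>) * r powr (\<alpha> - \<sigma>)" by (rule powr_mult)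
      finally show ?thesis by (simp add: mult.assoc)
    qed
    have I2: "integral\<^sup>N lborel T2 \<le> ennreal (A * ((1/2) powr (- \<sigma>) * C2 * 3 powr \<alpha>) * r powr (\<alpha> - \<sigma>))"
    proof -
      have "integral\<^sup>N lborel T2 = ennreal (A * (r/2) powr (- \<sigma>)) * (\<integral>\<^sup>+y. (\<lambda>z. ennreal (norm z powr (- (n - \<alpha>))) * indicator (ball 0 (3 * r)) z) (y + (- x)) \<partial>lborel)"
        unfolding T2_def by (subst nn_integral_cmult) auto
      also have "(\<integral>\<^sup>+y. (\<lambda>z. ennreal (norm z powr (- (n - \<alpha>))) * indicator (ball 0 (3 * r)) z) (y + (- x)) \<partial>lborel)
         = (\<integral>\<^sup>+z. ennreal (norm z powr (- (n - \<alpha>))) * indicator (ball 0 (3 * r)) z \<partial>(lborel :: 'a measure))"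
        by (rule lborel_nn_integral_translate[of "\<lambda>z. ennreal (norm z powr (- (n - \<alpha>))) * indicator (ball 0 (3 * r)) z" "- x"]) measurable
      also have "ennreal (A * (r/2) powr (- \<sigma>)) * \<dots> \<le> ennreal (A * (r/2) powr (- \<sigma>)) * ennreal (C2 * (3 * r) powr (n - (n - \<alpha>)))"
        using C2(2)[of "3 * r"] r by (intro mult_left_mono) auto
      also have "\<dots> = ennreal (A * ((1/2 * r) powr (- \<sigma>) * (C2 * (3 * r) powr \<alpha>)))"
        using A C2 by (simp add: ennreal_mult[symmetric] mult_ac)
      also have "(1/2 * r) powr (- \<sigma>) * (C2 * (3 * r) powr \<alpha>) = (1/2) powr (- \<sigma>) * C2 * 3 powr \<alpha> * (r powr (- \<sigma>) * r powr \<alpha>)"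
        unfolding powr_mult by (simp only: mult_ac)
      also have "r powr (- \<sigma>) * r powr \<alpha> = r powr (\<alpha> - \<sigma>)" unfolding powr_add[symmetric] by simp
      finally show ?thesis by (simp only: mult.assoc)
    qed
    have I3: "integral\<^sup>N lborel T3 \<le> ennreal (A * ((1/2) powr (\<alpha> - n) * C3 * 2 powr (\<alpha> - \<sigma>)) * r powr (\<alpha> - \<sigma>))"
    proof -
      have "integral\<^sup>N lborel T3 \<le> ennreal (A * (1/2) powr (\<alpha> - n)) * ennreal (C3 * (2 * r) powr (n - (n + \<sigma> - \<alpha>)))"
        unfolding T3_def using C3(2)[of "2 * r"] r by (subst nn_integral_cmult) (auto intro!: mult_left_mono)
      also have "n - (n + \<sigma> - \<alpha>) = \<alpha> - \<sigma>" by simp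
      also have "ennreal (A * (1/2) powr (\<alpha> - n)) * ennreal (C3 * (2 * r) powr (\<alpha> - \<sigma>)) = ennreal (A * (1/2) powr (\<alpha> - n) * (C3 * (2 * r) powr (\<alpha> - \<sigma>)))"
        using A C3 by (intro ennreal_mult[symmetric]) auto
      also have "A * (1/2) powr (\<alpha> - n) * (C3 * (2 * r) powr (\<alpha> - \<sigma>)) = A * ((1/2) powr (\<alpha> - n) * C3 * 2 powr (\<alpha> - \<sigma>)) * r powr (\<alpha> - \<sigma>)"
        unfolding powr_mult by (simp only: mult_ac)
      finally show ?thesis .
    qed
    have "riesz_conv \<alpha> (\<lambda>y. norm y powr (- \<sigma>)) x \<le> (\<integral>\<^sup>+y. T1 y + (T2 y + T3 y) \<partial>lborel)"
      unfolding riesz_conv_def nn_integral_completion by (rule nn_integral_mono) (rule pt)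
    also have "\<dots> = integral\<^sup>N lborel T1 + (integral\<^sup>N lborel T2 + integral\<^sup>N lborel T3)"
      by (simp add: nn_integral_add)
    also have "\<dots> \<le> ennreal (A * (C1 * (1/2) powr (\<alpha> - \<sigma>)) * r powr (\<alpha> - \<sigma>))
      + (ennreal (A * ((1/2) powr (- \<sigma>) * C2 * 3 powr \<alpha>) * r powr (\<alpha> - \<sigma>))
      + ennreal (A * ((1/2) powr (\<alpha> - n) * C3 * 2 powr (\<alpha> - \<sigma>)) * r powr (\<alpha> - \<sigma>)))"
      by (intro add_mono I1 I2 I3)
    also have "\<dots> = ennreal (A * (C1 * (1/2) powr (\<alpha> - \<sigma>)) * r powr (\<alpha> - \<sigma>)
      + (A * ((1/2) powr (- \<sigma>) * C2 * 3 powr \<alpha>) * r powr (\<alpha> - \<sigma>)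
      + A * ((1/2) powr (\<alpha> - n) * C3 * 2 powr (\<alpha> - \<sigma>)) * r powr (\<alpha> - \<sigma>)))"
      using A C1 C2 C3 by (simp add: ennreal_plus[symmetric] del: ennreal_plus)
    also have "\<dots> = ennreal (C * norm x powr (\<alpha> - \<sigma>))" by (simp add: C_def r_def algebra_simps)
    finally show ?thesis .
  qed
  moreover have "C > 0" unfolding C_def using A C1 C2 C3 by (auto intro!: mult_pos_pos add_pos_pos)
  ultimately show thesis using that by blast
qed

section \<open>Sufficiency\<close>

lemma Lloc_continuous:
  fixes f :: "'a::euclidean_space \<Rightarrow> real"
  assumes "continuous_on \<Omega> f" "r > 0"
  shows "Lloc r \<Omega> f"
  unfolding Lloc_def
proof (intro allI impI)
  fix K :: "'a set" assume K: "compact K \<and> K \<subseteq> \<Omega>"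
  have i: "set_integrable lebesgue K g" if "continuous_on K g" for g :: "'a \<Rightarrow> real"
  proof -
    have "integrable lborel (\<lambda>x. indicator K x *\<^sub>R g x)"
      using K that by (intro borel_integrable_compact) auto
    moreover from this have "(\<lambda>x. indicator K x *\<^sub>R g x) \<in> borel_measurable lborel" by auto
    ultimately show ?thesis by (simp add: set_integrable_def integrable_completion)
  qed
  have c: "continuous_on K f" using assms K continuous_on_subset by blast
  have "continuous_on K (\<lambda>x. \<bar>f x\<bar> powr r)"
    using assms by (intro continuous_on_powr' continuous_intros c) auto
  with c show "set_integrable lebesgue K f \<and> set_integrable lebesgue K (\<lambda>x. \<bar>f x\<bar> powr r)"
    by (intro conjI i)
qed

lemma continuous_on_power_grad: "continuous_on (ext_dom :: 'a::euclidean_space set) (power_grad c \<gamma>)"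
  unfolding power_grad_def[abs_def] by (intro continuous_intros continuous_on_norm_powr_ext_dom)

lemma W1loc_power:
  assumes m: "m > 1"
  shows "W1loc m (ext_dom :: 'a::euclidean_space set) (\<lambda>x. c * norm x powr (- \<gamma>)) (power_grad c \<gamma>)"
proof -
  have cu: "continuous_on (ext_dom :: 'a set) (\<lambda>x. c * norm x powr (- \<gamma>))"
    by (intro continuous_intros continuous_on_norm_powr_ext_dom)
  have cg: "continuous_on (ext_dom :: 'a set) (\<lambda>x. norm (power_grad c \<gamma> x))"
    by (intro continuous_intros continuous_on_power_grad)
  have "(\<lambda>x. indicator (ext_dom :: 'a set) x *\<^sub>R power_grad c \<gamma> x) \<in> borel_measurable borel"
    by (intro borel_measurable_continuous_on_indicator continuous_on_power_grad) measurable
  then have "set_borel_measurable lebesgue (ext_dom :: 'a set) (power_grad c \<gamma>)"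
    unfolding set_borel_measurable_def by (intro measurable_completion) simp
  moreover have "(LINT x:ext_dom|lebesgue. (c * norm x powr (- \<gamma>)) * frechet_derivative \<phi> (at x) b)
      = - (LINT x:ext_dom|lebesgue. (power_grad c \<gamma> x \<bullet> b) * \<phi> x)"
    if "test_fun ext_dom \<phi>" "b \<in> Basis" for \<phi> :: "'a \<Rightarrow> real" and b
  proof -
    have "(LINT x:ext_dom|lebesgue. (c * norm x powr (- \<gamma>)) * frechet_derivative \<phi> (at x) b)
      = - (LINT x:ext_dom|lebesgue. (b \<bullet> power_grad c \<gamma> x) * \<phi> x)"
      by (rule test_fun_integration_by_parts[where g'="\<lambda>x h. h \<bullet> power_grad c \<gamma> x", OF open_ext_dom that(1) _ _ that(2)])
         (auto intro!: power_has_derivative ext_dom_nonzero continuous_intros continuous_on_power_grad)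
    then show ?thesis by (simp add: inner_commute)
  qed
  ultimately show ?thesis
    using m by (auto simp: W1loc_def weak_grad_def intro!: Lloc_continuous cu cg)
qed

text \<open>For g < b the power c |x|^(-g) leaves the surplus c^(m-1) (K(b) - K(g)) |x|^(-g(m-1)-m)
  on the left. By (iii) and (iv) the nonlocal term decays at least as fast, and since the amplitudes
  enter with different exponents, p + q and m - 1, \<open>c\<close> can balance the
  constants.\<close>

lemma pos_solution_sufficient:
  assumes m: "m > 1" and N: "real DIM('a::euclidean_space) \<le> m" and p: "p > 0" and \<alpha>: "0 < \<alpha>" "\<alpha> < real DIM('a)"
    and b: "b > 0" "Kfun m DIM('a) b = - \<mu>" and c2: "p * b > \<alpha>"
    and c3: "m + \<alpha> < b * (p + q - (m - 1))" and c4: "m + \<alpha> - real DIM('a) < b * (q - (m - 1))"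
  shows "\<exists>u :: 'a \<Rightarrow> real. pos_solution m \<mu> p q \<alpha> u"
proof -
  define n where "n = real DIM('a)"
  define s where "s = p + q - (m - 1)"
  have s: "s > 0" using c3 b m \<alpha> zero_less_mult_pos[of b s] by (simp add: s_def)
  \<comment> \<open>All conditions are strict, hence survive a small decrease of the exponent from
    \<open>b\<close> to \<open>g\<close>.\<close>
  have "eventually (\<lambda>g. \<alpha> < p * g) (at_left b)" "eventually (\<lambda>g. m + \<alpha> < g * s) (at_left b)"
    "eventually (\<lambda>g. m + \<alpha> - n < g * (q - (m - 1))) (at_left b)" "eventually (\<lambda>g. 0 < g) (at_left b)"
    by (rule order_tendstoD(1)[OF _ c2] order_tendstoD(1)[OF _ c3[folded s_def]] order_tendstoD(1)[OF _ c4[folded n_def]]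
        order_tendstoD(1)[OF _ b(1)]; intro tendsto_intros)+
  moreover have "eventually (\<lambda>g. g < b) (at_left b)" by (simp add: eventually_at_filter)
  ultimately have "eventually (\<lambda>g. \<alpha> < p * g \<and> m + \<alpha> < g * s \<and> m + \<alpha> - n < g * (q - (m - 1)) \<and> 0 < g \<and> g < b) (at_left b)"
    by eventually_elim simp
  then obtain g where g: "\<alpha> < p * g" "m + \<alpha> < g * s" "m + \<alpha> - n < g * (q - (m - 1))" "0 < g" "g < b"
    using eventually_happens[of _ "at_left b"] by (auto simp: trivial_limit_at_left_real)
  \<comment> \<open>If p g is close to N or above it, |y|^(-p g) is replaced by the larger
    |y|^(-\<sigma>) with \<sigma> slightly below N, where the potential estimate holds.
    \<open>\<delta>\<close> is a loss that the strict form of (iv) affords, and the bound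
    (N-\<alpha>)/2 keeps \<sigma> above \<alpha>.\<close>
  define \<delta> where "\<delta> = min ((n - \<alpha>) / 2) (g * (q - (m - 1)) - (m + \<alpha> - n))"
  have \<delta>: "\<delta> > 0" "\<delta> \<le> (n - \<alpha>) / 2" "\<delta> \<le> g * (q - (m - 1)) - (m + \<alpha> - n)"
    using g \<alpha> unfolding \<delta>_def by (simp add: n_def, intro min.cobounded1, intro min.cobounded2)
  define \<sigma> where "\<sigma> = min (p * g) (n - \<delta>)"
  have \<sigma>: "\<alpha> < \<sigma>" "\<sigma> < n" "\<sigma> \<le> p * g"
    using g \<delta> \<alpha> by (auto simp: \<sigma>_def n_def min_def field_simps)
  \<comment> \<open>The comparison of decay rates: (iii) settles the case \<sigma> = p g, the choice
    of \<open>\<delta>\<close> the case \<sigma> = N - \<delta>.\<close>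
  have \<sigma>2: "g * (m - 1) + m \<le> q * g + \<sigma> - \<alpha>"
    using g \<delta>(3) by (auto simp: \<sigma>_def s_def min_def algebra_simps)
  obtain C where C: "C > 0" "\<And>x::'a. x \<noteq> 0 \<Longrightarrow> riesz_conv \<alpha> (\<lambda>y. norm y powr (- \<sigma>)) x \<le> ennreal (C * norm x powr (\<alpha> - \<sigma>))"
    using riesz_conv_power_upper[of \<alpha> \<sigma>, where 'a='a] \<alpha> \<sigma> unfolding n_def by blast
  define D where "D = Kfun m DIM('a) b - Kfun m DIM('a) g"
  have D: "D > 0" using Kfun_strict_mono[OF m N, of g b] g by (simp add: D_def)
  \<comment> \<open>Solves c^(p+q) C = c^(m-1) D, so that the upper bound of the nonlocal term
    equals the surplus.\<close>
  define c where "c = (D / C) powr (1 / s)"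
  have c: "c > 0" using C D by (simp add: c_def)
  have cs: "c powr (p + q) * C = c powr (m - 1) * D"
  proof -
    have "c powr s = D / C" using C D s by (simp add: c_def powr_powr)
    moreover have "c powr (p + q) = c powr s * c powr (m - 1)" unfolding powr_add[symmetric] by (simp add: s_def)
    ultimately show ?thesis using C by simp
  qed
  define u where "u x = c * norm x powr (- g)" for x :: 'a
  have up: "u y powr p \<le> c powr p * norm y powr (- \<sigma>)" if "y \<in> ext_dom" for y
  proof -
    have "u y powr p = c powr p * norm y powr (- (p * g))"
      using c by (simp add: u_def powr_mult powr_powr mult.commute)
    also have "\<dots> \<le> c powr p * norm y powr (- \<sigma>)"
      using that \<sigma> by (intro mult_left_mono powr_mono) (auto simp: ext_dom_iff)
    finally show ?thesis .
  qed
  have riesz: "riesz_pow \<alpha> p u x \<le> ennreal (c powr p * C * norm x powr (\<alpha> - \<sigma>))" if "x \<in> ext_dom" for x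
  proof -
    have A: "riesz_const DIM('a) \<alpha> > 0" using riesz_const_pos[OF \<alpha>] .
    have "riesz_pow \<alpha> p u x
       \<le> (\<integral>\<^sup>+y. ennreal (c powr p) * (indicator ext_dom y * ennreal (riesz_kernel \<alpha> (x - y) * norm y powr (- \<sigma>))) \<partial>lborel)"
      unfolding riesz_conv_def nn_integral_completion
    proof (rule nn_integral_mono)
      fix y :: 'a
      show "indicator ext_dom y * ennreal (riesz_kernel \<alpha> (x - y) * u y powr p)
        \<le> ennreal (c powr p) * (indicator ext_dom y * ennreal (riesz_kernel \<alpha> (x - y) * norm y powr (- \<sigma>)))"
      proof (cases "y \<in> ext_dom")
        case True
        have "riesz_kernel \<alpha> (x - y) * u y powr p \<le> riesz_kernel \<alpha> (x - y) * (c powr p * norm y powr (- \<sigma>))"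
          using up[OF True] A by (intro mult_left_mono) (auto simp: riesz_kernel_def)
        then show ?thesis using True A by (simp add: ennreal_mult[symmetric] riesz_kernel_def ennreal_leI mult_ac)
      qed simp
    qed
    also have "\<dots> = ennreal (c powr p) * riesz_conv \<alpha> (\<lambda>y. norm y powr (- \<sigma>)) x"
      unfolding riesz_conv_def nn_integral_completion riesz_kernel_def by (rule nn_integral_cmult) measurable
    also have "\<dots> \<le> ennreal (c powr p) * ennreal (C * norm x powr (\<alpha> - \<sigma>))"
      using C(2)[OF ext_dom_nonzero[OF that]] by (intro mult_left_mono) auto
    also have "\<dots> = ennreal (c powr p * C * norm x powr (\<alpha> - \<sigma>))"
      using C by (simp add: ennreal_mult[symmetric] mult_ac)
    finally show ?thesis .
  qed
  have nonlin: "riesz_pow \<alpha> p u x * ennreal (u x powr q) \<le> ennreal (c powr (p + q) * C * norm x powr (- (g * (m - 1) + m)))"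
    if x: "x \<in> ext_dom" for x
  proof -
    have "riesz_pow \<alpha> p u x * ennreal (u x powr q) \<le> ennreal (c powr p * C * norm x powr (\<alpha> - \<sigma>)) * ennreal (u x powr q)"
      using riesz[OF x] by (intro mult_right_mono) auto
    also have "\<dots> = ennreal (c powr p * C * norm x powr (\<alpha> - \<sigma>) * u x powr q)"
      using C by (intro ennreal_mult[symmetric]) auto
    also have "c powr p * C * norm x powr (\<alpha> - \<sigma>) * u x powr q = (c powr p * c powr q) * C * (norm x powr (\<alpha> - \<sigma>) * norm x powr (- g * q))"
      using c by (simp add: u_def powr_mult powr_powr mult_ac)
    also have "\<dots> = c powr (p + q) * C * norm x powr (\<alpha> - \<sigma> + - g * q)"
      by (simp only: powr_add)
    also have "\<dots> \<le> c powr (p + q) * C * norm x powr (- (g * (m - 1) + m))"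
      using \<sigma>2 C x by (intro mult_left_mono powr_mono) (auto simp: ext_dom_iff algebra_simps)
    finally show ?thesis by (simp add: ennreal_leI)
  qed
  have "pos_solution m \<mu> p q \<alpha> u"
    unfolding pos_solution_def
  proof (intro conjI exI[of _ "power_grad c g"] allI impI ballI)
    show "continuous_on ext_dom u" unfolding u_def by (intro continuous_intros continuous_on_norm_powr_ext_dom)
    show "0 < u x" if "x \<in> ext_dom" for x using c ext_dom_nonzero[OF that] by (simp add: u_def)
    show "W1loc m ext_dom u (power_grad c g)" unfolding u_def using m by (rule W1loc_power)
  next
    fix K :: "'a set" assume K: "compact K \<and> K \<subseteq> ext_dom"
    define h where "h x = c powr (p + q) * C * norm x powr (- (g * (m - 1) + m))" for x :: 'a
    have hi: "integrable lborel (\<lambda>x. indicator K x *\<^sub>R h x)"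
      unfolding h_def using K
      by (intro borel_integrable_compact continuous_intros continuous_on_subset[OF continuous_on_norm_powr_ext_dom]) auto
    have "(\<integral>\<^sup>+ x. indicator K x * riesz_pow \<alpha> p u x * ennreal (u x powr q) \<partial>lebesgue)
      \<le> (\<integral>\<^sup>+ x. ennreal (indicator K x *\<^sub>R h x) \<partial>lborel)"
      unfolding nn_integral_completion
    proof (rule nn_integral_mono)
      fix x :: 'a
      show "indicator K x * riesz_pow \<alpha> p u x * ennreal (u x powr q) \<le> ennreal (indicator K x *\<^sub>R h x)"
        using nonlin[of x] K by (cases "x \<in> K") (auto simp: h_def)
    qed
    also have "\<dots> < \<infinity>"
      using hi C by (subst nn_integral_eq_integral) (auto simp: h_def)
    finally show "(\<integral>\<^sup>+ x. indicator K x * riesz_pow \<alpha> p u x * ennreal (u x powr q) \<partial>lebesgue) < \<infinity>" .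
  next
    obtain C' where C': "C' > 0" "\<And>R. R > 0 \<Longrightarrow> (\<integral>\<^sup>+y. ennreal (norm y powr (- (n + \<sigma> - \<alpha>))) * indicator (- ball 0 R) y \<partial>(lborel :: 'a measure)) \<le> ennreal (C' * R powr (n - (n + \<sigma> - \<alpha>)))"
      by (rule nn_integral_norm_powr_near_infinity[of "n + \<sigma> - \<alpha>", where 'a='a, folded n_def]) (use \<sigma> in \<open>simp_all add: n_def\<close>)
    have "(\<integral>\<^sup>+ y. indicator ext_dom y * ennreal (u y powr p / (1 + norm y powr (n - \<alpha>))) \<partial>lebesgue)
      \<le> (\<integral>\<^sup>+ y. ennreal (c powr p) * (ennreal (norm y powr (- (n + \<sigma> - \<alpha>))) * indicator (- ball 0 1) y) \<partial>(lborel :: 'a measure))"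
      unfolding nn_integral_completion
    proof (rule nn_integral_mono)
      fix y :: 'a
      show "indicator ext_dom y * ennreal (u y powr p / (1 + norm y powr (n - \<alpha>)))
        \<le> ennreal (c powr p) * (ennreal (norm y powr (- (n + \<sigma> - \<alpha>))) * indicator (- ball 0 1) y)"
      proof (cases "y \<in> ext_dom")
        case True
        have "u y powr p / (1 + norm y powr (n - \<alpha>)) \<le> (c powr p * norm y powr (- \<sigma>)) / norm y powr (n - \<alpha>)"
          using up[OF True] ext_dom_nonzero[OF True] by (intro frac_le) auto
        also have "\<dots> = c powr p * norm y powr (- (n + \<sigma> - \<alpha>))"
        proof -
          have "norm y powr (- \<sigma>) / norm y powr (n - \<alpha>) = norm y powr (- (n + \<sigma> - \<alpha>))"
            unfolding powr_diff[symmetric] by (simp add: algebra_simps)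
          then show ?thesis by (metis times_divide_eq_right)
        qed
        finally show ?thesis using True by (simp add: ext_dom_iff ennreal_mult[symmetric] ennreal_leI)
      qed simp
    qed
    also have "\<dots> = ennreal (c powr p) * (\<integral>\<^sup>+ y. ennreal (norm y powr (- (n + \<sigma> - \<alpha>))) * indicator (- ball 0 1) y \<partial>(lborel :: 'a measure))"
    proof -
      have [measurable]: "ball (0::'a) s \<in> sets borel" for s by simp
      show ?thesis by (rule nn_integral_cmult) measurable
    qed
    also have "\<dots> \<le> ennreal (c powr p) * ennreal (C' * 1 powr (n - (n + \<sigma> - \<alpha>)))"
      by (intro mult_left_mono C') auto
    also have "\<dots> < \<infinity>" by (simp add: ennreal_mult_less_top)
    finally show "(\<integral>\<^sup>+ y. indicator ext_dom y * ennreal (u y powr p / (1 + norm y powr (real DIM('a) - \<alpha>))) \<partial>lebesgue) < \<infinity>"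
      by (simp add: n_def)
  next
    fix \<phi> :: "'a \<Rightarrow> real" assume "test_fun ext_dom \<phi> \<and> (\<forall>x. 0 \<le> \<phi> x)"
    then have t: "test_fun ext_dom \<phi>" and phi: "\<And>x. 0 \<le> \<phi> x" by auto
    note tf = test_fun_facts[OF t]
    define P where "P x = norm x powr (- (g * (m - 1) + m)) * \<phi> x" for x
    define J where "J = (LINT x:ext_dom|lebesgue. P x)"
    have P0: "P x \<ge> 0" for x using phi by (simp add: P_def)
    have Pi: "set_integrable lebesgue ext_dom P"
    proof (rule set_integrable_compact_support[OF tf(4) continuous_on_subset[OF _ tf(5)] _ tf(5)])
      show "continuous_on ext_dom P" unfolding P_def
        by (intro continuous_intros continuous_on_norm_powr_ext_dom continuous_on_subset[OF tf(1)]) auto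
    qed (use tf in \<open>auto simp: P_def\<close>)
    have J0: "J \<ge> 0" unfolding J_def set_lebesgue_integral_def
      using P0 by (intro Bochner_Integration.integral_nonneg) auto
    define X where "X = (\<integral>\<^sup>+ x. indicator ext_dom x * riesz_pow \<alpha> p u x * ennreal (u x powr q * \<phi> x) \<partial>lebesgue)"
    have k0: "c powr (p + q) * C \<ge> 0" using C by simp
    have "X \<le> (\<integral>\<^sup>+ x. ennreal (c powr (p + q) * C * (indicator ext_dom x *\<^sub>R P x)) \<partial>lebesgue)"
      unfolding X_def
    proof (rule nn_integral_mono)
      fix x :: 'a
      show "indicator ext_dom x * riesz_pow \<alpha> p u x * ennreal (u x powr q * \<phi> x)
        \<le> ennreal (c powr (p + q) * C * (indicator ext_dom x *\<^sub>R P x))"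
      proof (cases "x \<in> ext_dom")
        case True
        have "indicator ext_dom x * riesz_pow \<alpha> p u x * ennreal (u x powr q * \<phi> x)
          = (riesz_pow \<alpha> p u x * ennreal (u x powr q)) * ennreal (\<phi> x)"
          using True phi by (simp add: ennreal_mult mult_ac)
        also have "\<dots> \<le> ennreal (c powr (p + q) * C * norm x powr (- (g * (m - 1) + m))) * ennreal (\<phi> x)"
          by (intro mult_right_mono nonlin True) auto
        also have "\<dots> = ennreal (c powr (p + q) * C * (indicator ext_dom x *\<^sub>R P x))"
          using True phi C by (simp add: P_def ennreal_mult[symmetric] mult_ac)
        finally show ?thesis .
      qed simp
    qed
    also have "\<dots> = ennreal (c powr (p + q) * C * J)"
    proof -
      have "integrable lebesgue (\<lambda>x. c powr (p + q) * C * (indicator ext_dom x *\<^sub>R P x))"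
        using Pi unfolding set_integrable_def by (rule integrable_mult_right)
      moreover have "(\<integral>x. c powr (p + q) * C * (indicator ext_dom x *\<^sub>R P x) \<partial>lebesgue) = c powr (p + q) * C * J"
        by (simp add: J_def set_lebesgue_integral_def)
      ultimately show ?thesis using k0 P0 by (subst nn_integral_eq_integral) auto
    qed
    finally have "enn2real X \<le> c powr (p + q) * C * J"
      using k0 J0 by (intro enn2real_leI) auto
    \<comment> \<open>From here on the chain consists of identities: the surplus is rewritten as the
      flux of the power minus its Hardy term.\<close>
    also have "\<dots> = c powr (m - 1) * D * J" by (simp add: cs)
    also have "\<dots> = - (c powr (m - 1) * Kfun m DIM('a) g * J) - \<mu> * c powr (m - 1) * J"
      using b by (simp add: D_def algebra_simps)
    also have "\<dots> = (LINT x:ext_dom|lebesgue. flux m (power_grad c g) \<phi> x)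
       - (LINT x:ext_dom|lebesgue. \<mu> * c powr (m - 1) * P x)"
      using power_flux_integral[OF t c g(4), of m] by (simp add: J_def P_def)
    also have "\<dots> = (LINT x:ext_dom|lebesgue. flux m (power_grad c g) \<phi> x
       - \<mu> * c powr (m - 1) * P x)"
      using Pi flux_integrable[OF m W1loc_power[OF m] t] by (intro set_integral_diff(2)[symmetric]) auto
    also have "\<dots> = (LINT x:ext_dom|lebesgue. flux m (power_grad c g) \<phi> x
       - \<mu> / norm x powr m * u x powr (m - 1) * \<phi> x)"
    proof -
      have "\<mu> * c powr (m - 1) * P x = \<mu> / norm x powr m * u x powr (m - 1) * \<phi> x" for x :: 'a
      proof -
        have "u x powr (m - 1) = c powr (m - 1) * norm x powr (- (g * (m - 1)))"
          using c by (simp add: u_def powr_mult powr_powr)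
        moreover have "norm x powr (- (g * (m - 1) + m)) = norm x powr (- (g * (m - 1))) * norm x powr (- m)"
          unfolding powr_add[symmetric] by simp
        ultimately show ?thesis by (simp add: P_def powr_minus[of _ m] divide_inverse mult_ac)
      qed
      then show ?thesis by simp
    qed
    finally show "enn2real (\<integral>\<^sup>+ x. indicator ext_dom x * riesz_pow \<alpha> p u x * ennreal (u x powr q * \<phi> x) \<partial>lebesgue)
      \<le> (LINT x:ext_dom|lebesgue. flux m (power_grad c g) \<phi> x
               - \<mu> / norm x powr m * u x powr (m - 1) * \<phi> x)"
      unfolding X_def .
  qed
  then show ?thesis by blast
qed

theorem theorem1p2:
  fixes m \<mu> p q \<alpha> :: real
  assumes "m > 1" and "real DIM('a::euclidean_space) \<le> m" and "p > 0"
    and "0 < \<alpha>" and "\<alpha> < real DIM('a)"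
  shows "(\<exists>u :: 'a \<Rightarrow> real. pos_solution m \<mu> p q \<alpha> u) \<longleftrightarrow>
    (\<mu> < 0 \<and>
     p > \<alpha> / \<bar>beta_minus m DIM('a) \<mu>\<bar> \<and>
     p + q > m - 1 + (m + \<alpha>) / \<bar>beta_minus m DIM('a) \<mu>\<bar> \<and>
     q > m - 1 - (real DIM('a) - m - \<alpha>) / \<bar>beta_minus m DIM('a) \<mu>\<bar>)"
    (is "?L \<longleftrightarrow> ?R")
proof -
  have conv: "(p > \<alpha> / b \<and> p + q > m - 1 + (m + \<alpha>) / b \<and> q > m - 1 - (real DIM('a) - m - \<alpha>) / b)
     \<longleftrightarrow> (p * b > \<alpha> \<and> m + \<alpha> < b * (p + q - (m - 1)) \<and> m + \<alpha> - real DIM('a) < b * (q - (m - 1)))" if "b > 0" for b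
    using that by (simp add: field_simps)
  show ?thesis
  proof
    assume ?L
    then obtain u :: "'a \<Rightarrow> real" where "pos_solution m \<mu> p q \<alpha> u" by blast
    from pos_solution_necessary[OF assms this]
    obtain b where b: "b > 0" "Kfun m DIM('a) b = - \<mu>" "\<mu> < 0" "p * b > \<alpha>"
      "m + \<alpha> < b * (p + q - (m - 1))" "m + \<alpha> - real DIM('a) < b * (q - (m - 1))" by blast
    then have "\<bar>beta_minus m DIM('a) \<mu>\<bar> = b" using beta_minus_eq[OF assms(1,2)] by simp
    then show ?R using b conv[OF b(1)] by simp
  next
    assume R: ?R
    obtain b where b: "b > 0" "Kfun m DIM('a) b = - \<mu>" using Kfun_surj[OF assms(1,2), of "- \<mu>"] R by auto
    then have "\<bar>beta_minus m DIM('a) \<mu>\<bar> = b" using beta_minus_eq[OF assms(1,2)] by simp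
    then show ?L using R conv[OF b(1)] by (intro pos_solution_sufficient[OF assms b]) auto
  qed
qed

end
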